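(* Let $C>0$ be arbitrary. For all integers $N \geq 3$ and all real $0<t \le (\log N)^C$, we have \[ \frac{1}{\varphi(N)} \left| \left\{ a \in \mathbb{Z}_N^* \, : \, \left| D \left( \frac{a}{N} \right) \right| \geq t \log N \right\} \right| \ll \frac{1}{t} \] with an implied constant depending only on $C$.
   Context: For an integer $N\ge 2$, $\mathbb{Z}_N^*$ denotes the set of integers $1\le a\le N$ coprime to $N$, and $\varphi$ is Euler's totient function. For $a\in\mathbb{Z}_N^*$, the Dedekind sum is \[ D \left( \frac{a}{N} \right) = \sum_{b=1}^{N-1} \left( \frac{b}{N} - \frac{1}{2} \right) \left( \left\{ \frac{ba}{N} \right\} - \frac{1}{2} \right), \] where $\{\cdot\}$ denotes the fractional part. *)

theory Defs
  imports Complex_Main "HOL-Number_Theory.Number_Theory"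
begin

definition dedekind_sum :: "nat \<Rightarrow> nat \<Rightarrow> real" where
  "dedekind_sum a N =
     (\<Sum>b = 1..N - 1. (real b / real N - 1 / 2) * (frac (real (b * a) / real N) - 1 / 2))"

end

theory Submission
  imports Defs "HOL-Real_Asymp.Real_Asymp" "HOL-Analysis.Harmonic_Numbers" "HOL-Number_Theory.Modular_Inverse"
begin

text \<open>
  Call \<open>(q, r)\<close> with \<open>q > 0\<close> and \<open>r = a q - p N \<noteq> 0\<close> a convergent vector of \<open>a/N\<close> if \<open>gcd(q, p) = 1\<close> and
  \<open>2 q |r| < N\<close>; then its quality \<open>z = N / (q |r|)\<close> is within a constant of a partial quotient of \<open>a/N\<close>, and the
  reciprocity law gives that \<open>12 D(a/N)\<close> is the sum of \<open>sgn(r) z\<close> up to \<open>O(log N)\<close>.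

  The number of pairs of \<open>a\<close> and a vector with \<open>z \<ge> T\<close> is \<open>O(\<phi>(N) log N / T)\<close>, so with \<open>T = t log N\<close> all \<open>a\<close>
  having a vector with \<open>z \<ge> T\<close> may be discarded and \<open>z\<close> may be capped at \<open>T\<close>. Put
  \<open>R = sqrt N / (d(N) T)\<close> with \<open>d\<close> the divisor function and split the vectors into the late ones with
  \<open>|r| \<le> R\<close>, the early ones with \<open>q \<le> R\<close>, and the rest.

  For the late vectors the second moment is \<open>O(\<phi>(N) t log^2 N)\<close>. The diagonal terms have this size. For the
  other terms, fix \<open>(q, r)\<close>: the vectors with a larger denominator correspond to the convergent vectors of
  \<open>s/|r|\<close>, where \<open>q s = -N\<close> modulo \<open>|r|\<close>, and their sum is an odd function of \<open>s\<close>. For fixed \<open>r\<close> the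
  denominators \<open>q\<close> are so well distributed over the residue classes modulo \<open>|r|\<close> that \<open>s\<close> and \<open>-s\<close> cancel.
  The early vectors of \<open>a\<close> are the late vectors of the inverse of \<open>a\<close> modulo \<open>N\<close>.

  The middle range is only \<open>O(log (d(N) T)) = O(log N / log log N)\<close> long on a logarithmic scale, and each unit
  of length contributes \<open>O(log T)\<close> to the first moment. Since \<open>t \<le> (log N)^C\<close> the product is \<open>O(log N)\<close>.
\<close>


section \<open>The reciprocity law\<close>

lemma real_of_nat_mod: "real (m mod n) = real m - real n * real (m div n)"
  by (metis add_diff_cancel_left' mult_div_mod_eq of_nat_add of_nat_mult)

lemma frac_real_divide: "frac (real m / real n) = real (m mod n) / real n"
  by (cases "n = 0")
    (simp_all add: frac_def floor_divide_of_nat_eq real_of_nat_mod diff_divide_distrib)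

lemma dedekind_sum_altdef:
  assumes "N > 0"
  shows "dedekind_sum a N =
    (\<Sum>b = 1..<N. (real b / real N - 1 / 2) * (real (b * a mod N) / real N - 1 / 2))"
proof -
  have "{1..N - 1} = {1..<N}" using assms by auto
  then show ?thesis unfolding dedekind_sum_def by (simp only: frac_real_divide)
qed

lemma dedekind_sum_mod: "N > 0 \<Longrightarrow> dedekind_sum (a mod N) N = dedekind_sum a N"
  by (simp add: dedekind_sum_altdef mod_mult_right_eq)

lemma bij_betw_mult_mod:
  fixes h k :: nat
  assumes "coprime h k"
  shows "bij_betw (\<lambda>b. b * h mod k) {1..<k} {1..<k}"
proof -
  have "inj_on (\<lambda>b. b * h mod k) {1..<k}"
  proof (rule inj_onI)
    fix x y assume xy: "x \<in> {1..<k}" "y \<in> {1..<k}" "x * h mod k = y * h mod k"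
    then have "[x * h = y * h] (mod k)" by (simp add: Cong.cong_def)
    then have "[x = y] (mod k)" using assms by (simp add: cong_mult_rcancel_nat)
    then show "x = y" using xy by (simp add: Cong.cong_def)
  qed
  moreover have "b * h mod k \<in> {1..<k}" if "b \<in> {1..<k}" for b
  proof -
    have "\<not> k dvd b * h"
      using that assms by (auto simp: coprime_dvd_mult_left_iff coprime_commute dest: dvd_imp_le)
    then show ?thesis using that by (auto simp: dvd_eq_mod_eq_0)
  qed
  then have "(\<lambda>b. b * h mod k) ` {1..<k} \<subseteq> {1..<k}" by blast
  ultimately show ?thesis by (simp add: bij_betw_def endo_inj_surj)
qed

lemma sum_mult_mod:
  fixes h k :: nat
  assumes "coprime h k"
  shows "(\<Sum>b=1..<k. f (b * h mod k)) = (\<Sum>b=1..<k. f b)"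
  by (rule sum.reindex_bij_betw[OF bij_betw_mult_mod[OF assms]])

lemma mult_diff_mod:
  fixes a b N :: nat
  assumes "a \<le> N" "\<not> N dvd b * a"
  shows "b * (N - a) mod N = N - b * a mod N"
proof -
  have "N > 0" using assms by (cases N) auto
  have "int (b * (N - a) mod N) = - int (b * a) mod int N"
    using assms(1) by (simp add: zmod_int of_nat_diff right_diff_distrib mod_diff_left_eq[symmetric])
  also have "\<dots> = int N - int (b * a) mod int N"
    using assms(2) by (simp add: zmod_zminus1_eq_if flip: of_nat_mod of_nat_mult) (simp add: dvd_eq_mod_eq_0)
  also have "\<dots> = int (N - b * a mod N)"
    using \<open>N > 0\<close> by (simp add: of_nat_diff less_imp_le zmod_int)
  finally show ?thesis by simp
qed

lemma dedekind_sum_uminus: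
  assumes "coprime a N" "a < N" "N > 1"
  shows "dedekind_sum (N - a) N = - dedekind_sum a N"
proof -
  have "real (b * (N - a) mod N) = real N - real (b * a mod N)" if "b \<in> {1..<N}" for b
  proof -
    have "b * a mod N \<in> {1..<N}"
      using bij_betw_mult_mod[OF assms(1)] that by (auto simp: bij_betw_def)
    then have "\<not> N dvd b * a" by auto
    then show ?thesis using assms by (simp add: mult_diff_mod of_nat_diff less_imp_le)
  qed
  then have "dedekind_sum (N - a) N =
      (\<Sum>b = 1..<N. - ((real b / real N - 1 / 2) * (real (b * a mod N) / real N - 1 / 2)))"
    using assms by (simp add: dedekind_sum_altdef) (intro sum.cong, simp_all add: field_simps)
  then show ?thesis using assms by (simp add: dedekind_sum_altdef sum_negf)
qed

lemma sum_real_lessThan: "k > 0 \<Longrightarrow> (\<Sum>b=1..<k. real b) = real k * (real k - 1) / 2"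
  by (induction k) (auto simp: sum.atLeastLessThan_Suc field_simps)

lemma sum_real_squares_lessThan:
  "k > 0 \<Longrightarrow> (\<Sum>b=1..<k. (real b)\<^sup>2) = real k * (real k - 1) * (2 * real k - 1) / 6"
proof (induction k)
  case (Suc k)
  then show ?case
    by (cases "k = 0") (auto simp: sum.atLeastLessThan_Suc field_simps power2_eq_square)
qed auto

lemma double_sum_real: "(\<Sum>i=1..n. 2 * real i) = real n * (real n + 1)"
  using double_gauss_sum_from_Suc_0[of n, where ?'a = real] by (simp add: sum_distrib_left)

lemma lattice_points_under_line:
  fixes b h k :: nat
  assumes "k > 0" "b < k" "h > 0"
  shows "{j \<in> {1..<h}. j * k \<le> b * h} = {1..b * h div k}"
proof -
  have "b * h div k < h" using assms by (simp add: less_mult_imp_div_less)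
  then have "j < h \<and> j * k \<le> b * h \<longleftrightarrow> j \<le> b * h div k" for j
    using less_eq_div_iff_mult_less_eq[OF assms(1), of j "b * h"] by linarith
  then show ?thesis by (simp add: set_eq_iff)
qed

lemma lattice_points_right_of_line:
  fixes h j k :: nat
  assumes "coprime h k" "j \<in> {1..<h}"
  shows "{b \<in> {1..<k}. j * k \<le> b * h} = {j * k div h<..<k}"
proof -
  have "j * k \<le> b * h \<longleftrightarrow> j * k div h < b" if "b \<in> {1..<k}" for b
  proof -
    have "j * k \<noteq> b * h"
    proof
      assume "j * k = b * h"
      then have "h dvd j * k" by simp
      then have "h dvd j" using assms(1) by (simp add: coprime_dvd_mult_left_iff)
      then show False using assms(2) by (auto dest: dvd_imp_le)
    qed
    moreover have "j * k < b * h \<longleftrightarrow> j * k div h < b"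
      using assms(2) by (simp add: div_less_iff_less_mult)
    ultimately show ?thesis by linarith
  qed
  then show ?thesis by auto
qed

definition floor_moment :: "nat \<Rightarrow> nat \<Rightarrow> real" where
  "floor_moment h k = (\<Sum>b=1..<k. real b * real (b * h div k))"

text \<open>Both sides count each lattice point \<open>(b, j)\<close> of the triangle under the diagonal with weight \<open>2 j\<close>.\<close>

lemma sum_floor_lattice:
  assumes "coprime h k" "h > 0" "k > 0"
  shows "(\<Sum>b=1..<k. real (b * h div k) * (real (b * h div k) + 1)) =
    (real k - 1) * real h * (real h - 1) - 2 * floor_moment k h"
proof -
  have "(\<Sum>b=1..<k. real (b * h div k) * (real (b * h div k) + 1)) =
      (\<Sum>b=1..<k. \<Sum>j | j \<in> {1..<h} \<and> j * k \<le> b * h. 2 * real j)"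
  proof (intro sum.cong refl)
    fix b assume "b \<in> {1..<k}"
    then have "b < k" by simp
    show "real (b * h div k) * (real (b * h div k) + 1) =
        (\<Sum>j | j \<in> {1..<h} \<and> j * k \<le> b * h. 2 * real j)"
      unfolding lattice_points_under_line[OF assms(3) \<open>b < k\<close> assms(2)] double_sum_real ..
  qed
  also have "\<dots> = (\<Sum>j=1..<h. \<Sum>b | b \<in> {1..<k} \<and> j * k \<le> b * h. 2 * real j)"
    by (rule sum.swap_restrict) auto
  also have "\<dots> = (\<Sum>j=1..<h. 2 * real j * (real k - 1 - real (j * k div h)))"
  proof (intro sum.cong refl)
    fix j assume j: "j \<in> {1..<h}"
    have "j * k div h < k" using j assms by (simp add: less_mult_imp_div_less mult.commute)
    then have "real (card {j * k div h<..<k}) = real k - 1 - real (j * k div h)"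
      by (simp add: of_nat_diff)
    then show "(\<Sum>b | b \<in> {1..<k} \<and> j * k \<le> b * h. 2 * real j) =
        2 * real j * (real k - 1 - real (j * k div h))"
      unfolding lattice_points_right_of_line[OF assms(1) j] by simp
  qed
  also have "\<dots> = 2 * (real k - 1) * (\<Sum>j=1..<h. real j) - 2 * floor_moment k h"
    by (simp add: floor_moment_def sum_distrib_left sum_subtractf[symmetric] algebra_simps)
  finally show ?thesis unfolding sum_real_lessThan[OF assms(2)] by (simp add: algebra_simps)
qed

lemma sum_floor_multiples:
  assumes "coprime h k" "k > 0"
  shows "(\<Sum>b=1..<k. real (b * h div k)) = (real h - 1) * (real k - 1) / 2"
proof -
  have "(\<Sum>b=1..<k. real b) = real h * (\<Sum>b=1..<k. real b) - real k * (\<Sum>b=1..<k. real (b * h div k))"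
    using sum_mult_mod[OF assms(1), of real]
    by (simp add: real_of_nat_mod sum_subtractf sum_distrib_left mult.commute)
  then have "real k * (\<Sum>b=1..<k. real (b * h div k)) = real k * ((real h - 1) * (real k - 1) / 2)"
    unfolding sum_real_lessThan[OF assms(2)] by (simp add: field_simps)
  then show ?thesis using assms(2) by simp
qed

lemma dedekind_sum_floor_moment:
  assumes "coprime h k" "k > 0"
  shows "(real k)\<^sup>2 * dedekind_sum h k =
    real h * (\<Sum>b=1..<k. (real b)\<^sup>2) - real k * floor_moment h k - (real k)\<^sup>2 * (real k - 1) / 4"
proof -
  have "(real k)\<^sup>2 * dedekind_sum h k =
      (\<Sum>b=1..<k. (real b - real k / 2) * (real (b * h mod k) - real k / 2))"
    unfolding dedekind_sum_altdef[OF assms(2)] sum_distrib_left using assms(2)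
    by (intro sum.cong refl) (simp add: field_simps power2_eq_square)
  also have "\<dots> = (\<Sum>b=1..<k. real b * real (b * h mod k) - real k / 2 * real b
      - real k / 2 * real (b * h mod k) + (real k)\<^sup>2 / 4)"
    by (intro sum.cong refl) (simp add: field_simps power2_eq_square)
  also have "\<dots> = (\<Sum>b=1..<k. real b * real (b * h mod k)) - real k / 2 * (\<Sum>b=1..<k. real b)
      - real k / 2 * (\<Sum>b=1..<k. real (b * h mod k)) + (real k - 1) * (real k)\<^sup>2 / 4"
    using assms(2) by (simp add: sum.distrib sum_subtractf sum_distrib_left of_nat_diff)
  also have "(\<Sum>b=1..<k. real b * real (b * h mod k)) =
      real h * (\<Sum>b=1..<k. (real b)\<^sup>2) - real k * floor_moment h k"
    unfolding floor_moment_def real_of_nat_mod sum_distrib_left sum_subtractf[symmetric]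
    by (intro sum.cong refl) (simp add: algebra_simps power2_eq_square)
  finally show ?thesis
    unfolding sum_mult_mod[OF assms(1), of real] sum_real_lessThan[OF assms(2)]
    by (simp add: field_simps power2_eq_square)
qed

lemma floor_moment_reciprocity:
  assumes "coprime h k" "h > 0" "k > 0"
  shows "2 * real h * real k * floor_moment h k + 2 * (real k)\<^sup>2 * floor_moment k h =
    ((real h)\<^sup>2 - 1) * (\<Sum>b=1..<k. (real b)\<^sup>2)
      + (real k)\<^sup>2 * (real h - 1) * (real k - 1) * (2 * real h - 1) / 2"
proof -
  define F where "F = (\<Sum>b=1..<k. (real (b * h div k))\<^sup>2)"
  have "(\<Sum>b=1..<k. (real b)\<^sup>2) = (\<Sum>b=1..<k. (real (b * h mod k))\<^sup>2)"
    by (rule sum_mult_mod[OF assms(1), symmetric])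
  also have "\<dots> = (real h)\<^sup>2 * (\<Sum>b=1..<k. (real b)\<^sup>2) - 2 * real h * real k * floor_moment h k + (real k)\<^sup>2 * F"
    unfolding floor_moment_def F_def real_of_nat_mod sum_distrib_left sum_subtractf[symmetric] sum.distrib[symmetric]
    by (intro sum.cong refl) (simp add: algebra_simps power2_eq_square)
  finally have squares: "2 * real h * real k * floor_moment h k =
    ((real h)\<^sup>2 - 1) * (\<Sum>b=1..<k. (real b)\<^sup>2) + (real k)\<^sup>2 * F"
    by (simp add: algebra_simps)
  have "F + (real h - 1) * (real k - 1) / 2 =
      (\<Sum>b=1..<k. real (b * h div k) * (real (b * h div k) + 1))"
    unfolding F_def sum_floor_multiples[OF assms(1,3), symmetric]
    by (simp add: sum.distrib[symmetric] algebra_simps power2_eq_square)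
  then have F: "F = (real k - 1) * real h * (real h - 1) - 2 * floor_moment k h - (real h - 1) * (real k - 1) / 2"
    unfolding sum_floor_lattice[OF assms] by simp
  show ?thesis unfolding squares F by (simp add: field_simps)
qed

theorem dedekind_reciprocity:
  assumes "coprime h k" "h > 0" "k > 0"
  shows "dedekind_sum h k + dedekind_sum k h =
    (real h / real k + real k / real h + 1 / (real h * real k)) / 12 - 1 / 4"
proof -
  let ?h = "real h" and ?k = "real k"
  have pos: "?h > 0" "?k > 0" using assms by auto
  have kh: "coprime k h" using assms(1) by (simp add: coprime_commute)
  have "2 * ?h\<^sup>2 * ?k\<^sup>2 * (dedekind_sum h k + dedekind_sum k h) =
      2 * ?h\<^sup>2 * (?k\<^sup>2 * dedekind_sum h k) + 2 * ?k\<^sup>2 * (?h\<^sup>2 * dedekind_sum k h)"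
    by (simp add: algebra_simps)
  also have "\<dots> = 2 * ?h\<^sup>2 * (?h * (\<Sum>b=1..<k. (real b)\<^sup>2)) + 2 * ?k\<^sup>2 * (?k * (\<Sum>j=1..<h. (real j)\<^sup>2))
      - ?h * (2 * ?h * ?k * floor_moment h k + 2 * ?k\<^sup>2 * floor_moment k h)
      - ?h\<^sup>2 * ?k\<^sup>2 * (?h + ?k - 2) / 2"
    unfolding dedekind_sum_floor_moment[OF assms(1,3)] dedekind_sum_floor_moment[OF kh assms(2)]
    by (simp add: field_simps power2_eq_square)
  also have "\<dots> = 2 * ?h\<^sup>2 * ?k\<^sup>2 * ((?h / ?k + ?k / ?h + 1 / (?h * ?k)) / 12 - 1 / 4)"
    unfolding floor_moment_reciprocity[OF assms] sum_real_squares_lessThan[OF assms(2)]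
      sum_real_squares_lessThan[OF assms(3)] using pos
    by (simp add: field_simps power2_eq_square)
  finally show ?thesis using pos by simp
qed

section \<open>Convergent vectors\<close>

text \<open>A vector \<open>(q, r)\<close> of the lattice \<open>r = a q\<close> modulo \<open>N\<close> is stored as the pair \<open>(q, p)\<close> with \<open>r = a q - p N\<close>,
  so that primitivity is coprimality of the two components.\<close>

definition lattice_res :: "int \<Rightarrow> int \<Rightarrow> int \<times> int \<Rightarrow> int" where
  "lattice_res N a v = a * fst v - snd v * N"

definition vec_det :: "int \<times> int \<Rightarrow> int \<times> int \<Rightarrow> int" where
  "vec_det v w = fst v * snd w - snd v * fst w"

definition conv_vecs :: "int \<Rightarrow> int \<Rightarrow> (int \<times> int) set" where
  "conv_vecs N a = {v. fst v > 0 \<and> coprime (fst v) (snd v) \<and> lattice_res N a v \<noteq> 0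
      \<and> 2 * (fst v * \<bar>lattice_res N a v\<bar>) < N}"

definition quality :: "int \<Rightarrow> int \<Rightarrow> int \<times> int \<Rightarrow> real" where
  "quality N a v = real_of_int N / real_of_int (fst v * \<bar>lattice_res N a v\<bar>)"

definition signed_term :: "(real \<Rightarrow> real) \<Rightarrow> int \<Rightarrow> int \<Rightarrow> int \<times> int \<Rightarrow> real" where
  "signed_term g N a v = real_of_int (sgn (lattice_res N a v)) * g (quality N a v)"

definition conv_sum :: "(real \<Rightarrow> real) \<Rightarrow> int \<Rightarrow> int \<Rightarrow> real" where
  "conv_sum g N a = (\<Sum>v\<in>conv_vecs N a. signed_term g N a v)"

definition tail_sum :: "(real \<Rightarrow> real) \<Rightarrow> int \<Rightarrow> int \<Rightarrow> int \<times> int \<Rightarrow> real" where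
  "tail_sum g N a v = (\<Sum>u | u \<in> conv_vecs N a \<and> fst u > fst v. signed_term g N a u)"

lemma fst_lattice_res_det:
  "fst w * lattice_res N a v - fst v * lattice_res N a w = N * vec_det v w"
  by (simp add: lattice_res_def vec_det_def algebra_simps)

lemma snd_lattice_res_det:
  "snd w * lattice_res N a v - snd v * lattice_res N a w = a * vec_det v w"
  by (simp add: lattice_res_def vec_det_def algebra_simps)

lemma lattice_res_inject:
  assumes "fst v = fst w" "lattice_res N a v = lattice_res N a w" "N \<noteq> 0"
  shows "v = w"
  using assms by (auto simp: lattice_res_def prod_eq_iff)

lemma conv_vecsD:
  assumes "v \<in> conv_vecs N a"
  shows "fst v \<ge> 1" "coprime (fst v) (snd v)" "\<bar>lattice_res N a v\<bar> \<ge> 1"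
    "2 * (fst v * \<bar>lattice_res N a v\<bar>) < N" "2 * fst v < N" "2 * \<bar>lattice_res N a v\<bar> < N"
proof -
  have v: "fst v \<ge> 1" "\<bar>lattice_res N a v\<bar> \<ge> 1" "2 * (fst v * \<bar>lattice_res N a v\<bar>) < N"
    using assms by (auto simp: conv_vecs_def)
  have "fst v * 1 \<le> fst v * \<bar>lattice_res N a v\<bar>" using v by (intro mult_left_mono) auto
  moreover have "1 * \<bar>lattice_res N a v\<bar> \<le> fst v * \<bar>lattice_res N a v\<bar>"
    using v by (intro mult_right_mono) auto
  ultimately show "2 * fst v < N" "2 * \<bar>lattice_res N a v\<bar> < N" using v by linarith+
qed (use assms in \<open>auto simp: conv_vecs_def\<close>)

lemma conv_vecs_empty: "N \<le> 2 \<Longrightarrow> conv_vecs N a = {}"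
  using conv_vecsD(1,5)[of _ N a] by fastforce

lemma quality_le_2:
  assumes "fst v > 0" "coprime (fst v) (snd v)" "lattice_res N a v \<noteq> 0" "v \<notin> conv_vecs N a"
  shows "quality N a v \<le> 2"
proof -
  have "N \<le> 2 * (fst v * \<bar>lattice_res N a v\<bar>)" "fst v * \<bar>lattice_res N a v\<bar> > 0"
    using assms by (auto simp: conv_vecs_def)
  then have "real_of_int N \<le> 2 * real_of_int (fst v * \<bar>lattice_res N a v\<bar>)"
    "real_of_int (fst v * \<bar>lattice_res N a v\<bar>) > 0" by linarith+
  then show ?thesis unfolding quality_def by (subst divide_le_eq) simp
qed

lemma abs_signed_term_le: "g (quality N a v) \<ge> 0 \<Longrightarrow> \<bar>signed_term g N a v\<bar> \<le> g (quality N a v)"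
  by (simp add: signed_term_def abs_mult sgn_if)

lemma signed_term_squared: "v \<in> conv_vecs N a \<Longrightarrow> (signed_term g N a v)\<^sup>2 = (g (quality N a v))\<^sup>2"
  using conv_vecsD(3)[of v N a] by (auto simp: signed_term_def sgn_if)

lemma finite_conv_vecs [simp, intro]: "finite (conv_vecs N a)"
proof (rule finite_subset)
  show "conv_vecs N a \<subseteq> {0..N} \<times> {-(\<bar>a\<bar> * N + N)..\<bar>a\<bar> * N + N}"
  proof
    fix v assume "v \<in> conv_vecs N a"
    note v = conv_vecsD[OF this]
    have N: "N > 0" using v by linarith
    have "\<bar>snd v\<bar> * 1 \<le> \<bar>snd v\<bar> * N" using N by (intro mult_left_mono) auto
    also have "\<dots> = \<bar>a * fst v - lattice_res N a v\<bar>" using N by (simp add: lattice_res_def abs_mult)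
    also have "\<dots> \<le> \<bar>a * fst v\<bar> + N" using v(6) by linarith
    also have "\<bar>a * fst v\<bar> \<le> \<bar>a\<bar> * N"
      unfolding abs_mult using v by (intro mult_left_mono) auto
    finally show "v \<in> {0..N} \<times> {-(\<bar>a\<bar> * N + N)..\<bar>a\<bar> * N + N}"
      using v by (cases v) auto
  qed
qed auto

lemma coprime_vec_det_0_imp_eq:
  assumes "coprime (fst v) (snd v)" "coprime (fst w) (snd w)" "fst v > 0" "fst w > 0" "vec_det v w = 0"
  shows "v = w"
proof -
  have parallel: "fst v * snd w = fst w * snd v" using assms(5) by (simp add: vec_det_def mult.commute)
  then have "fst v dvd fst w * snd v" "fst w dvd fst v * snd w" by (metis dvd_triv_left)+
  then have "fst v dvd fst w" "fst w dvd fst v"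
    using assms(1,2) by (simp_all add: coprime_dvd_mult_left_iff)
  then have "fst v = fst w" using assms(3,4) by (simp add: zdvd_antisym_nonneg)
  then show ?thesis using parallel assms(3) by (simp add: prod_eq_iff)
qed

lemma conv_vecs_antichain:
  assumes v: "v \<in> conv_vecs N a" and w: "w \<in> conv_vecs N a"
    and le: "fst v \<le> fst w" "\<bar>lattice_res N a v\<bar> \<le> \<bar>lattice_res N a w\<bar>"
  shows "v = w"
proof (rule coprime_vec_det_0_imp_eq)
  note v' = conv_vecsD[OF v] and w' = conv_vecsD[OF w]
  have "\<bar>N * vec_det v w\<bar> = \<bar>fst w * lattice_res N a v - fst v * lattice_res N a w\<bar>"
    by (simp only: fst_lattice_res_det)
  also have "\<dots> \<le> fst w * \<bar>lattice_res N a v\<bar> + fst v * \<bar>lattice_res N a w\<bar>"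
    using abs_triangle_ineq4[of "fst w * lattice_res N a v" "fst v * lattice_res N a w"] v'(1) w'(1)
    by (simp add: abs_mult)
  also have "\<dots> \<le> fst w * \<bar>lattice_res N a w\<bar> + fst w * \<bar>lattice_res N a w\<bar>"
    using le v'(1) w'(1) by (intro add_mono mult_left_mono mult_right_mono) auto
  also have "\<dots> < N" using w'(4) by simp
  finally have "\<bar>N * vec_det v w\<bar> < N" .
  then show "vec_det v w = 0" using dvd_imp_le_int[of "N * vec_det v w" N] by (cases "N = 0") auto
qed (use conv_vecsD(1,2)[OF v] conv_vecsD(1,2)[OF w] in auto)

lemma inj_on_fst_conv_vecs: "inj_on fst (conv_vecs N a)"
proof (rule inj_onI)
  fix v w assume "v \<in> conv_vecs N a" "w \<in> conv_vecs N a" "fst v = fst w"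
  then show "v = w"
    using conv_vecs_antichain[of v N a w] conv_vecs_antichain[of w N a v]
    by (cases "\<bar>lattice_res N a v\<bar> \<le> \<bar>lattice_res N a w\<bar>") simp_all
qed

lemma conv_vecs_res_decreasing:
  assumes "v \<in> conv_vecs N a" "w \<in> conv_vecs N a" "fst v < fst w"
  shows "\<bar>lattice_res N a w\<bar> < \<bar>lattice_res N a v\<bar>"
  using conv_vecs_antichain[OF assms(1,2)] assms(3)
  by (cases "\<bar>lattice_res N a v\<bar> \<le> \<bar>lattice_res N a w\<bar>") auto

subsection \<open>Symmetries\<close>

definition shear_vec :: "int \<Rightarrow> int \<Rightarrow> int \<times> int \<Rightarrow> int \<times> int" where
  "shear_vec e k v = (fst v, e * snd v + k * fst v)"

lemma fst_shear_vec [simp]: "fst (shear_vec e k v) = fst v"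
  by (simp add: shear_vec_def)

lemma shear_vec_inverse: "\<bar>e\<bar> = 1 \<Longrightarrow> shear_vec e (- (e * k)) (shear_vec e k v) = v"
  by (cases "e \<ge> 0") (auto simp: shear_vec_def)

lemma lattice_res_shear_vec:
  "lattice_res N (e * a + k * N) (shear_vec e k v) = e * lattice_res N a v"
  by (simp add: lattice_res_def shear_vec_def algebra_simps)

lemma quality_shear_vec: "\<bar>e\<bar> = 1 \<Longrightarrow> quality N (e * a + k * N) (shear_vec e k v) = quality N a v"
  by (simp add: quality_def lattice_res_shear_vec abs_mult)

lemma signed_term_shear_vec:
  assumes "\<bar>e\<bar> = 1"
  shows "signed_term g N (e * a + k * N) (shear_vec e k v) = e * signed_term g N a v"
proof -
  have "sgn e = e" using assms by (auto simp: sgn_if)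
  then show ?thesis
    by (simp add: signed_term_def quality_shear_vec[OF assms] lattice_res_shear_vec sgn_mult)
qed

lemma coprime_shear_vec:
  assumes "\<bar>e\<bar> = 1"
  shows "coprime (fst v) (snd (shear_vec e k v)) \<longleftrightarrow> coprime (fst v) (snd v)"
proof -
  have "d dvd fst v \<and> d dvd e * snd v + k * fst v \<longleftrightarrow> d dvd fst v \<and> d dvd snd v" for d
    using assms by (cases "e \<ge> 0") (auto simp: dvd_add_left_iff dvd_diff_right_iff)
  then show ?thesis unfolding coprime_def shear_vec_def by (metis snd_conv)
qed

lemma shear_vec_in_conv_vecs:
  "\<bar>e\<bar> = 1 \<Longrightarrow> v \<in> conv_vecs N a \<Longrightarrow> shear_vec e k v \<in> conv_vecs N (e * a + k * N)"
  by (auto simp: conv_vecs_def lattice_res_shear_vec coprime_shear_vec abs_mult)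

lemma bij_betw_shear_vec:
  assumes e: "\<bar>e\<bar> = 1"
  shows "bij_betw (shear_vec e k) {v \<in> conv_vecs N a. P (fst v)} {v \<in> conv_vecs N (e * a + k * N). P (fst v)}"
proof (rule bij_betw_byWitness[where f' = "shear_vec e (- (e * k))"])
  have "e * (e * a + k * N) + - (e * k) * N = (e * e) * a" by (simp add: algebra_simps)
  also have "e * e = 1" using e by (cases "e \<ge> 0") auto
  finally have "e * (e * a + k * N) + - (e * k) * N = a" by simp
  then show "shear_vec e (- (e * k)) ` {v \<in> conv_vecs N (e * a + k * N). P (fst v)} \<subseteq> {v \<in> conv_vecs N a. P (fst v)}"
    using shear_vec_in_conv_vecs[OF e, of _ N "e * a + k * N" "- (e * k)"] by auto
  show "shear_vec e k ` {v \<in> conv_vecs N a. P (fst v)} \<subseteq> {v \<in> conv_vecs N (e * a + k * N). P (fst v)}"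
    using shear_vec_in_conv_vecs[OF e] by auto
  show "\<forall>v\<in>{v \<in> conv_vecs N (e * a + k * N). P (fst v)}. shear_vec e k (shear_vec e (- (e * k)) v) = v"
    using shear_vec_inverse[OF e, of "- (e * k)"] \<open>e * e = 1\<close> by (simp flip: mult.assoc)
qed (simp add: shear_vec_inverse[OF e])

lemma sum_signed_term_shear_vec:
  assumes "\<bar>e\<bar> = 1"
  shows "(\<Sum>v | v \<in> conv_vecs N (e * a + k * N) \<and> P (fst v). signed_term g N (e * a + k * N) v) =
    e * (\<Sum>v | v \<in> conv_vecs N a \<and> P (fst v). signed_term g N a v)"
  using sum.reindex_bij_betw[OF bij_betw_shear_vec[OF assms, where k = k and N = N and a = a and P = P],
      of "signed_term g N (e * a + k * N)"]
  by (simp add: signed_term_shear_vec[OF assms] sum_distrib_left)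

lemma conv_sum_shear: "\<bar>e\<bar> = 1 \<Longrightarrow> conv_sum g N (e * a + k * N) = e * conv_sum g N a"
  using sum_signed_term_shear_vec[of e g N a k "\<lambda>_. True"] by (simp add: conv_sum_def)

lemma tail_sum_shear:
  "\<bar>e\<bar> = 1 \<Longrightarrow> tail_sum g N (e * a + k * N) (shear_vec e k v) = e * tail_sum g N a v"
  using sum_signed_term_shear_vec[of e g N a k "\<lambda>q. q > fst v"] by (simp add: tail_sum_def)

lemma conv_sum_mod: "conv_sum g N (a mod N) = conv_sum g N a"
  using conv_sum_shear[of 1 g N "a mod N" "a div N"] by (simp add: mod_div_mult_eq)

lemma conv_sum_uminus: "conv_sum g N (- a) = - conv_sum g N a"
  using conv_sum_shear[of "-1" g N a 0] by simp

lemma conv_sum_diff: "conv_sum g N (N - a) = - conv_sum g N a"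
  using conv_sum_shear[of "-1" g N a 1] by simp

subsection \<open>Unimodular bases\<close>

definition from_basis :: "int \<times> int \<Rightarrow> int \<times> int \<Rightarrow> int \<times> int \<Rightarrow> int \<times> int" where
  "from_basis v w x = (fst x * fst w - snd x * fst v, fst x * snd w - snd x * snd v)"

definition to_basis :: "int \<times> int \<Rightarrow> int \<times> int \<Rightarrow> int \<times> int \<Rightarrow> int \<times> int" where
  "to_basis v w u = (vec_det v u, vec_det w u)"

lemma from_basis_to_basis:
  assumes "vec_det v w = 1"
  shows "from_basis v w (to_basis v w u) = u"
proof -
  have "fst (from_basis v w (to_basis v w u)) = vec_det v w * fst u"
    "snd (from_basis v w (to_basis v w u)) = vec_det v w * snd u"
    by (simp_all add: from_basis_def to_basis_def vec_det_def algebra_simps)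
  then show ?thesis by (simp add: assms prod_eq_iff)
qed

lemma to_basis_from_basis:
  assumes "vec_det v w = 1"
  shows "to_basis v w (from_basis v w x) = x"
proof -
  have "fst (to_basis v w (from_basis v w x)) = fst x * vec_det v w"
    "snd (to_basis v w (from_basis v w x)) = snd x * vec_det v w"
    by (simp_all add: from_basis_def to_basis_def vec_det_def algebra_simps)
  then show ?thesis by (simp add: assms prod_eq_iff)
qed

lemma lattice_res_from_basis:
  "lattice_res N a (from_basis v w x) = lattice_res (lattice_res N a v) (lattice_res N a w) x"
  by (simp add: lattice_res_def from_basis_def algebra_simps)

lemma coprime_from_basis:
  assumes "vec_det v w = 1"
  shows "coprime (fst (from_basis v w x)) (snd (from_basis v w x)) \<longleftrightarrow> coprime (fst x) (snd x)"
proof -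
  have "d dvd fst x \<and> d dvd snd x \<longleftrightarrow> d dvd fst (from_basis v w x) \<and> d dvd snd (from_basis v w x)" for d
  proof
    assume "d dvd fst (from_basis v w x) \<and> d dvd snd (from_basis v w x)"
    then have "d dvd fst (to_basis v w (from_basis v w x)) \<and> d dvd snd (to_basis v w (from_basis v w x))"
      unfolding to_basis_def vec_det_def by auto
    then show "d dvd fst x \<and> d dvd snd x" by (simp add: to_basis_from_basis[OF assms])
  qed (auto simp: from_basis_def)
  then show ?thesis unfolding coprime_def by metis
qed

subsection \<open>The vectors beyond a given one\<close>

text \<open>In a unimodular basis \<open>v, w\<close> the vectors beyond \<open>v\<close> become, up to boundary terms, the convergent vectors for
  the residues \<open>y, s\<close> of \<open>v, w\<close> in the roles of \<open>N, a\<close>; qualities move by at most \<open>1/l\<^sup>2\<close>, where \<open>l\<close> is the new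
  denominator.\<close>

locale conv_basis =
  fixes N a :: int and v w :: "int \<times> int"
  assumes in_conv_vecs: "v \<in> conv_vecs N a" and res_pos: "lattice_res N a v > 0"
    and det: "vec_det v w = 1"
begin

abbreviation y :: int where "y \<equiv> lattice_res N a v"
abbreviation s :: int where "s \<equiv> lattice_res N a w"

lemma fst_pos: "fst v \<ge> 1" and fst_times_res: "2 * (fst v * y) < N" and modulus_pos: "N > 0"
  using conv_vecsD(1,4,5)[OF in_conv_vecs] res_pos by auto

lemma fst_from_basis: "fst (from_basis v w x) * y = fst x * N + fst v * lattice_res y s x"
  using fst_lattice_res_det[of "from_basis v w x" N a v] to_basis_from_basis[OF det, of x]
  by (simp add: to_basis_def prod_eq_iff lattice_res_from_basis algebra_simps)

definition tail_coords :: "(int \<times> int) set" where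
  "tail_coords = conv_vecs y s \<union> to_basis v w ` {u \<in> conv_vecs N a. fst u > fst v}"

lemma finite_tail_coords: "finite tail_coords"
  by (simp add: tail_coords_def)

lemma fst_from_basis_ge:
  assumes "fst x \<ge> 1" "\<bar>lattice_res y s x\<bar> < y"
  shows "fst x * fst v \<le> fst (from_basis v w x)"
proof -
  have "fst x * (2 * (fst v * y)) \<le> fst x * N"
    using assms fst_times_res by (intro mult_left_mono) auto
  moreover have "1 * (fst v * y) \<le> fst x * (fst v * y)"
    using assms fst_pos res_pos by (intro mult_right_mono) auto
  moreover have "fst v * (- y) \<le> fst v * lattice_res y s x"
    using assms fst_pos by (intro mult_left_mono) auto
  ultimately have "fst x * fst v * y \<le> fst (from_basis v w x) * y"
    unfolding fst_from_basis by (simp add: mult.assoc)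
  then show ?thesis using res_pos by simp
qed

lemma fst_from_basis_gt:
  assumes "x \<in> conv_vecs y s"
  shows "fst (from_basis v w x) > fst v"
proof -
  note x = conv_vecsD[OF assms]
  have "1 * N \<le> fst x * N" using x(1) modulus_pos by (intro mult_right_mono) auto
  moreover have "fst v * (- y) \<le> fst v * lattice_res y s x"
    using x(6) fst_pos by (intro mult_left_mono) auto
  ultimately have "fst v * y < fst (from_basis v w x) * y"
    unfolding fst_from_basis using fst_times_res by linarith
  then show ?thesis using res_pos by simp
qed

lemma fst_to_basis_ge:
  assumes u: "u \<in> conv_vecs N a" "fst u > fst v"
  shows "fst (to_basis v w u) \<ge> 1"
proof -
  have res_less: "\<bar>lattice_res N a u\<bar> < y"
    using conv_vecs_res_decreasing[OF in_conv_vecs u] res_pos by simp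
  have "fst v * lattice_res N a u \<le> fst v * \<bar>lattice_res N a u\<bar>"
    using fst_pos by (intro mult_left_mono) auto
  also have "\<dots> < fst u * y"
    using res_less u(2) fst_pos by (intro mult_strict_mono) auto
  finally have "0 < N * vec_det v u" using fst_lattice_res_det[of u N a v] by linarith
  then show ?thesis using modulus_pos by (simp add: to_basis_def zero_less_mult_iff)
qed

lemma tail_coordsD:
  assumes "x \<in> tail_coords"
  shows "fst x \<ge> 1" "coprime (fst x) (snd x)" "lattice_res y s x \<noteq> 0" "\<bar>lattice_res y s x\<bar> < y"
    "fst (from_basis v w x) > fst v"
proof -
  consider (reduced) "x \<in> conv_vecs y s"
    | (original) u where "u \<in> conv_vecs N a" "fst u > fst v" "x = to_basis v w u"
    using assms by (auto simp: tail_coords_def)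
  then have "fst x \<ge> 1 \<and> coprime (fst x) (snd x) \<and> lattice_res y s x \<noteq> 0 \<and> \<bar>lattice_res y s x\<bar> < y \<and>
    fst (from_basis v w x) > fst v"
  proof cases
    case reduced
    then show ?thesis using conv_vecsD[OF reduced] fst_from_basis_gt by auto
  next
    case (original u)
    have "from_basis v w x = u" using original(3) by (simp add: from_basis_to_basis[OF det])
    moreover from this have "lattice_res y s x = lattice_res N a u" "coprime (fst x) (snd x)"
      using lattice_res_from_basis[of N a v w x] coprime_from_basis[OF det, of x] conv_vecsD(2)[OF original(1)]
      by simp_all
    moreover have "fst x \<ge> 1" using fst_to_basis_ge[OF original(1,2)] original(3) by simp
    ultimately show ?thesis
      using conv_vecsD(3)[OF original(1)] conv_vecs_res_decreasing[OF in_conv_vecs original(1,2)] original(2) res_pos by auto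
  qed
  then show "fst x \<ge> 1" "coprime (fst x) (snd x)" "lattice_res y s x \<noteq> 0" "\<bar>lattice_res y s x\<bar> < y"
    "fst (from_basis v w x) > fst v" by blast+
qed

lemma quality_from_basis_diff:
  assumes "x \<in> tail_coords"
  shows "\<bar>quality N a (from_basis v w x) - quality y s x\<bar> \<le> 1 / (real_of_int (fst x))\<^sup>2"
proof -
  define l q u r where "l = real_of_int (fst x)" and "q = real_of_int (fst v)"
    and "u = real_of_int (fst (from_basis v w x))" and "r = real_of_int (lattice_res y s x)"
  note x = tail_coordsD[OF assms]
  have pos: "l > 0" "q > 0" "u > 0" "\<bar>r\<bar> > 0"
    using x fst_pos by (auto simp: l_def q_def u_def r_def)
  have eq: "u * real_of_int y = l * real_of_int N + q * r"
    using arg_cong[OF fst_from_basis[of x], of real_of_int] by (simp add: l_def q_def u_def r_def)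
  have "l * q \<le> u"
    using fst_from_basis_ge[OF x(1,4)] unfolding l_def q_def u_def by (simp flip: of_int_mult)
  have "quality N a (from_basis v w x) - quality y s x =
      (l * real_of_int N - u * real_of_int y) / (l * u * \<bar>r\<bar>)"
    using pos by (simp add: quality_def lattice_res_from_basis l_def u_def r_def field_simps)
  also have "\<dots> = - (q * r) / (l * u * \<bar>r\<bar>)" by (simp add: eq)
  finally have "\<bar>quality N a (from_basis v w x) - quality y s x\<bar> = q / (l * u)"
    using pos by (simp add: abs_mult)
  also have "\<dots> \<le> q / (l * (l * q))"
    using \<open>l * q \<le> u\<close> pos by (intro divide_left_mono mult_left_mono) auto
  also have "\<dots> = 1 / l\<^sup>2" using pos by (simp add: power2_eq_square)
  finally show ?thesis by (simp add: l_def)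
qed

end

lemma sum_inverse_squares_le: "(\<Sum>l=1..n. 1 / (real l)\<^sup>2) \<le> 2"
proof -
  have "(\<Sum>l=1..n. 1 / (real l)\<^sup>2) \<le> 2 - 1 / real n" if "n > 0"
    using that
  proof (induction n rule: nat_induct_non_zero)
    case (Suc n)
    have "1 / (real (Suc n))\<^sup>2 \<le> 1 / (real n * real (Suc n))"
      using Suc by (intro divide_left_mono) (auto simp: power2_eq_square)
    also have "\<dots> = 1 / real n - 1 / real (Suc n)" using Suc by (simp add: field_simps)
    finally show ?case using Suc by simp
  qed auto
  moreover have "2 - 1 / real n \<le> 2" by simp
  ultimately show ?thesis by (cases "n = 0") (auto intro: order_trans)
qed

lemma residues_near_zero_subset:
  fixes x y :: int
  assumes "y > 0"
  shows "{c. \<bar>x - c * y\<bar> < y} \<subseteq> {x div y, x div y + 1}"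
proof
  fix c assume "c \<in> {c. \<bar>x - c * y\<bar> < y}"
  then have "\<bar>(x div y - c) * y + x mod y\<bar> < y"
    using mult_div_mod_eq[of y x] by (simp add: algebra_simps)
  moreover have "0 \<le> x mod y" "x mod y < y" using assms by auto
  ultimately have "(x div y - c) * y < 1 * y" "(-2) * y < (x div y - c) * y" by linarith+
  then have "x div y - c < 1" "-2 < x div y - c" using assms by (auto simp only: mult_less_cancel_right_pos)
  then show "c \<in> {x div y, x div y + 1}" by auto
qed

lemma card_residues_near_zero:
  fixes x y :: int
  assumes "y > 0"
  shows "finite {c. \<bar>x - c * y\<bar> < y}" "card {c. \<bar>x - c * y\<bar> < y} \<le> 2"
proof -
  show "finite {c. \<bar>x - c * y\<bar> < y}"
    by (rule finite_subset[OF residues_near_zero_subset[OF assms]]) auto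
  have "card {c. \<bar>x - c * y\<bar> < y} \<le> card {x div y, x div y + 1}"
    by (intro card_mono residues_near_zero_subset assms) auto
  then show "card {c. \<bar>x - c * y\<bar> < y} \<le> 2" by simp
qed

lemma sum_inverse_squares_lattice_le:
  assumes "finite X" "y > 0" "\<And>x. x \<in> X \<Longrightarrow> fst x \<ge> 1 \<and> \<bar>lattice_res y s x\<bar> < y"
  shows "(\<Sum>x\<in>X. 1 / (real_of_int (fst x))\<^sup>2) \<le> 4"
proof -
  define n where "n = nat (Max (insert 1 (fst ` X)))"
  define C where "C = (\<lambda>l::nat. {c. \<bar>s * int l - c * y\<bar> < y})"
  have "X \<subseteq> (\<lambda>(l, c). (int l, c)) ` Sigma {1..n} C"
  proof
    fix x assume x: "x \<in> X"
    have "fst x \<le> Max (insert 1 (fst ` X))" using x assms(1) by (intro Max_ge) auto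
    then have "nat (fst x) \<in> {1..n}" "int (nat (fst x)) = fst x"
      using assms(3)[OF x] by (auto simp: n_def)
    moreover have "snd x \<in> C (nat (fst x))" using assms(3)[OF x] by (auto simp: C_def lattice_res_def)
    ultimately show "x \<in> (\<lambda>(l, c). (int l, c)) ` Sigma {1..n} C"
      by (intro image_eqI[of _ _ "(nat (fst x), snd x)"]) auto
  qed
  moreover have C: "finite (C l)" "card (C l) \<le> 2" for l
    unfolding C_def using card_residues_near_zero[OF assms(2)] by auto
  ultimately have "(\<Sum>x\<in>X. 1 / (real_of_int (fst x))\<^sup>2) \<le>
      (\<Sum>x\<in>(\<lambda>(l, c). (int l, c)) ` Sigma {1..n} C. 1 / (real_of_int (fst x))\<^sup>2)"
    by (intro sum_mono2) auto
  also have "\<dots> = (\<Sum>x\<in>Sigma {1..n} C. 1 / (real (fst x))\<^sup>2)"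
    by (subst sum.reindex) (auto simp: inj_on_def case_prod_beta)
  also have "\<dots> = (\<Sum>l=1..n. \<Sum>c\<in>C l. 1 / (real l)\<^sup>2)"
    using C(1) by (subst sum.Sigma) (auto simp: case_prod_beta)
  also have "\<dots> \<le> (\<Sum>l=1..n. 2 * (1 / (real l)\<^sup>2))"
    using C(2) by (intro sum_mono order_trans[OF sum_bounded_above[OF order_refl]] mult_right_mono) auto
  also have "\<dots> \<le> 2 * 2"
    unfolding sum_distrib_left[symmetric] by (intro mult_left_mono sum_inverse_squares_le) auto
  finally show ?thesis by simp
qed

locale quality_weight =
  fixes g :: "real \<Rightarrow> real"
  assumes weight_mono: "x \<le> y \<Longrightarrow> g x \<le> g y"
    and weight_lipschitz: "\<bar>g x - g y\<bar> \<le> \<bar>x - y\<bar>"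
    and weight_vanish: "x \<le> 2 \<Longrightarrow> g x = 0"
begin

lemma weight_nonneg: "0 \<le> g z"
  using weight_mono[of "min z 2" z] weight_vanish[of "min z 2"] by simp

lemma signed_term_eq_0:
  assumes "fst v > 0" "coprime (fst v) (snd v)" "lattice_res N a v \<noteq> 0" "v \<notin> conv_vecs N a"
  shows "signed_term g N a v = 0"
  using quality_le_2[OF assms] by (simp add: signed_term_def weight_vanish)

lemma abs_signed_term_from_basis_diff:
  assumes "conv_basis N a v w" "x \<in> conv_basis.tail_coords N a v w"
  shows "\<bar>signed_term g N a (from_basis v w x) - signed_term g (lattice_res N a v) (lattice_res N a w) x\<bar>
    \<le> 1 / (real_of_int (fst x))\<^sup>2"
proof -
  interpret conv_basis N a v w by fact
  have "\<bar>signed_term g N a (from_basis v w x) - signed_term g y s x\<bar> =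
      \<bar>g (quality N a (from_basis v w x)) - g (quality y s x)\<bar>"
    using tail_coordsD(3)[OF assms(2)]
    by (simp add: signed_term_def lattice_res_from_basis abs_mult sgn_if flip: right_diff_distrib)
  also have "\<dots> \<le> \<bar>quality N a (from_basis v w x) - quality y s x\<bar>" by (rule weight_lipschitz)
  also have "\<dots> \<le> 1 / (real_of_int (fst x))\<^sup>2" by (rule quality_from_basis_diff[OF assms(2)])
  finally show ?thesis .
qed

lemma tail_sum_eq_sum_tail_coords:
  assumes "conv_basis N a v w"
  shows "tail_sum g N a v = (\<Sum>x\<in>conv_basis.tail_coords N a v w. signed_term g N a (from_basis v w x))"
proof -
  interpret conv_basis N a v w by fact
  let ?later = "{u \<in> conv_vecs N a. fst u > fst v}"
  have inj: "inj_on (to_basis v w) ?later" by (metis inj_on_inverseI from_basis_to_basis[OF det])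
  have "tail_sum g N a v = (\<Sum>x\<in>to_basis v w ` ?later. signed_term g N a (from_basis v w x))"
    unfolding tail_sum_def by (subst sum.reindex[OF inj]) (simp add: from_basis_to_basis[OF det])
  also have "\<dots> = (\<Sum>x\<in>tail_coords. signed_term g N a (from_basis v w x))"
  proof (rule sum.mono_neutral_left[OF finite_tail_coords])
    show "\<forall>x\<in>tail_coords - to_basis v w ` ?later. signed_term g N a (from_basis v w x) = 0"
    proof
      fix x assume x: "x \<in> tail_coords - to_basis v w ` ?later"
      have "from_basis v w x \<notin> ?later"
      proof
        assume "from_basis v w x \<in> ?later"
        then have "to_basis v w (from_basis v w x) \<in> to_basis v w ` ?later" by (rule imageI)
        then show False using x unfolding to_basis_from_basis[OF det] by blast
      qed
      then show "signed_term g N a (from_basis v w x) = 0"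
        using x tail_coordsD[of x] fst_pos
        by (intro signed_term_eq_0) (simp_all add: coprime_from_basis[OF det] lattice_res_from_basis)
    qed
  qed (auto simp: tail_coords_def)
  finally show ?thesis .
qed

lemma conv_sum_eq_sum_tail_coords:
  assumes "conv_basis N a v w"
  shows "conv_sum g (lattice_res N a v) (lattice_res N a w) =
    (\<Sum>x\<in>conv_basis.tail_coords N a v w. signed_term g (lattice_res N a v) (lattice_res N a w) x)"
proof -
  interpret conv_basis N a v w by fact
  show ?thesis
    unfolding conv_sum_def
  proof (rule sum.mono_neutral_left[OF finite_tail_coords])
    show "\<forall>x\<in>tail_coords - conv_vecs y s. signed_term g y s x = 0"
    proof
      fix x assume "x \<in> tail_coords - conv_vecs y s"
      then show "signed_term g y s x = 0" using tail_coordsD[of x] by (intro signed_term_eq_0) auto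
    qed
  qed (simp add: tail_coords_def)
qed

lemma tail_sum_approx:
  assumes "conv_basis N a v w"
  shows "\<bar>tail_sum g N a v - conv_sum g (lattice_res N a v) (lattice_res N a w)\<bar> \<le> 4"
proof -
  interpret conv_basis N a v w by fact
  have "\<bar>tail_sum g N a v - conv_sum g y s\<bar> \<le>
      (\<Sum>x\<in>tail_coords. \<bar>signed_term g N a (from_basis v w x) - signed_term g y s x\<bar>)"
    unfolding tail_sum_eq_sum_tail_coords[OF assms] conv_sum_eq_sum_tail_coords[OF assms]
      sum_subtractf[symmetric] by (rule sum_abs)
  also have "\<dots> \<le> (\<Sum>x\<in>tail_coords. 1 / (real_of_int (fst x))\<^sup>2)"
    by (intro sum_mono abs_signed_term_from_basis_diff[OF assms])
  also have "\<dots> \<le> 4"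
    using tail_coordsD by (intro sum_inverse_squares_lattice_le[OF finite_tail_coords res_pos]) blast
  finally show ?thesis .
qed

lemma conv_sum_reciprocity:
  assumes a: "0 < a" "2 * a < N"
  shows "\<bar>conv_sum g N a + conv_sum g a N - g (real_of_int N / real_of_int a)\<bar> \<le> 4"
proof -
  have res: "lattice_res N a (1, 0) = a" "lattice_res N a (0, 1) = - N" by (simp_all add: lattice_res_def)
  have first: "(1, 0) \<in> conv_vecs N a" using a by (simp add: conv_vecs_def res)
  have "conv_vecs N a = insert (1, 0) {u \<in> conv_vecs N a. fst u > 1}"
  proof -
    have "u = (1, 0)" if "u \<in> conv_vecs N a" "\<not> fst u > 1" for u
      using inj_onD[OF inj_on_fst_conv_vecs _ that(1) first] conv_vecsD(1)[OF that(1)] that(2) by simp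
    then show ?thesis using first by blast
  qed
  then have "conv_sum g N a = (\<Sum>u\<in>insert (1, 0) {u \<in> conv_vecs N a. fst u > 1}. signed_term g N a u)"
    unfolding conv_sum_def by simp
  also have "\<dots> = signed_term g N a (1, 0) + tail_sum g N a (1, 0)"
    by (subst sum.insert) (auto simp: tail_sum_def)
  also have "signed_term g N a (1, 0) = g (real_of_int N / real_of_int a)"
    using a by (simp add: signed_term_def quality_def res)
  finally have "conv_sum g N a = g (real_of_int N / real_of_int a) + tail_sum g N a (1, 0)" .
  moreover have "conv_basis N a (1, 0) (0, 1)"
    using first a by unfold_locales (simp_all add: res vec_det_def)
  ultimately show ?thesis
    using tail_sum_approx[of N a "(1, 0)" "(0, 1)"] by (simp add: res conv_sum_uminus)
qed

end

subsection \<open>Dedekind sums in terms of convergent vectors\<close>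

definition excess :: "real \<Rightarrow> real" where
  "excess z = max 0 (z - 2)"

interpretation excess: quality_weight excess
  by unfold_locales (auto simp: excess_def)

definition dedekind_error :: "nat \<Rightarrow> nat \<Rightarrow> real" where
  "dedekind_error a N = 12 * dedekind_sum a N - conv_sum excess (int N) (int a)"

lemma dedekind_error_mod: "N > 0 \<Longrightarrow> dedekind_error (a mod N) N = dedekind_error a N"
  by (simp add: dedekind_error_def dedekind_sum_mod conv_sum_mod zmod_int)

lemma dedekind_error_uminus:
  assumes "coprime a N" "a < N" "N > 1"
  shows "dedekind_error (N - a) N = - dedekind_error a N"
  using dedekind_sum_uminus[OF assms] assms(2)
  by (simp add: dedekind_error_def of_nat_diff conv_sum_diff)

lemma dedekind_error_eq_0:
  assumes "N \<le> 2"
  shows "dedekind_error a N = 0"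
proof -
  have "N = 0 \<or> N = 1 \<or> N = 2" using assms by linarith
  then show ?thesis
    using assms by (auto simp: dedekind_error_def dedekind_sum_def conv_sum_def conv_vecs_empty)
qed

lemma dedekind_error_half_range:
  assumes "coprime a N" "N > 2"
  obtains b where "0 < b" "2 * b < N" "coprime b N" "\<bar>dedekind_error b N\<bar> = \<bar>dedekind_error a N\<bar>"
proof -
  define c where "c = a mod N"
  have c: "coprime c N" "c < N" "dedekind_error c N = dedekind_error a N"
    using assms by (simp_all add: c_def dedekind_error_mod)
  have "c > 0" using c(1) assms(2) by (intro Nat.gr0I) auto
  have "2 * c \<noteq> N"
  proof
    assume "2 * c = N"
    then have "c dvd N" by auto
    then have "c = 1" using c(1) by (simp add: coprime_absorb_left)
    then show False using \<open>2 * c = N\<close> assms(2) by simp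
  qed
  then consider (lower) "2 * c < N" | (upper) "2 * (N - c) < N" using c(2) by linarith
  then show ?thesis
  proof cases
    case lower
    then show ?thesis using c \<open>c > 0\<close> by (intro that[of c]) simp_all
  next
    case upper
    have "coprime (N - c) N" using gcd_diff2_nat[of c N] c by (simp only: coprime_iff_gcd_eq_1)
    then show ?thesis
      using upper c dedekind_error_uminus[OF c(1,2)] assms(2) by (intro that[of "N - c"]) simp_all
  qed
qed

lemma abs_dedekind_error_step:
  assumes "0 < a" "2 * a < N" "coprime a N"
  shows "\<bar>dedekind_error a N\<bar> \<le> \<bar>dedekind_error N a\<bar> + 6"
proof -
  have "12 * dedekind_sum a N =
      - 12 * dedekind_sum N a + (real a / real N + real N / real a + 1 / (real a * real N)) - 3"
    using dedekind_reciprocity[of a N] assms by (simp add: field_simps)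
  moreover have "excess (real N / real a) = real N / real a - 2"
    using assms by (simp add: excess_def field_simps)
  then have "\<bar>conv_sum excess (int N) (int a) + conv_sum excess (int a) (int N) - (real N / real a - 2)\<bar> \<le> 4"
    using excess.conv_sum_reciprocity[of "int a" "int N"] assms by simp
  moreover have "0 \<le> real a / real N" "real a / real N \<le> 1" using assms by (auto simp: field_simps)
  moreover have "0 \<le> 1 / (real a * real N)" "1 / (real a * real N) \<le> 1"
    using assms mult_mono[of 1 "real a" 1 "real N"] by (auto simp: divide_le_eq)
  ultimately show ?thesis unfolding dedekind_error_def by linarith
qed

lemma abs_dedekind_error_le:
  assumes "N > 0" "coprime a N"
  shows "\<bar>dedekind_error a N\<bar> \<le> 6 * log 2 (real N)"
  using assms
proof (induction N arbitrary: a rule: less_induct)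
  case (less N)
  show ?case
  proof (cases "N \<le> 2")
    case True
    then show ?thesis using less.prems by (simp add: dedekind_error_eq_0)
  next
    case False
    then obtain b where b: "0 < b" "2 * b < N" "coprime b N" "\<bar>dedekind_error b N\<bar> = \<bar>dedekind_error a N\<bar>"
      using dedekind_error_half_range[OF less.prems(2)] by auto
    have "\<bar>dedekind_error b N\<bar> \<le> \<bar>dedekind_error N b\<bar> + 6" using b by (intro abs_dedekind_error_step)
    also have "\<dots> \<le> 6 * (log 2 (real b) + 1)"
      using less.IH[of b N] b by (simp add: coprime_commute)
    also have "\<dots> = 6 * log 2 (2 * real b)" using b by (simp add: log_mult)
    also have "\<dots> \<le> 6 * log 2 (real N)" using b by (intro mult_left_mono log_mono) auto
    finally show ?thesis using b by simp
  qed
qed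

section \<open>Inversion modulo N exchanges denominators and residues\<close>

definition invert_vec :: "int \<Rightarrow> int \<Rightarrow> int \<Rightarrow> int \<times> int \<Rightarrow> int \<times> int" where
  "invert_vec N a b v = (\<bar>lattice_res N a v\<bar>,
     sgn (lattice_res N a v) * ((a * b - 1) div N * fst v - b * snd v))"

lemma fst_invert_vec [simp]: "fst (invert_vec N a b v) = \<bar>lattice_res N a v\<bar>"
  by (simp add: invert_vec_def)

lemma lattice_res_invert_vec:
  assumes "[a * b = 1] (mod N)"
  shows "lattice_res N b (invert_vec N a b v) = sgn (lattice_res N a v) * fst v"
proof -
  define e k where "e = sgn (lattice_res N a v)" and "k = (a * b - 1) div N"
  have "N * k = a * b - 1" using assms by (simp add: k_def cong_iff_dvd_diff)
  then have "e * (fst v * (a * b - N * k)) = e * fst v" by simp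
  moreover have abs_eq: "\<bar>lattice_res N a v\<bar> = e * (a * fst v - snd v * N)"
    by (simp add: e_def lattice_res_def abs_sgn mult.commute)
  have "lattice_res N b (invert_vec N a b v) = e * (fst v * (a * b - N * k))"
    unfolding invert_vec_def e_def[symmetric] k_def[symmetric]
    by (simp add: lattice_res_def[of N b] abs_eq algebra_simps)
  ultimately show ?thesis by (simp add: e_def)
qed

lemma abs_lattice_res_invert_vec:
  assumes "[a * b = 1] (mod N)" "v \<in> conv_vecs N a"
  shows "\<bar>lattice_res N b (invert_vec N a b v)\<bar> = fst v"
  using conv_vecsD(1,3)[OF assms(2)] by (auto simp: lattice_res_invert_vec[OF assms(1)] abs_mult sgn_if)

lemma sgn_lattice_res_invert_vec:
  assumes "[a * b = 1] (mod N)" "v \<in> conv_vecs N a"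
  shows "sgn (lattice_res N b (invert_vec N a b v)) = sgn (lattice_res N a v)"
  using conv_vecsD(1)[OF assms(2)] by (simp add: lattice_res_invert_vec[OF assms(1)] sgn_mult)

lemma invert_vec_invert_vec:
  assumes ab: "[a * b = 1] (mod N)" and v: "v \<in> conv_vecs N a"
  shows "invert_vec N b a (invert_vec N a b v) = v"
proof (rule lattice_res_inject)
  show "fst (invert_vec N b a (invert_vec N a b v)) = fst v"
    using abs_lattice_res_invert_vec[OF ab v] by simp
  have "[b * a = 1] (mod N)" using ab by (simp add: mult.commute)
  then show "lattice_res N a (invert_vec N b a (invert_vec N a b v)) = lattice_res N a v"
    using sgn_lattice_res_invert_vec[OF ab v] by (simp add: lattice_res_invert_vec sgn_mult_abs)
  show "N \<noteq> 0" using conv_vecsD(1,5)[OF v] by linarith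
qed

lemma invert_vec_in_conv_vecs:
  assumes ab: "[a * b = 1] (mod N)" and v: "v \<in> conv_vecs N a"
  shows "invert_vec N a b v \<in> conv_vecs N b"
proof -
  note D = conv_vecsD[OF v]
  let ?w = "invert_vec N a b v"
  have "coprime (fst ?w) (snd ?w)"
  proof (rule coprimeI)
    fix d assume d: "d dvd fst ?w" "d dvd snd ?w"
    then have "d dvd lattice_res N b ?w" unfolding lattice_res_def by simp
    then have "d dvd fst (invert_vec N b a ?w)" "d dvd snd (invert_vec N b a ?w)"
      using d by (auto simp: invert_vec_def[of N b])
    then show "is_unit d"
      using coprime_common_divisor[OF D(2)] by (simp add: invert_vec_invert_vec[OF ab v])
  qed
  moreover have "lattice_res N b ?w \<noteq> 0" using abs_lattice_res_invert_vec[OF ab v] D(1) by auto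
  ultimately show ?thesis
    unfolding conv_vecs_def using abs_lattice_res_invert_vec[OF ab v] D by (simp add: mult.commute)
qed

lemma quality_invert_vec:
  assumes "[a * b = 1] (mod N)" "v \<in> conv_vecs N a"
  shows "quality N b (invert_vec N a b v) = quality N a v"
  by (simp add: quality_def abs_lattice_res_invert_vec[OF assms] mult.commute)

lemma signed_term_invert_vec:
  assumes "[a * b = 1] (mod N)" "v \<in> conv_vecs N a"
  shows "signed_term g N b (invert_vec N a b v) = signed_term g N a v"
  by (simp add: signed_term_def quality_invert_vec[OF assms] sgn_lattice_res_invert_vec[OF assms])

definition denom_vecs :: "nat \<Rightarrow> nat set \<Rightarrow> nat \<Rightarrow> (int \<times> int) set" where
  "denom_vecs N Y a = {v \<in> conv_vecs (int N) (int a). nat (fst v) \<in> Y}"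

definition res_vecs :: "nat \<Rightarrow> nat set \<Rightarrow> nat \<Rightarrow> (int \<times> int) set" where
  "res_vecs N Y a = {v \<in> conv_vecs (int N) (int a). nat \<bar>lattice_res (int N) (int a) v\<bar> \<in> Y}"

lemma finite_denom_vecs [simp, intro]: "finite (denom_vecs N Y a)"
  by (simp add: denom_vecs_def)

lemma finite_res_vecs [simp, intro]: "finite (res_vecs N Y a)"
  by (simp add: res_vecs_def)

lemma bij_betw_invert_vec:
  assumes ab: "[int a * int b = 1] (mod int N)"
  shows "bij_betw (invert_vec (int N) (int a) (int b)) (denom_vecs N Y a) (res_vecs N Y b)"
proof -
  have ba: "[int b * int a = 1] (mod int N)" using ab by (simp add: mult.commute)
  show ?thesis
  proof (rule bij_betw_byWitness[where f' = "invert_vec (int N) (int b) (int a)"])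
    show "\<forall>v\<in>denom_vecs N Y a. invert_vec (int N) (int b) (int a) (invert_vec (int N) (int a) (int b) v) = v"
      by (simp add: denom_vecs_def invert_vec_invert_vec[OF ab])
    show "\<forall>v\<in>res_vecs N Y b. invert_vec (int N) (int a) (int b) (invert_vec (int N) (int b) (int a) v) = v"
      by (simp add: res_vecs_def invert_vec_invert_vec[OF ba])
    show "invert_vec (int N) (int a) (int b) ` denom_vecs N Y a \<subseteq> res_vecs N Y b"
      by (auto simp: denom_vecs_def res_vecs_def invert_vec_in_conv_vecs[OF ab] abs_lattice_res_invert_vec[OF ab])
    show "invert_vec (int N) (int b) (int a) ` res_vecs N Y b \<subseteq> denom_vecs N Y a"
      by (auto simp: denom_vecs_def res_vecs_def invert_vec_in_conv_vecs[OF ba])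
  qed
qed

lemma sum_signed_term_denom_vecs:
  assumes "[int a * int b = 1] (mod int N)"
  shows "(\<Sum>v\<in>denom_vecs N Y a. signed_term g (int N) (int a) v) =
    (\<Sum>v\<in>res_vecs N Y b. signed_term g (int N) (int b) v)"
  unfolding sum.reindex_bij_betw[OF bij_betw_invert_vec[OF assms], symmetric]
  by (simp add: denom_vecs_def signed_term_invert_vec[OF assms])

lemma ex_quality_res_vecs:
  assumes "[int a * int b = 1] (mod int N)" "\<exists>v\<in>denom_vecs N Y a. P (quality (int N) (int a) v)"
  shows "\<exists>v\<in>res_vecs N Y b. P (quality (int N) (int b) v)"
proof -
  obtain v where v: "v \<in> denom_vecs N Y a" "P (quality (int N) (int a) v)" using assms(2) by blast
  have "invert_vec (int N) (int a) (int b) v \<in> res_vecs N Y b"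
    using bij_betw_invert_vec[OF assms(1)] v(1) by (rule bij_betw_apply)
  moreover have "v \<in> conv_vecs (int N) (int a)" using v(1) by (simp add: denom_vecs_def)
  ultimately show ?thesis using v(2) quality_invert_vec[OF assms(1)] by metis
qed

lemma nat_modular_inverse_in_totatives:
  assumes "N > 1" "a \<in> totatives N"
  shows "nat (modular_inverse (int N) (int a)) \<in> totatives N"
    "[int a * int (nat (modular_inverse (int N) (int a))) = 1] (mod int N)"
proof -
  have "coprime (int a) (int N)" using assms(2) by (simp add: in_totatives_iff)
  moreover from this have "modular_inverse (int N) (int a) > 0"
    using assms(1) by (intro mult_modular_inverse_int_pos) auto
  moreover have "modular_inverse (int N) (int a) < int N"
    using assms(1) by (intro modular_inverse_int_less) auto
  ultimately show "nat (modular_inverse (int N) (int a)) \<in> totatives N"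
    "[int a * int (nat (modular_inverse (int N) (int a))) = 1] (mod int N)"
    using cong_modular_inverse1[of "int a" "int N"] coprime_modular_inverse[of "int a" "int N"]
    by (auto simp: in_totatives_iff coprime_int_iff[symmetric] simp del: coprime_int_iff)
qed

lemma card_totatives_le_by_inverse:
  assumes N: "N > 1"
    and PQ: "\<And>a b. [int a * int b = 1] (mod int N) \<Longrightarrow> P a \<Longrightarrow> Q b"
  shows "card {a \<in> totatives N. P a} \<le> card {b \<in> totatives N. Q b}"
proof (rule card_inj_on_le[where f = "\<lambda>a. nat (modular_inverse (int N) (int a))"])
  note inverse = nat_modular_inverse_in_totatives[OF N]
  show "inj_on (\<lambda>a. nat (modular_inverse (int N) (int a))) {a \<in> totatives N. P a}"
  proof (rule inj_onI)
    fix a b assume ab: "a \<in> {a \<in> totatives N. P a}" "b \<in> {a \<in> totatives N. P a}"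
      "nat (modular_inverse (int N) (int a)) = nat (modular_inverse (int N) (int b))"
    define c where "c = nat (modular_inverse (int N) (int a))"
    have "[int a * int c = 1] (mod int N)" "[int b * int c = 1] (mod int N)"
      using inverse(2)[of a] inverse(2)[of b] ab by (simp_all add: c_def)
    then have "[int a * int c = int b * int c] (mod int N)" using cong_trans cong_sym by blast
    then have "[a * c = b * c] (mod N)" by (simp flip: of_nat_mult add: cong_int_iff)
    moreover have "coprime c N" using inverse(1)[of a] ab(1) by (simp add: c_def in_totatives_iff)
    ultimately have "[a = b] (mod N)" by (simp add: cong_mult_rcancel_nat)
    moreover have "a < N" "b < N" using ab N totatives_less by auto
    ultimately show "a = b" by (simp add: Cong.cong_def)
  qed
  show "(\<lambda>a. nat (modular_inverse (int N) (int a))) ` {a \<in> totatives N. P a} \<subseteq> {b \<in> totatives N. Q b}"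
    using inverse PQ by blast
qed simp

section \<open>Vectors of prescribed residue\<close>

definition res_pairs :: "nat \<Rightarrow> nat \<Rightarrow> (nat \<times> int \<times> int) set" where
  "res_pairs N y = {(a, v). a \<in> totatives N \<and> v \<in> conv_vecs (int N) (int a) \<and>
     lattice_res (int N) (int a) v = int y}"

lemma finite_conv_pairs: "finite {(a, v). a \<in> totatives N \<and> v \<in> conv_vecs (int N) (int a) \<and> P a v}"
  by (rule finite_subset[of _ "Sigma (totatives N) (\<lambda>a. conv_vecs (int N) (int a))"]) auto

lemma finite_res_pairs [simp, intro]: "finite (res_pairs N y)"
  unfolding res_pairs_def by (rule finite_conv_pairs)

lemma diff_in_totatives:
  assumes "a \<in> totatives N" "N > 1"
  shows "N - a \<in> totatives N"
proof -
  have a: "0 < a" "a < N" "coprime a N" using assms totatives_less by (auto simp: in_totatives_iff)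
  have "coprime (N - a) N" using gcd_diff2_nat[of a N] a by (simp only: coprime_iff_gcd_eq_1)
  then show ?thesis using a by (auto simp: in_totatives_iff)
qed

definition reflect_pair :: "nat \<Rightarrow> nat \<times> int \<times> int \<Rightarrow> nat \<times> int \<times> int" where
  "reflect_pair N = (\<lambda>(a, v). (N - a, shear_vec (- 1) 1 v))"

lemma reflect_pair:
  assumes "a \<in> totatives N" "v \<in> conv_vecs (int N) (int a)"
  shows "N - a \<in> totatives N" "shear_vec (- 1) 1 v \<in> conv_vecs (int N) (int (N - a))"
    "lattice_res (int N) (int (N - a)) (shear_vec (- 1) 1 v) = - lattice_res (int N) (int a) v"
    "reflect_pair N (reflect_pair N (a, v)) = (a, v)"
proof -
  have "N > 1" using conv_vecsD(1,5)[OF assms(2)] by linarith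
  then show "N - a \<in> totatives N" using assms(1) by (intro diff_in_totatives)
  have "a \<le> N" using assms(1) by (rule totatives_le)
  then have N: "int (N - a) = - 1 * int a + 1 * int N" by (simp add: of_nat_diff)
  show "shear_vec (- 1) 1 v \<in> conv_vecs (int N) (int (N - a))"
    unfolding N by (rule shear_vec_in_conv_vecs[OF _ assms(2)]) simp
  show "lattice_res (int N) (int (N - a)) (shear_vec (- 1) 1 v) = - lattice_res (int N) (int a) v"
    unfolding N by (simp only: lattice_res_shear_vec)
  show "reflect_pair N (reflect_pair N (a, v)) = (a, v)"
    using \<open>a \<le> N\<close> shear_vec_inverse[of "- 1" 1 v] by (simp add: reflect_pair_def)
qed

lemma bij_betw_reflect_pair:
  "bij_betw (reflect_pair N)
     {(a, v). a \<in> totatives N \<and> v \<in> conv_vecs (int N) (int a) \<and> P (lattice_res (int N) (int a) v)}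
     {(a, v). a \<in> totatives N \<and> v \<in> conv_vecs (int N) (int a) \<and> P (- lattice_res (int N) (int a) v)}"
  by (rule bij_betw_byWitness[where f' = "reflect_pair N"])
    (auto simp: reflect_pair(4), auto simp: reflect_pair_def reflect_pair(1-3))

lemma sum_res_vecs:
  fixes F :: "nat \<Rightarrow> int \<times> int \<Rightarrow> real"
  assumes Y: "finite Y" "0 \<notin> Y"
    and reflect: "\<And>a v. a \<in> totatives N \<Longrightarrow> v \<in> conv_vecs (int N) (int a) \<Longrightarrow>
      F (N - a) (shear_vec (- 1) 1 v) = F a v"
  shows "(\<Sum>a\<in>totatives N. \<Sum>v\<in>res_vecs N Y a. F a v) = 2 * (\<Sum>y\<in>Y. \<Sum>(a, v)\<in>res_pairs N y. F a v)"
proof -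
  let ?r = "\<lambda>a v. lattice_res (int N) (int a) v"
  define Pos where "Pos = {(a, v). a \<in> totatives N \<and> v \<in> conv_vecs (int N) (int a) \<and> ?r a v \<in> int ` Y}"
  define Neg where "Neg = {(a, v). a \<in> totatives N \<and> v \<in> conv_vecs (int N) (int a) \<and> - ?r a v \<in> int ` Y}"
  have "x \<in> int ` Y \<longleftrightarrow> 0 \<le> x \<and> nat x \<in> Y" for x
    by (auto simp: image_iff intro!: bexI[of _ "nat x"])
  then have "nat \<bar>x\<bar> \<in> Y \<longleftrightarrow> x \<in> int ` Y \<or> - x \<in> int ` Y" for x
    by (cases "x = 0") (auto simp: abs_if)
  then have split: "Sigma (totatives N) (res_vecs N Y) = Pos \<union> Neg"
    by (auto simp: res_vecs_def Pos_def Neg_def)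
  have disjoint: "Pos \<inter> Neg = {}" using Y(2) by (auto simp: Pos_def Neg_def)
  have fin: "finite Pos" "finite Neg" unfolding Pos_def Neg_def by (rule finite_conv_pairs)+
  have "(\<Sum>(a, v)\<in>Neg. F a v) = (\<Sum>x\<in>Pos. (\<lambda>(a, v). F a v) (reflect_pair N x))"
    unfolding Pos_def Neg_def by (rule sum.reindex_bij_betw[OF bij_betw_reflect_pair, symmetric])
  also have "\<dots> = (\<Sum>(a, v)\<in>Pos. F a v)"
    by (intro sum.cong refl) (auto simp: Pos_def reflect_pair_def reflect)
  finally have Neg: "(\<Sum>(a, v)\<in>Neg. F a v) = (\<Sum>(a, v)\<in>Pos. F a v)" .
  have "Pos = (\<Union>y\<in>Y. res_pairs N y)" by (auto simp: Pos_def res_pairs_def)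
  then have "(\<Sum>(a, v)\<in>Pos. F a v) = (\<Sum>y\<in>Y. \<Sum>(a, v)\<in>res_pairs N y. F a v)"
    using Y(1) by (simp only:) (intro sum.UNION_disjoint, simp_all, auto simp: res_pairs_def)
  moreover have "(\<Sum>a\<in>totatives N. \<Sum>v\<in>res_vecs N Y a. F a v) = (\<Sum>(a, v)\<in>Pos \<union> Neg. F a v)"
    by (subst sum.Sigma) (simp_all add: split)
  ultimately show ?thesis by (simp add: sum.union_disjoint[OF fin disjoint] Neg)
qed

subsection \<open>Transposition\<close>

lemma complement_exists:
  assumes "coprime (fst v) (snd v)" "lattice_res N a v > 0"
  shows "\<exists>w. vec_det v w = 1 \<and> lattice_res N a w \<in> {0<..lattice_res N a v}"
proof -
  obtain x z where "x * fst v + z * snd v = 1"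
    using assms(1) bezout_int[of "fst v" "snd v"] by (auto simp: coprime_iff_gcd_eq_1)
  then have bezout: "vec_det v (- z, x) = 1" by (simp add: vec_det_def algebra_simps)
  define y r k where "y = lattice_res N a v" and "r = lattice_res N a (- z, x)" and "k = (r - 1) div y"
  define w where "w = (- z - k * fst v, x - k * snd v)"
  have "lattice_res N a w - 1 = (r - 1) - k * y"
    by (simp add: w_def r_def y_def lattice_res_def algebra_simps)
  also have "\<dots> = (r - 1) mod y" by (simp add: k_def minus_div_mult_eq_mod)
  finally have "lattice_res N a w - 1 = (r - 1) mod y" .
  moreover have "0 \<le> (r - 1) mod y" "(r - 1) mod y < y" using assms(2) by (simp_all add: y_def)
  ultimately have "lattice_res N a w \<in> {0<..y}" by auto
  moreover have "vec_det v w = 1" using bezout by (simp add: w_def vec_det_def algebra_simps)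
  ultimately show ?thesis unfolding y_def by blast
qed

lemma complement_unique:
  assumes "vec_det v w = 1" "lattice_res N a w \<in> {0<..lattice_res N a v}"
    and "vec_det v u = 1" "lattice_res N a u \<in> {0<..lattice_res N a v}"
  shows "w = u"
proof -
  define k y where "k = vec_det u w" and "y = lattice_res N a v"
  have "vec_det v w * fst u = vec_det v u * fst w + k * fst v"
    "vec_det v w * snd u = vec_det v u * snd w + k * snd v"
    by (simp_all add: vec_det_def k_def algebra_simps)
  then have u: "fst u = fst w + k * fst v" "snd u = snd w + k * snd v" using assms by simp_all
  then have "lattice_res N a u = lattice_res N a w + k * y"
    by (simp add: lattice_res_def y_def algebra_simps)
  then have "k * y < 1 * y" "(- 1) * y < k * y"
    using assms(2,4) unfolding y_def[symmetric] greaterThanAtMost_iff by linarith+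
  moreover have "y > 0" using assms(2) by (auto simp: y_def)
  ultimately have "k = 0" by (simp only: mult_less_cancel_right_pos)
  then show ?thesis using u by (simp add: prod_eq_iff)
qed

definition complement :: "int \<Rightarrow> int \<Rightarrow> int \<times> int \<Rightarrow> int \<times> int" where
  "complement N a v = (THE w. vec_det v w = 1 \<and> lattice_res N a w \<in> {0<..lattice_res N a v})"

lemma complement:
  assumes "coprime (fst v) (snd v)" "lattice_res N a v > 0"
  shows "vec_det v (complement N a v) = 1" "lattice_res N a (complement N a v) \<in> {0<..lattice_res N a v}"
proof -
  have "\<exists>!w. vec_det v w = 1 \<and> lattice_res N a w \<in> {0<..lattice_res N a v}"
    using complement_exists[OF assms] complement_unique by blast
  from theI'[OF this] show "vec_det v (complement N a v) = 1"
    "lattice_res N a (complement N a v) \<in> {0<..lattice_res N a v}"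
    by (simp_all only: complement_def)
qed

lemma complement_eqI:
  assumes "vec_det v w = 1" "lattice_res N a w \<in> {0<..lattice_res N a v}"
  shows "complement N a v = w"
  unfolding complement_def using assms complement_unique by (intro the_equality) blast+

lemma coprime_vec_det_1:
  assumes "vec_det v w = 1"
  shows "coprime (fst v) (snd v)" "coprime (fst v) (fst w)"
proof -
  have "d dvd 1" if "d dvd fst v" "d dvd snd v \<or> d dvd fst w" for d
    unfolding assms[symmetric] vec_det_def using that by auto
  then show "coprime (fst v) (snd v)" "coprime (fst v) (fst w)" by (blast intro: coprimeI)+
qed

lemma vec_det_transpose: "vec_det (fst v, fst w) (snd v, snd w) = vec_det v w"
  by (simp add: vec_det_def)

lemma lattice_res_transpose:
  assumes "vec_det v w = 1"
  shows "lattice_res (- lattice_res N a v) (- lattice_res N a w) (fst v, fst w) = N"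
    "lattice_res (- lattice_res N a v) (- lattice_res N a w) (snd v, snd w) = a"
  using fst_lattice_res_det[of w N a v] snd_lattice_res_det[of w N a v] assms
  by (simp_all add: lattice_res_def[of "- lattice_res N a v"] mult.commute)

lemma complement_transpose:
  assumes "vec_det v w = 1" "a \<in> {0<..N}"
  shows "complement (- lattice_res N a v) (- lattice_res N a w) (fst v, fst w) = (snd v, snd w)"
  using assms by (intro complement_eqI) (simp_all add: vec_det_transpose lattice_res_transpose)

lemma coprime_lattice_res_iff:
  assumes "vec_det v w = 1"
  shows "coprime (lattice_res N a w) (lattice_res N a v) \<longleftrightarrow> coprime a N"
proof -
  have "d dvd lattice_res N a w \<and> d dvd lattice_res N a v \<longleftrightarrow> d dvd a \<and> d dvd N" for d
  proof
    assume "d dvd lattice_res N a w \<and> d dvd lattice_res N a v"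
    then have "d dvd lattice_res (- lattice_res N a v) (- lattice_res N a w) u" for u
      unfolding lattice_res_def[of "- lattice_res N a v"] by simp
    then show "d dvd a \<and> d dvd N" by (metis lattice_res_transpose[OF assms])
  qed (simp add: lattice_res_def)
  then show ?thesis unfolding coprime_def by metis
qed

definition tail_denoms :: "nat \<Rightarrow> nat \<Rightarrow> nat \<Rightarrow> nat set" where
  "tail_denoms N y s = {q. q > 0 \<and> 2 * (q * y) < N \<and> y dvd q * s + N \<and> coprime q ((q * s + N) div y)}"

lemma finite_tail_denoms:
  assumes "y > 0"
  shows "finite (tail_denoms N y s)"
proof (rule finite_subset)
  show "tail_denoms N y s \<subseteq> {..N}"
  proof
    fix q assume "q \<in> tail_denoms N y s"
    then have "2 * (q * y) < N" by (simp add: tail_denoms_def)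
    moreover have "q * 1 \<le> q * y" using assms by (intro mult_left_mono) auto
    ultimately have "q \<le> N" by linarith
    then show "q \<in> {..N}" by simp
  qed
qed simp

lemma res_pairsD:
  assumes "(a, v) \<in> res_pairs N y" "y > 0"
  defines "w \<equiv> complement (int N) (int a) v"
  defines "s \<equiv> lattice_res (int N) (int a) w"
  shows "vec_det v w = 1" "s \<in> {0<..int y}" "fst w * int y = fst v * s + int N"
    "complement (- int y) (- s) (fst v, fst w) = (snd v, snd w)"
    "lattice_res (- int y) (- s) (snd v, snd w) = int a" "coprime s (int y)"
proof -
  have a: "int a \<in> {0<..int N}" "coprime a N" and v: "v \<in> conv_vecs (int N) (int a)"
    and res: "lattice_res (int N) (int a) v = int y"
    using assms(1) by (auto simp: res_pairs_def in_totatives_iff)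
  show det: "vec_det v w = 1" and "s \<in> {0<..int y}"
    using complement[OF conv_vecsD(2)[OF v], of "int N" "int a"] assms(2) by (simp_all add: w_def s_def res)
  show "fst w * int y = fst v * s + int N"
    using fst_lattice_res_det[of w "int N" "int a" v] by (simp add: det res s_def)
  show "complement (- int y) (- s) (fst v, fst w) = (snd v, snd w)"
    using complement_transpose[OF det a(1)] by (simp add: res s_def)
  show "lattice_res (- int y) (- s) (snd v, snd w) = int a"
    using lattice_res_transpose(2)[OF det, of "int N" "int a"] by (simp add: res s_def)
  show "coprime s (int y)"
    using coprime_lattice_res_iff[OF det, of "int N" "int a"] a(2) by (simp add: res s_def)
qed

definition tail_params :: "nat \<Rightarrow> nat \<times> int \<times> int \<Rightarrow> nat \<times> nat" where
  "tail_params N = (\<lambda>(a, v). (nat (lattice_res (int N) (int a) (complement (int N) (int a) v)), nat (fst v)))"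

lemma inj_on_tail_params:
  assumes "y > 0"
  shows "inj_on (tail_params N) (res_pairs N y)"
proof (rule inj_onI)
  fix x x' assume in_pairs: "x \<in> res_pairs N y" "x' \<in> res_pairs N y" and eq: "tail_params N x = tail_params N x'"
  obtain a v a' v' where x: "x = (a, v)" "x' = (a', v')" by (cases x, cases x') auto
  define w w' where "w = complement (int N) (int a) v" and "w' = complement (int N) (int a') v'"
  note D = res_pairsD[OF in_pairs(1)[unfolded x] assms, folded w_def]
    and D' = res_pairsD[OF in_pairs(2)[unfolded x] assms, folded w'_def]
  have "fst v > 0" "fst v' > 0" using in_pairs conv_vecsD(1) by (fastforce simp: x res_pairs_def)+
  then have eq: "lattice_res (int N) (int a') w' = lattice_res (int N) (int a) w" "fst v' = fst v"
    using eq D(2) D'(2) by (auto simp: x tail_params_def w_def[symmetric] w'_def[symmetric] eq_nat_nat_iff)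
  then have "fst w' * int y = fst w * int y" using D(3) D'(3) by simp
  then have "fst w' = fst w" using assms by simp
  then have "(snd v', snd w') = (snd v, snd w)" using D(4) D'(4) eq by metis
  moreover from this have "int a' = int a" using D(5) D'(5) eq by metis
  ultimately show "x = x'" using eq by (simp add: x prod_eq_iff)
qed

lemma tail_params_in_Sigma:
  assumes "x \<in> res_pairs N y" "y > 0"
  shows "tail_params N x \<in> Sigma (totatives y) (tail_denoms N y)"
proof -
  obtain a v where x: "x = (a, v)" by (cases x)
  define w where "w = complement (int N) (int a) v"
  define s q where "s = nat (lattice_res (int N) (int a) w)" and "q = nat (fst v)"
  note D = res_pairsD[OF assms(1)[unfolded x] assms(2), folded w_def]
  have v: "v \<in> conv_vecs (int N) (int a)" "lattice_res (int N) (int a) v = int y"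
    using assms(1) by (auto simp: x res_pairs_def)
  have q: "fst v = int q" "q > 0" using conv_vecsD(1)[OF v(1)] by (auto simp: q_def)
  have s: "lattice_res (int N) (int a) w = int s" using D(2) by (simp add: s_def)
  have "s \<in> totatives y" using D(2,6) by (simp add: s in_totatives_iff)
  moreover have "q \<in> tail_denoms N y s"
  proof -
    have eq: "fst w * int y = int (q * s + N)" using D(3) by (simp add: s q)
    then have "0 \<le> fst w * int y" by simp
    then have "fst w \<ge> 0" using assms(2) by (simp add: zero_le_mult_iff)
    then have "nat (fst w) * y = q * s + N" using eq by (simp add: nat_mult_distrib flip: of_nat_eq_iff[where ?'a = int])
    then have "y dvd q * s + N" "(q * s + N) div y = nat (fst w)"
      using assms(2) by (metis dvd_triv_right, metis nonzero_mult_div_cancel_right not_gr_zero)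
    moreover have "coprime q (nat (fst w))"
      using coprime_vec_det_1(2)[OF D(1)] \<open>fst w \<ge> 0\<close> by (simp add: q flip: coprime_int_iff)
    moreover have "2 * (q * y) < N"
      using conv_vecsD(4)[OF v(1)] by (simp add: v(2) q flip: of_nat_mult)
    ultimately show ?thesis using q(2) by (simp add: tail_denoms_def)
  qed
  ultimately show ?thesis by (simp add: x tail_params_def w_def[symmetric] s q)
qed

lemma Sigma_subset_tail_params:
  assumes "N > 0" "y > 0" "s \<in> totatives y" "q \<in> tail_denoms N y s"
  shows "(s, q) \<in> tail_params N ` res_pairs N y"
proof -
  have s: "int s \<in> {0<..int y}" "coprime (int s) (int y)" using assms(3) by (simp_all add: in_totatives_iff)
  define q0 where "q0 = (q * s + N) div y"
  have q: "q > 0" "2 * (q * y) < N" "q0 * y = q * s + N" "coprime q q0"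
    using assms(4) by (auto simp: tail_denoms_def q0_def)
  define u where "u = (int q, int q0)"
  have "lattice_res (- int y) (- int s) u = int (q0 * y) - int (q * s)"
    by (simp add: u_def lattice_res_def)
  then have N: "lattice_res (- int y) (- int s) u = int N" by (simp add: q(3))
  define z where "z = complement (- int y) (- int s) u"
  have z: "vec_det u z = 1" "lattice_res (- int y) (- int s) z \<in> {0<..int N}"
    using complement[of u "- int y" "- int s"] q(4) assms(1) by (simp_all add: N z_def) (simp_all add: u_def)
  define a where "a = nat (lattice_res (- int y) (- int s) z)"
  have a: "lattice_res (- int y) (- int s) z = int a" using z(2) by (simp add: a_def)
  define v w where "v = (fst u, fst z)" and "w = (snd u, snd z)"
  have det: "vec_det v w = 1" using z(1) by (simp add: v_def w_def vec_det_transpose)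
  have "lattice_res (- int N) (- int a) v = - int y" "lattice_res (- int N) (- int a) w = - int s"
    using lattice_res_transpose[OF z(1), of "- int y" "- int s"] by (simp_all add: N a v_def w_def)
  then have res: "lattice_res (int N) (int a) v = int y" "lattice_res (int N) (int a) w = int s"
    by (simp_all add: lattice_res_def)
  have "complement (int N) (int a) v = w" using det s(1) by (intro complement_eqI) (simp_all add: res)
  then have "tail_params N (a, v) = (s, q)" by (simp add: tail_params_def res) (simp add: v_def u_def)
  moreover have "coprime a N" using coprime_lattice_res_iff[OF det, of "int N" "int a"] s(2) by (simp add: res)
  then have "a \<in> totatives N" using z(2) by (simp add: a in_totatives_iff)
  then have "(a, v) \<in> res_pairs N y"
    using q(1,2) assms(2) coprime_vec_det_1(1)[OF det]
    by (simp add: res_pairs_def conv_vecs_def res) (simp add: v_def u_def flip: of_nat_mult)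
  ultimately show ?thesis by force
qed

lemma bij_betw_tail_params:
  assumes "N > 0" "y > 0"
  shows "bij_betw (tail_params N) (res_pairs N y) (Sigma (totatives y) (tail_denoms N y))"
proof (rule bij_betw_imageI[OF inj_on_tail_params[OF assms(2)]])
  show "tail_params N ` res_pairs N y = Sigma (totatives y) (tail_denoms N y)"
  proof (intro subset_antisym image_subsetI subsetI)
    fix z assume "z \<in> Sigma (totatives y) (tail_denoms N y)"
    then show "z \<in> tail_params N ` res_pairs N y"
      by (elim SigmaE) (simp only: Sigma_subset_tail_params[OF assms])
  qed (rule tail_params_in_Sigma[OF _ assms(2)])
qed

section \<open>Sieve and divisor bounds\<close>

definition divisor_count :: "nat \<Rightarrow> nat" where
  "divisor_count N = card {d. d dvd N}"

lemma divisor_count_pos: "N > 0 \<Longrightarrow> divisor_count N > 0"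
  unfolding divisor_count_def by (subst card_gt_0_iff) auto

lemma divisor_count_ge_2:
  assumes "N \<ge> 2"
  shows "divisor_count N \<ge> 2"
proof -
  have "card {1, N} \<le> divisor_count N"
    unfolding divisor_count_def using assms by (intro card_mono finite_divisors_nat) auto
  then show ?thesis using assms by simp
qed

lemma divisor_count_mono: "M dvd N \<Longrightarrow> N > 0 \<Longrightarrow> divisor_count M \<le> divisor_count N"
  unfolding divisor_count_def by (intro card_mono) (auto intro: dvd_trans)

lemma prod_primes_dvd_iff:
  fixes X :: "'a :: factorial_semiring_gcd set"
  assumes "finite X" "\<And>p. p \<in> X \<Longrightarrow> prime p"
  shows "\<Prod>X dvd n \<longleftrightarrow> (\<forall>p\<in>X. p dvd n)"
  using assms
proof (induction X rule: finite_induct)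
  case (insert p X)
  have "coprime p (\<Prod>X)"
    using insert.hyps insert.prems by (intro prod_coprime_right) (auto intro: primes_coprime)
  then show ?case using insert by (auto intro: divides_mult)
qed auto

lemma prime_dvd_prod_primes_iff:
  fixes X :: "'a :: factorial_semiring_gcd set"
  assumes "finite X" "\<And>p. p \<in> X \<Longrightarrow> prime p" "prime p"
  shows "p dvd \<Prod>X \<longleftrightarrow> p \<in> X"
proof
  assume "p dvd \<Prod>X"
  then obtain x where "x \<in> X" "p dvd x" using assms by (auto simp: prime_dvd_prod_iff)
  then show "p \<in> X" using assms primes_dvd_imp_eq[of p x] by auto
qed (use assms in \<open>auto intro: dvd_prodI\<close>)

lemma two_pow_card_prime_factors_le:
  assumes "N > 0"
  shows "2 ^ card (prime_factors N) \<le> divisor_count N"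
proof -
  have X: "finite X" "\<And>p. p \<in> X \<Longrightarrow> prime p" if "X \<subseteq> prime_factors N" for X
    using that finite_subset[OF that] by auto
  have "inj_on (\<lambda>X. \<Prod>X) (Pow (prime_factors N))"
  proof (rule inj_onI)
    fix Y Z assume YZ: "Y \<in> Pow (prime_factors N)" "Z \<in> Pow (prime_factors N)" "\<Prod>Y = \<Prod>Z"
    then have "p \<in> Y \<longleftrightarrow> p \<in> Z" if "prime p" for p
      using prime_dvd_prod_primes_iff[OF X[of Y] that] prime_dvd_prod_primes_iff[OF X[of Z] that] by auto
    moreover have "prime p" if "p \<in> Y \<union> Z" for p using that YZ by auto
    ultimately show "Y = Z" by blast
  qed
  moreover have "\<Prod>Y dvd N" if "Y \<in> Pow (prime_factors N)" for Y
    using that X[of Y] prod_primes_dvd_iff[of Y N] by auto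
  ultimately have "card (Pow (prime_factors N)) \<le> divisor_count N"
    unfolding divisor_count_def using finite_divisors_nat[OF assms] by (intro card_inj_on_le) auto
  then show ?thesis by (simp add: card_Pow)
qed

lemma sum_inclusion_exclusion:
  fixes h :: "'a \<Rightarrow> 'b :: comm_ring_1"
  assumes "finite A" "finite P"
  shows "(\<Sum>x | x \<in> A \<and> (\<forall>p\<in>P. \<not> b p x). h x) =
    (\<Sum>X\<in>Pow P. (-1) ^ card X * (\<Sum>x | x \<in> A \<and> (\<forall>p\<in>X. b p x). h x))"
proof -
  have prod_of_bool: "(\<Prod>p\<in>X. of_bool (c p) :: 'b) = of_bool (\<forall>p\<in>X. c p)"
    if "finite X" for X and c :: "'c \<Rightarrow> bool"
    using that by (induction X rule: finite_induct) auto
  have indicator: "of_bool (\<forall>p\<in>P. \<not> b p x) = (\<Sum>X\<in>Pow P. (-1) ^ card X * of_bool (\<forall>p\<in>X. b p x) :: 'b)" for x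
  proof -
    have "of_bool (\<forall>p\<in>P. \<not> b p x) = (\<Prod>p\<in>P. of_bool (\<not> b p x) :: 'b)"
      using prod_of_bool[OF assms(2)] by metis
    also have "\<dots> = (\<Prod>p\<in>P. 1 - of_bool (b p x))" by (intro prod.cong) auto
    also have "\<dots> = (\<Sum>X\<in>Pow P. (-1) ^ card X * (\<Prod>p\<in>X. of_bool (b p x)) * (\<Prod>p\<in>P - X. 1))"
      by (rule prod_diff_conv_sum[OF assms(2)])
    also have "\<dots> = (\<Sum>X\<in>Pow P. (-1) ^ card X * of_bool (\<forall>p\<in>X. b p x))"
      using assms(2) by (intro sum.cong refl) (auto simp: prod_of_bool finite_subset)
    finally show ?thesis .
  qed
  have "(\<Sum>x | x \<in> A \<and> (\<forall>p\<in>P. \<not> b p x). h x) = (\<Sum>x\<in>A. of_bool (\<forall>p\<in>P. \<not> b p x) * h x)"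
    using assms(1) by (simp add: sum.inter_filter of_bool_def if_distrib[of "\<lambda>c. c * _"] cong: if_cong)
  also have "\<dots> = (\<Sum>x\<in>A. \<Sum>X\<in>Pow P. (-1) ^ card X * (of_bool (\<forall>p\<in>X. b p x) * h x))"
    unfolding indicator by (simp add: sum_distrib_right mult.assoc)
  also have "\<dots> = (\<Sum>X\<in>Pow P. (-1) ^ card X * (\<Sum>x\<in>A. of_bool (\<forall>p\<in>X. b p x) * h x))"
    by (subst sum.swap) (simp add: sum_distrib_left)
  also have "\<dots> = (\<Sum>X\<in>Pow P. (-1) ^ card X * (\<Sum>x | x \<in> A \<and> (\<forall>p\<in>X. b p x). h x))"
    using assms(1) by (simp add: sum.inter_filter of_bool_def if_distrib[of "\<lambda>c. c * _"] cong: if_cong)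
  finally show ?thesis .
qed

lemma coprime_iff_no_common_prime_factor:
  fixes x z N :: nat
  assumes "N > 0" "gcd x z dvd N"
  shows "coprime x z \<longleftrightarrow> (\<forall>p\<in>prime_factors N. \<not> (p dvd x \<and> p dvd z))"
proof
  assume "coprime x z"
  then show "\<forall>p\<in>prime_factors N. \<not> (p dvd x \<and> p dvd z)"
    using coprime_common_divisor not_prime_unit by blast
next
  assume none: "\<forall>p\<in>prime_factors N. \<not> (p dvd x \<and> p dvd z)"
  show "coprime x z"
  proof (rule ccontr)
    assume "\<not> coprime x z"
    then obtain p where p: "prime p" "p dvd gcd x z"
      by (metis coprime_iff_gcd_eq_1 prime_factor_nat)
    then have "p dvd N" using assms(2) by (metis dvd_trans)
    then have "p \<in> prime_factors N" using p(1) assms(1) by (simp add: in_prime_factors_iff)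
    moreover have "p dvd x" "p dvd z" using p(2) by simp_all
    ultimately show False using none by blast
  qed
qed

lemma sum_coprime_sieve:
  fixes h :: "'a \<Rightarrow> real" and f k :: "'a \<Rightarrow> nat"
  assumes "finite A" "N > 0" "\<And>x. x \<in> A \<Longrightarrow> gcd (f x) (k x) dvd N"
  shows "(\<Sum>x | x \<in> A \<and> coprime (f x) (k x). h x) =
    (\<Sum>X\<in>Pow (prime_factors N). (-1) ^ card X * (\<Sum>x | x \<in> A \<and> \<Prod>X dvd f x \<and> \<Prod>X dvd k x. h x))"
proof -
  have "{x. x \<in> A \<and> coprime (f x) (k x)} =
      {x. x \<in> A \<and> (\<forall>p\<in>prime_factors N. \<not> (p dvd f x \<and> p dvd k x))}"
    using coprime_iff_no_common_prime_factor[OF assms(2,3)] by blast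
  moreover have "{x. x \<in> A \<and> (\<forall>p\<in>X. p dvd f x \<and> p dvd k x)} = {x. x \<in> A \<and> \<Prod>X dvd f x \<and> \<Prod>X dvd k x}"
    if "X \<in> Pow (prime_factors N)" for X
  proof -
    have "finite X" "\<And>p. p \<in> X \<Longrightarrow> prime p" using that finite_subset by auto
    then show ?thesis by (auto simp: prod_primes_dvd_iff)
  qed
  ultimately show ?thesis
    using sum_inclusion_exclusion[OF assms(1), where P = "prime_factors N"
        and b = "\<lambda>p x. p dvd f x \<and> p dvd k x" and h = h]
    by simp
qed

lemma card_multiples:
  assumes "d > 0"
  shows "card {x \<in> {1..n}. d dvd x} = n div (d::nat)"
proof -
  have "{x \<in> {1..n}. d dvd x} = (\<lambda>j. d * j) ` {1..n div d}"
    using assms by (auto simp: less_eq_div_iff_mult_less_eq mult.commute elim!: dvdE)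
  then show ?thesis using assms by (simp add: card_image inj_on_def)
qed

lemma real_div_bounds:
  "real (n div d) \<le> real n / real d" "real n / real d - 1 \<le> real (n div d)"
  using floor_divide_of_nat_eq[of n d, where ?'a = real] by linarith+

lemma card_coprime_eq_sieve:
  assumes "M > 0"
  shows "real (card {x \<in> {1..n}. coprime x M}) =
    (\<Sum>X\<in>Pow (prime_factors M). (-1) ^ card X * real (n div \<Prod>X))"
proof -
  have "real (card {x \<in> {1..n}. coprime x M}) = (\<Sum>x | x \<in> {1..n} \<and> coprime x M. 1)" by simp
  also have "\<dots> = (\<Sum>X\<in>Pow (prime_factors M). (-1) ^ card X * (\<Sum>x | x \<in> {1..n} \<and> \<Prod>X dvd x \<and> \<Prod>X dvd M. 1))"
    using assms by (intro sum_coprime_sieve) auto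
  also have "\<dots> = (\<Sum>X\<in>Pow (prime_factors M). (-1) ^ card X * real (n div \<Prod>X))"
  proof (intro sum.cong refl)
    fix X assume "X \<in> Pow (prime_factors M)"
    then have X: "finite X" "\<And>p. p \<in> X \<Longrightarrow> prime p" "\<And>p. p \<in> X \<Longrightarrow> p dvd M"
      using finite_subset by auto
    have "\<Prod>X dvd M" using X by (simp add: prod_primes_dvd_iff)
    then have "(\<Sum>x | x \<in> {1..n} \<and> \<Prod>X dvd x \<and> \<Prod>X dvd M. 1) = real (card {x \<in> {1..n}. \<Prod>X dvd x})"
      by simp
    moreover have "\<Prod>X > 0" using X(2) by (auto intro!: prod_pos simp: prime_gt_0_nat)
    ultimately show "(-1) ^ card X * (\<Sum>x | x \<in> {1..n} \<and> \<Prod>X dvd x \<and> \<Prod>X dvd M. 1) =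
        (-1) ^ card X * real (n div \<Prod>X)"
      by (simp only: card_multiples)
  qed
  finally show ?thesis .
qed

lemma card_coprime_le:
  assumes "M > 0"
  shows "real (card {x \<in> {1..n}. coprime x M}) \<le> real n * (real (totient M) / real M) + real (divisor_count M)"
proof -
  define P where "P = prime_factors M"
  have "real (card {x \<in> {1..n}. coprime x M}) \<le> (\<Sum>X\<in>Pow P. (-1) ^ card X * (real n / real (\<Prod>X)) + 1)"
    unfolding card_coprime_eq_sieve[OF assms] P_def[symmetric]
  proof (intro sum_mono)
    fix X
    show "(-1) ^ card X * real (n div \<Prod>X) \<le> (-1) ^ card X * (real n / real (\<Prod>X)) + 1"
      using real_div_bounds[of n "\<Prod>X"] by (cases "even (card X)") (simp_all add: algebra_simps)
  qed
  also have "\<dots> = real n * (\<Sum>X\<in>Pow P. (-1) ^ card X * (\<Prod>p\<in>X. 1 / real p)) + 2 ^ card P"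
    by (simp add: P_def sum.distrib card_Pow sum_distrib_left prod_dividef mult_ac)
  also have "(\<Sum>X\<in>Pow P. (-1) ^ card X * (\<Prod>p\<in>X. 1 / real p)) = (\<Prod>p\<in>P. 1 - 1 / real p)"
    using prod_diff_conv_sum[of P "\<lambda>_. 1" "\<lambda>p. 1 / real p"] by (simp add: P_def)
  also have "\<dots> = real (totient M) / real M"
    unfolding totient_formula2 P_def using assms by simp
  also have "(2::real) ^ card P \<le> real (divisor_count M)"
    using two_pow_card_prime_factors_le[OF assms] unfolding P_def
    by (metis of_nat_le_iff of_nat_numeral of_nat_power)
  finally show ?thesis by simp
qed

lemma totient_le_mult_totient:
  assumes "M dvd N" "N > 0"
  shows "totient N \<le> N div M * totient M"
proof -
  have M: "M > 0" using assms by (auto intro: Nat.gr0I)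
  have sub: "prime_factors M \<subseteq> prime_factors N" using assms by (intro dvd_prime_factors) auto
  have factor: "0 \<le> 1 - 1 / real p \<and> 1 - 1 / real p \<le> 1" if "p \<in> prime_factors N" for p
    using that prime_ge_1_nat[of p] by (auto simp: in_prime_factors_iff)
  have "(\<Prod>p\<in>prime_factors N. 1 - 1 / real p) =
      (\<Prod>p\<in>prime_factors N - prime_factors M. 1 - 1 / real p) * (\<Prod>p\<in>prime_factors M. 1 - 1 / real p)"
    by (rule prod.subset_diff[OF sub]) auto
  also have "\<dots> \<le> 1 * (\<Prod>p\<in>prime_factors M. 1 - 1 / real p)"
    using factor sub by (intro mult_right_mono prod_le_1 prod_nonneg) auto
  finally have "real (totient N) \<le> real N * (\<Prod>p\<in>prime_factors M. 1 - 1 / real p)"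
    unfolding totient_formula2 by (intro mult_left_mono) auto
  also have "\<dots> = real (N div M) * real (totient M)"
    unfolding totient_formula2[of M] using assms(1) M by (simp add: real_of_nat_div)
  finally have "real (totient N) \<le> real (N div M * totient M)" by simp
  then show ?thesis by (simp only: of_nat_le_iff)
qed

lemma le_divisor_count_mult_totient:
  assumes "N > 0"
  shows "N \<le> divisor_count N * totient N"
proof -
  have "(\<Prod>p\<in>prime_factors N. 1 / 2) \<le> (\<Prod>p\<in>prime_factors N. 1 - 1 / real p)"
  proof (intro prod_mono conjI)
    fix p assume "p \<in> prime_factors N"
    then have "p \<ge> 2" by (auto simp: in_prime_factors_iff prime_ge_2_nat)
    then show "1 / 2 \<le> 1 - 1 / real p" by (simp add: field_simps)
  qed auto
  then have "real N * (1 / 2 ^ card (prime_factors N)) \<le> real (totient N)"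
    unfolding totient_formula2 by (intro mult_left_mono) (auto simp: power_divide)
  then have "real N \<le> real (2 ^ card (prime_factors N) * totient N)" by (simp add: field_simps)
  then have "N \<le> 2 ^ card (prime_factors N) * totient N" by (simp only: of_nat_le_iff)
  also have "\<dots> \<le> divisor_count N * totient N"
    by (intro mult_right_mono two_pow_card_prime_factors_le assms) auto
  finally show ?thesis .
qed

subsection \<open>Linear congruences over totatives\<close>

lemma coprime_lift:
  fixes c M N :: nat
  assumes "coprime c M" "N > 0"
  obtains u where "coprime u N" "[u = c] (mod M)"
proof
  define X where "X = {p \<in> prime_factors N. \<not> p dvd c}"
  define k where "k = \<Prod>X"
  have X: "finite X" "\<And>p. p \<in> X \<Longrightarrow> prime p" by (auto simp: X_def)
  have prime_dvd_k: "p dvd k \<longleftrightarrow> p \<in> X" if "prime p" for p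
    unfolding k_def by (rule prime_dvd_prod_primes_iff[OF X that])
  show "[c + k * M = c] (mod M)" by (simp add: Cong.cong_def)
  show "coprime (c + k * M) N"
  proof (rule ccontr)
    assume "\<not> coprime (c + k * M) N"
    then obtain p where p: "prime p" "p dvd c + k * M" "p dvd N"
      by (metis coprime_iff_gcd_eq_1 gcd_nat.bounded_iff prime_factor_nat)
    show False
    proof (cases "p dvd c")
      case True
      then have "p dvd k * M" using p(2) by (simp add: dvd_add_right_iff)
      moreover have "\<not> p dvd M" using True assms(1) p(1) by (metis coprime_common_divisor not_prime_unit)
      moreover have "\<not> p dvd k" using prime_dvd_k[OF p(1)] True by (simp add: X_def)
      ultimately show False using p(1) prime_dvd_mult_iff by blast
    next
      case False
      then have "p dvd k" using prime_dvd_k[OF p(1)] p assms by (simp add: X_def in_prime_factors_iff)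
      then show False using False p(2) by (metis dvd_add_left_iff dvd_mult2)
    qed
  qed
qed

definition totatives_cong :: "nat \<Rightarrow> nat \<Rightarrow> nat \<Rightarrow> nat set" where
  "totatives_cong N M c = {a \<in> totatives N. [a = c] (mod M)}"

lemma finite_totatives_cong [simp, intro]: "finite (totatives_cong N M c)"
  by (simp add: totatives_cong_def)

lemma mult_mod_in_totatives_cong:
  assumes "M dvd N" "N > 1" "coprime u N" "a \<in> totatives_cong N M c"
  shows "u * a mod N \<in> totatives_cong N M (u * c)"
proof -
  have a: "coprime a N" "[a = c] (mod M)"
    using assms(4) by (simp_all add: totatives_cong_def in_totatives_iff)
  have "coprime (u * a mod N) N" using a(1) assms(2,3) by simp
  moreover from this have "u * a mod N > 0" using assms(2) by (intro Nat.gr0I) auto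
  moreover have "u * a mod N \<le> N" using assms(2) by (simp add: less_imp_le)
  moreover have "[u * a mod N = u * a] (mod M)"
    by (rule cong_dvd_modulus_nat[OF _ assms(1)]) (simp add: Cong.cong_def)
  then have "[u * a mod N = u * c] (mod M)"
    using cong_trans cong_mult[OF cong_refl a(2)] by blast
  ultimately show ?thesis by (simp add: totatives_cong_def in_totatives_iff)
qed

lemma inj_on_mult_mod_totatives_cong:
  assumes "N > 1" "coprime u N"
  shows "inj_on (\<lambda>a. u * a mod N) (totatives_cong N M c)"
proof (rule inj_onI)
  fix x y assume xy: "x \<in> totatives_cong N M c" "y \<in> totatives_cong N M c" "u * x mod N = u * y mod N"
  then have "[u * x = u * y] (mod N)" by (simp add: Cong.cong_def)
  then have "[x = y] (mod N)" using assms(2) by (simp add: cong_mult_lcancel_nat)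
  moreover have "x < N" "y < N" using xy assms(1) totatives_less by (auto simp: totatives_cong_def)
  ultimately show "x = y" by (simp add: Cong.cong_def)
qed

lemma totatives_cong_cong:
  assumes "[c = c'] (mod M)"
  shows "totatives_cong N M c = totatives_cong N M c'"
  using cong_trans[OF _ assms] cong_trans[OF _ cong_sym[OF assms]] by (auto simp: totatives_cong_def)

lemma card_totatives_cong_mono:
  assumes "M dvd N" "N > 1" "coprime c M" "coprime c' M"
  shows "card (totatives_cong N M c) \<le> card (totatives_cong N M c')"
proof -
  obtain i where i: "[c * i = 1] (mod M)" using cong_solve_coprime_nat[OF assms(3)] by auto
  then have "coprime i M" by (metis coprime_iff_invertible_nat mult.commute One_nat_def)
  then obtain u where u: "coprime u N" "[u = c' * i] (mod M)"
    using coprime_lift[of "c' * i" M N] assms(2,4) by auto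
  have "[u * c = c' * i * c] (mod M)" using u(2) by (intro cong_mult) auto
  also have "c' * i * c = c' * (c * i)" by simp
  also have "[c' * (c * i) = c' * 1] (mod M)" using i by (intro cong_mult) auto
  finally have "totatives_cong N M (u * c) = totatives_cong N M c'" by (intro totatives_cong_cong) simp
  then show ?thesis
    using mult_mod_in_totatives_cong[OF assms(1,2) u(1)]
    by (intro card_inj_on_le[OF inj_on_mult_mod_totatives_cong[OF assms(2) u(1)]]) auto
qed

lemma totatives_eq_UN_totatives_cong:
  assumes "M dvd N" "N > 0"
  shows "totatives N = (\<Union>d\<in>totatives M. totatives_cong N M d)"
proof (intro equalityI subsetI)
  fix a assume a: "a \<in> totatives N"
  have M: "M > 0" using assms by (auto intro: Nat.gr0I)
  show "a \<in> (\<Union>d\<in>totatives M. totatives_cong N M d)"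
  proof (cases "M = 1")
    case True
    then show ?thesis using a by (auto simp: totatives_cong_def)
  next
    case False
    have "coprime a M" using a assms(1) by (metis in_totatives_iff coprime_divisors dvd_refl)
    then have "a mod M \<in> totatives M"
      using False M by (auto simp: in_totatives_iff intro!: Nat.gr0I less_imp_le)
    moreover have "a \<in> totatives_cong N M (a mod M)" using a by (simp add: totatives_cong_def Cong.cong_def)
    ultimately show ?thesis by blast
  qed
qed (auto simp: totatives_cong_def)

lemma totatives_cong_disjoint:
  assumes "i \<in> totatives M" "j \<in> totatives M" "i \<noteq> j"
  shows "totatives_cong N M i \<inter> totatives_cong N M j = {}"
proof -
  have "\<not> [i = j] (mod M)"
  proof (cases "M > 1")
    case True
    then show ?thesis using assms totatives_less[of _ M] by (auto simp: Cong.cong_def)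
  next
    case False
    then have "M = 0 \<or> M = 1" by linarith
    then show ?thesis using assms by auto
  qed
  then show ?thesis unfolding totatives_cong_def by auto (metis cong_sym cong_trans)
qed

lemma card_totatives_cong:
  assumes "M dvd N" "N > 0" "coprime c M"
  shows "card (totatives_cong N M c) * totient M = totient N"
proof (cases "N = 1")
  case True
  then show ?thesis using assms by (simp add: totatives_cong_def Collect_conv_if)
next
  case False
  have "totient N = (\<Sum>d\<in>totatives M. card (totatives_cong N M d))"
    unfolding totient_def totatives_eq_UN_totatives_cong[OF assms(1,2)]
    by (intro card_UN_disjoint ballI impI totatives_cong_disjoint) auto
  also have "\<dots> = (\<Sum>d\<in>totatives M. card (totatives_cong N M c))"
    using False assms by (intro sum.cong refl antisym card_totatives_cong_mono) (auto simp: in_totatives_iff)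
  finally show ?thesis by (simp add: totient_def mult.commute)
qed

lemma gcd_eq_if_totative_mult_cong:
  assumes "a \<in> totatives N" "[a * q = y] (mod N)"
  shows "gcd q N = gcd y N"
proof -
  have "gcd q N = gcd (a * q) N"
    using assms(1) by (simp add: in_totatives_iff gcd_mult_left_left_cancel coprime_commute)
  also have "\<dots> = gcd y N" using assms(2) by (rule cong_gcd_eq)
  finally show ?thesis .
qed

lemma card_totatives_mult_cong_le:
  assumes "N > 0"
  shows "card {a \<in> totatives N. [a * q = y] (mod N)} * totient (N div gcd q N) \<le> totient N"
proof (cases "{a \<in> totatives N. [a * q = y] (mod N)} = {}")
  case True
  then show ?thesis by (simp only: card.empty)
next
  case False
  then obtain b where b: "b \<in> totatives N" "[b * q = y] (mod N)" by auto
  define d M x where "d = gcd q N" and "M = N div d" and "x = q div d"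
  have d: "d > 0" "N = d * M" "q = d * x" using assms by (simp_all add: d_def M_def x_def)
  have "coprime x M" unfolding x_def M_def d_def using assms by (intro div_gcd_coprime) auto
  have "M dvd N" by (simp add: d(2))
  have "{a \<in> totatives N. [a * q = y] (mod N)} \<subseteq> totatives_cong N M b"
  proof
    fix a assume a: "a \<in> {a \<in> totatives N. [a * q = y] (mod N)}"
    then have "[a * q = b * q] (mod N)" using b(2) cong_trans cong_sym by blast
    then have "[d * (a * x) = d * (b * x)] (mod (d * M))" by (simp add: d mult_ac)
    then have "[a * x = b * x] (mod M)" using d(1) by (simp add: Cong.cong_def mod_mult_mult1)
    then show "a \<in> totatives_cong N M b"
      using a \<open>coprime x M\<close> by (simp add: totatives_cong_def cong_mult_rcancel_nat)
  qed
  then have "card {a \<in> totatives N. [a * q = y] (mod N)} * totient M \<le> card (totatives_cong N M b) * totient M"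
    by (intro mult_right_mono card_mono) auto
  also have "\<dots> = totient N"
    using b(1) coprime_divisors[OF dvd_refl \<open>M dvd N\<close>, of b] \<open>M dvd N\<close> assms
    by (intro card_totatives_cong) (auto simp: in_totatives_iff)
  finally show ?thesis by (simp add: M_def d_def)
qed

definition mult_cong_pairs :: "nat \<Rightarrow> nat \<Rightarrow> nat \<Rightarrow> (nat \<times> nat) set" where
  "mult_cong_pairs N y n = {(a, q). a \<in> totatives N \<and> q \<in> {1..n} \<and> [a * q = y] (mod N)}"

lemma finite_mult_cong_pairs [simp, intro]: "finite (mult_cong_pairs N y n)"
  by (rule finite_subset[of _ "totatives N \<times> {1..n}"]) (auto simp: mult_cong_pairs_def)

lemma snd_mult_cong_pairsE:
  fixes N y n :: nat
  assumes "N > 0" "(a, q) \<in> mult_cong_pairs N y n"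
  defines "d \<equiv> gcd y N"
  obtains x where "q = d * x" "x \<in> {1..n div d}" "coprime x (N div d)"
proof -
  have d: "d > 0" "N = d * (N div d)" using assms(1) by (simp_all add: d_def)
  have q: "a \<in> totatives N" "[a * q = y] (mod N)" "1 \<le> q" "q \<le> n"
    using assms(2) by (auto simp: mult_cong_pairs_def)
  have g: "gcd q N = d" using gcd_eq_if_totative_mult_cong[of a N q y] q by (simp add: d_def)
  then obtain x where x: "q = d * x" by (metis dvdE gcd_dvd1)
  have "d * gcd x (N div d) = d * 1" using g x d(2) by (metis gcd_mult_distrib_nat mult.right_neutral)
  then have "gcd x (N div d) = 1" using d(1) by (simp only: mult_cancel1) simp
  then have "coprime x (N div d)" by (simp only: coprime_iff_gcd_eq_1)
  moreover have "x \<ge> 1" using q(3) x by (cases x) auto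
  moreover have "x \<le> n div d" using q(4) x d(1) by (simp add: less_eq_div_iff_mult_less_eq mult.commute)
  ultimately show ?thesis using x by (intro that[of x]) simp_all
qed

lemma card_mult_cong_pairs_le_card_coprime:
  fixes N y n :: nat
  assumes "N > 0"
  defines "d \<equiv> gcd y N"
  shows "card (mult_cong_pairs N y n) * totient (N div d) \<le>
    totient N * card {x \<in> {1..n div d}. coprime x (N div d)}"
proof -
  define Q where "Q = {x \<in> {1..n div d}. coprime x (N div d)}"
  define A where "A q = {a \<in> totatives N. [a * q = y] (mod N)}" for q
  have "(a, q) \<in> (\<Union>x\<in>Q. A (d * x) \<times> {d * x})" if "(a, q) \<in> mult_cong_pairs N y n" for a q
    using snd_mult_cong_pairsE[OF assms(1) that] that
    by (auto simp: mult_cong_pairs_def A_def Q_def d_def)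
  then have "card (mult_cong_pairs N y n) \<le> card (\<Union>x\<in>Q. A (d * x) \<times> {d * x})"
    by (intro card_mono) (auto simp: Q_def A_def)
  also have "\<dots> \<le> (\<Sum>x\<in>Q. card (A (d * x)))"
    by (rule order_trans[OF card_UN_le]) (auto simp: Q_def card_cartesian_product)
  finally have "card (mult_cong_pairs N y n) * totient (N div d) \<le> (\<Sum>x\<in>Q. card (A (d * x)) * totient (N div d))"
    by (simp flip: sum_distrib_right)
  also have "\<dots> \<le> (\<Sum>x\<in>Q. totient N)"
  proof (intro sum_mono)
    fix x assume "x \<in> Q"
    then have "gcd x (N div d) = 1" by (simp add: Q_def)
    moreover have "N = d * (N div d)" by (simp add: d_def)
    ultimately have "gcd (d * x) N = d" by (metis gcd_mult_distrib_nat mult.right_neutral)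
    then show "card (A (d * x)) * totient (N div d) \<le> totient N"
      using card_totatives_mult_cong_le[OF assms(1), of "d * x" y] by (simp add: A_def)
  qed
  finally show ?thesis by (simp add: Q_def mult.commute)
qed

lemma card_mult_cong_pairs_le:
  assumes "N > 0"
  shows "card (mult_cong_pairs N y n) \<le> n"
proof -
  define d M where "d = gcd y N" and "M = N div d"
  have "N = d * M" by (simp add: d_def M_def)
  then have M: "M dvd N" "N div M = d" "totient M > 0" using assms by auto
  have "card (mult_cong_pairs N y n) * totient M \<le> totient N * card {x \<in> {1..n div d}. coprime x M}"
    using card_mult_cong_pairs_le_card_coprime[OF assms] by (simp add: d_def M_def)
  also have "\<dots> \<le> (d * totient M) * (n div d)"
  proof (intro mult_mono)
    have "card {x \<in> {1..n div d}. coprime x M} \<le> card {1..n div d}" by (intro card_mono) auto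
    then show "card {x \<in> {1..n div d}. coprime x M} \<le> n div d" by simp
  qed (use totient_le_mult_totient[OF M(1) assms] M(2) in auto)
  also have "\<dots> = (d * (n div d)) * totient M" by simp
  finally have "card (mult_cong_pairs N y n) \<le> d * (n div d)" using M(3) by simp
  also have "\<dots> \<le> n" by simp
  finally show ?thesis .
qed

lemma card_mult_cong_pairs_le_totient:
  assumes "N > 0"
  shows "real (card (mult_cong_pairs N y n)) \<le>
    real (totient N) * real n / real N + real (gcd y N) * real (divisor_count N)"
proof -
  define d M where "d = gcd y N" and "M = N div d"
  have "N = d * M" by (simp add: d_def M_def)
  then have M: "d > 0" "N = d * M" "N div M = d" "M dvd N" "M > 0" "totient M > 0" using assms by auto
  define f where "f = real (totient N) / real (totient M)"
  have f: "0 \<le> f" "f \<le> real d"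
    using totient_le_mult_totient[OF M(4) assms] M(6) unfolding f_def M(3)
    by (auto simp: divide_le_eq simp flip: of_nat_mult)
  have "real (card (mult_cong_pairs N y n) * totient M) \<le> real (totient N * card {x \<in> {1..n div d}. coprime x M})"
    using card_mult_cong_pairs_le_card_coprime[OF assms, of y n] unfolding d_def M_def by (simp only: of_nat_le_iff)
  then have "real (card (mult_cong_pairs N y n)) \<le> f * real (card {x \<in> {1..n div d}. coprime x M})"
    using M(6) by (simp add: f_def field_simps)
  also have "\<dots> \<le> f * (real (n div d) * (real (totient M) / real M) + real (divisor_count M))"
    using f(1) M(5) by (intro mult_left_mono card_coprime_le)
  also have "\<dots> \<le> f * (real n / real d * (real (totient M) / real M)) + f * real (divisor_count M)"
    unfolding distrib_left using f(1) real_div_bounds(1)[of n d] by (intro add_mono mult_left_mono mult_right_mono) auto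
  also have "\<dots> = real (totient N) * real n / real N + f * real (divisor_count M)"
    using M by (simp add: f_def field_simps)
  also have "f * real (divisor_count M) \<le> real d * real (divisor_count N)"
    using f divisor_count_mono[OF M(4) assms] by (intro mult_mono) auto
  finally show ?thesis by (simp add: d_def)
qed

lemma sum_gcd_le:
  assumes "N > 0"
  shows "(\<Sum>y=1..n. gcd y N) \<le> n * divisor_count N"
proof -
  have "(\<Sum>y=1..n. gcd y N) \<le> (\<Sum>y=1..n. \<Sum>d | d \<in> {d. d dvd N} \<and> d dvd y. d)"
    using finite_divisors_nat[OF assms] by (intro sum_mono member_le_sum) auto
  also have "\<dots> = (\<Sum>d | d dvd N. \<Sum>y | y \<in> {1..n} \<and> d dvd y. d)"
    using finite_divisors_nat[OF assms] by (intro sum.swap_restrict) auto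
  also have "\<dots> \<le> (\<Sum>d | d dvd N. n)"
  proof (intro sum_mono)
    fix d assume "d \<in> {d. d dvd N}"
    then have "d > 0" using assms by (auto intro: Nat.gr0I)
    then show "(\<Sum>y | y \<in> {1..n} \<and> d dvd y. d) \<le> n" using card_multiples[of d n] by simp
  qed
  also have "\<dots> = n * divisor_count N" by (simp add: divisor_count_def)
  finally show ?thesis .
qed

subsection \<open>The divisor bound\<close>

lemma divisor_count_mult_le:
  assumes "m > 0" "n > 0"
  shows "divisor_count (m * n) \<le> divisor_count m * divisor_count n"
proof -
  have "{d. d dvd m * n} \<subseteq> (\<lambda>(x, y). x * y) ` ({d. d dvd m} \<times> {d. d dvd n})"
    by (auto dest!: division_decomp)
  then have "divisor_count (m * n) \<le> card ((\<lambda>(x, y). x * y) ` ({d. d dvd m} \<times> {d. d dvd n}))"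
    unfolding divisor_count_def using assms by (intro card_mono) (auto simp: finite_divisors_nat)
  also have "\<dots> \<le> card ({d. d dvd m} \<times> {d. d dvd n})"
    using assms by (intro card_image_le) (auto simp: finite_divisors_nat)
  finally show ?thesis by (simp add: divisor_count_def card_cartesian_product)
qed

lemma divisor_count_prod_le:
  assumes "finite I" "\<And>i. i \<in> I \<Longrightarrow> f i > 0"
  shows "divisor_count (\<Prod>i\<in>I. f i) \<le> (\<Prod>i\<in>I. divisor_count (f i))"
  using assms
proof (induction I rule: finite_induct)
  case (insert i I)
  have "(\<Prod>i\<in>I. f i) > 0" using insert.prems by (auto intro!: prod_pos)
  then have "divisor_count (f i * (\<Prod>i\<in>I. f i)) \<le> divisor_count (f i) * divisor_count (\<Prod>i\<in>I. f i)"
    using insert.prems by (intro divisor_count_mult_le) auto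
  also have "\<dots> \<le> divisor_count (f i) * (\<Prod>i\<in>I. divisor_count (f i))"
    using insert by (intro mult_left_mono) auto
  finally show ?case using insert.hyps by simp
qed (simp add: divisor_count_def)

lemma divisor_count_prime_power_le:
  assumes "prime p"
  shows "divisor_count (p ^ m) \<le> m + 1"
proof -
  have "{d. d dvd p ^ m} \<subseteq> (\<lambda>i. p ^ i) ` {..m}"
    using assms by (auto simp: divides_primepow_nat)
  then have "divisor_count (p ^ m) \<le> card ((\<lambda>i. p ^ i) ` {..m})"
    unfolding divisor_count_def by (intro card_mono) auto
  also have "\<dots> \<le> card {..m}" by (rule card_image_le) auto
  finally show ?thesis by simp
qed

lemma divisor_count_le_prod_multiplicity:
  assumes "N > 0"
  shows "divisor_count N \<le> (\<Prod>p\<in>prime_factors N. multiplicity p N + 1)"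
proof -
  have "divisor_count N = divisor_count (\<Prod>p\<in>prime_factors N. p ^ multiplicity p N)"
    using prime_factorization_nat[OF assms] by simp
  also have "\<dots> \<le> (\<Prod>p\<in>prime_factors N. divisor_count (p ^ multiplicity p N))"
    by (intro divisor_count_prod_le) (auto intro: prime_gt_0_nat)
  also have "\<dots> \<le> (\<Prod>p\<in>prime_factors N. multiplicity p N + 1)"
    by (intro prod_mono) (auto intro: order_trans[OF divisor_count_prime_power_le])
  finally show ?thesis .
qed

lemma multiplicity_le_log2:
  assumes "N > 0" "prime p"
  shows "real (multiplicity p N) \<le> log 2 (real N)"
proof -
  have "2 ^ multiplicity p N \<le> p ^ multiplicity p N"
    using prime_ge_2_nat[OF assms(2)] by (intro power_mono) auto
  also have "\<dots> \<le> N" using assms(1) by (intro dvd_imp_le) (auto simp: multiplicity_dvd)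
  finally have "2 ^ multiplicity p N \<le> real N" by (metis of_nat_le_iff of_nat_numeral of_nat_power)
  then have "log 2 (2 ^ multiplicity p N) \<le> log 2 (real N)" using assms(1) by (intro log_mono) auto
  then show ?thesis by simp
qed

lemma prod_multiplicity_small_le:
  assumes "N > 0" "x \<ge> (0::real)"
  shows "(\<Prod>p | p \<in> prime_factors N \<and> real p < x. real (multiplicity p N + 1)) \<le> (1 + log 2 (real N)) powr x"
proof -
  define P where "P = {p. p \<in> prime_factors N \<and> real p < x}"
  have L: "1 \<le> 1 + log 2 (real N)" using assms(1) by simp
  have "P \<subseteq> {1..nat \<lfloor>x\<rfloor>}"
    by (auto simp: P_def in_prime_factors_iff prime_ge_Suc_0_nat le_nat_floor)
  then have "card P \<le> nat \<lfloor>x\<rfloor>" using card_mono[of "{1..nat \<lfloor>x\<rfloor>}" P] by simp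
  then have "real (card P) \<le> x" using assms(2) by linarith
  have "(\<Prod>p\<in>P. real (multiplicity p N + 1)) \<le> (\<Prod>p\<in>P. 1 + log 2 (real N))"
    using multiplicity_le_log2[OF assms(1)] by (intro prod_mono) (auto simp: P_def in_prime_factors_iff)
  also have "\<dots> = (1 + log 2 (real N)) powr real (card P)" using L by (simp add: powr_realpow)
  also have "\<dots> \<le> (1 + log 2 (real N)) powr x" by (rule powr_mono[OF \<open>real (card P) \<le> x\<close> L])
  finally show ?thesis by (simp add: P_def)
qed

lemma prod_multiplicity_large_le:
  assumes "N > 0" "x > (1::real)"
  shows "(\<Prod>p | p \<in> prime_factors N \<and> \<not> real p < x. real (multiplicity p N + 1)) \<le> 2 powr log x (real N)"
proof -
  define P k where "P = {p. p \<in> prime_factors N \<and> \<not> real p < x}" and "k = (\<Sum>p\<in>P. multiplicity p N)"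
  have "x ^ k = (\<Prod>p\<in>P. x ^ multiplicity p N)" by (simp add: k_def power_sum)
  also have "\<dots> \<le> (\<Prod>p\<in>P. real p ^ multiplicity p N)"
    using assms(2) by (intro prod_mono) (auto simp: P_def intro!: power_mono)
  also have "\<dots> = real (\<Prod>p\<in>P. p ^ multiplicity p N)" by simp
  also have "(\<Prod>p\<in>P. p ^ multiplicity p N) dvd N"
    by (subst (2) prime_factorization_nat[OF assms(1)], intro prod_dvd_prod_subset) (auto simp: P_def)
  then have "real (\<Prod>p\<in>P. p ^ multiplicity p N) \<le> real N" using assms(1) by (simp only: of_nat_le_iff dvd_imp_le)
  finally have "x powr real k \<le> real N" using assms(2) by (simp add: powr_realpow)
  then have k: "real k \<le> log x (real N)" using assms by (simp add: le_log_iff)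
  have "real (multiplicity p N + 1) \<le> 2 ^ multiplicity p N" for p
    using Suc_leI[OF less_exp[of "multiplicity p N"]]
    by (metis Suc_eq_plus1 of_nat_le_iff of_nat_numeral of_nat_power)
  then have "(\<Prod>p\<in>P. real (multiplicity p N + 1)) \<le> (\<Prod>p\<in>P. 2 ^ multiplicity p N)"
    by (intro prod_mono) auto
  also have "\<dots> = 2 powr real k" by (simp add: k_def power_sum powr_realpow flip: of_nat_sum)
  also have "\<dots> \<le> 2 powr (log x (real N))" using k by (intro powr_mono) auto
  finally show ?thesis by (simp add: P_def)
qed

lemma divisor_count_le_powr:
  assumes "N > 0" "x > (1::real)"
  shows "real (divisor_count N) \<le> (1 + log 2 (real N)) powr x * 2 powr (log x (real N))"
proof -
  let ?m = "\<lambda>p. real (multiplicity p N + 1)"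
  have "real (divisor_count N) \<le> (\<Prod>p\<in>prime_factors N. ?m p)"
    using divisor_count_le_prod_multiplicity[OF assms(1)] by (metis of_nat_le_iff of_nat_prod)
  also have "\<dots> = (\<Prod>p | p \<in> prime_factors N \<and> real p < x. ?m p) *
      (\<Prod>p | p \<in> prime_factors N \<and> \<not> real p < x. ?m p)"
    by (subst prod.union_disjoint[symmetric]) (auto intro!: prod.cong)
  also have "\<dots> \<le> (1 + log 2 (real N)) powr x * 2 powr (log x (real N))"
    using assms by (intro mult_mono prod_multiplicity_small_le prod_multiplicity_large_le prod_nonneg) auto
  finally show ?thesis .
qed

section \<open>Cancellation of the off-diagonal terms\<close>

lemma sum_residue_class:
  fixes y c J :: nat and H :: "nat \<Rightarrow> 'a :: comm_monoid_add"
  assumes c: "1 \<le> c" "c \<le> y"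
  shows "(\<Sum>q | q \<in> {1..y * J} \<and> [q = c] (mod y). H q) = (\<Sum>j<J. H (c + y * j))"
proof (rule sum.reindex_bij_witness[where i = "\<lambda>j. c + y * j" and j = "\<lambda>q. (q - c) div y"])
  fix q assume "q \<in> {q. q \<in> {1..y * J} \<and> [q = c] (mod y)}"
  then have q: "1 \<le> q" "q \<le> y * J" "[q = c] (mod y)" by auto
  have "c \<le> q"
  proof (rule ccontr)
    assume "\<not> c \<le> q"
    then have "y dvd c - q" "0 < c - q" "c - q < y"
      using q c cong_altdef_nat[of q c y] by (auto simp: cong_sym_eq)
    then show False by (auto dest: dvd_imp_le)
  qed
  then obtain k where k: "q = c + y * k" using q(3) by (auto simp: cong_le_nat mult.commute add.commute)
  then have "y * k < y * J" using q(2) c by linarith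
  then show "c + y * ((q - c) div y) = q" "(q - c) div y \<in> {..<J}" "H (c + y * ((q - c) div y)) = H q"
    using k c by auto
next
  fix j assume "j \<in> {..<J}"
  then have "y * (j + 1) \<le> y * J" by (intro mult_left_mono) auto
  then show "c + y * j \<in> {q. q \<in> {1..y * J} \<and> [q = c] (mod y)}" using c by (simp add: Cong.cong_def)
  show "(c + y * j - c) div y = j" using c by simp
qed

lemma arith_progressions_interlace:
  fixes y c c' :: nat and H :: "nat \<Rightarrow> real"
  assumes c: "1 \<le> c" "c \<le> c'" "c' \<le> y"
    and H: "\<And>q. q > 0 \<Longrightarrow> 0 \<le> H q \<and> H q \<le> T" "\<And>q q'. 0 < q \<Longrightarrow> q \<le> q' \<Longrightarrow> H q' \<le> H q"
  shows "(\<Sum>j<J. H (c' + y * j)) \<le> (\<Sum>j<J. H (c + y * j))"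
    "(\<Sum>j<J. H (c + y * j)) \<le> (\<Sum>j<J. H (c' + y * j)) + T"
proof -
  have pos: "0 < c + y * j" "0 < c' + y * j" for j using c by auto
  show "(\<Sum>j<J. H (c' + y * j)) \<le> (\<Sum>j<J. H (c + y * j))"
    using c pos by (intro sum_mono H(2)) auto
  show "(\<Sum>j<J. H (c + y * j)) \<le> (\<Sum>j<J. H (c' + y * j)) + T"
  proof (cases J)
    case 0
    then show ?thesis using H(1)[of 1] by simp
  next
    case (Suc K)
    have "(\<Sum>j<J. H (c + y * j)) = H c + (\<Sum>j<K. H (c + y * Suc j))"
      unfolding Suc by (subst sum.lessThan_Suc_shift) simp
    also have "\<dots> \<le> T + (\<Sum>j<K. H (c' + y * j))"
    proof (intro add_mono sum_mono)
      show "H c \<le> T" using c H(1)[of c] by simp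
      show "H (c + y * Suc j) \<le> H (c' + y * j)" for j using c pos by (intro H(2)) auto
    qed
    also have "(\<Sum>j<K. H (c' + y * j)) \<le> (\<Sum>j<J. H (c' + y * j))"
      unfolding Suc using H(1) pos by simp
    finally show ?thesis by simp
  qed
qed

lemma sum_residue_classes_diff_le:
  fixes y c c' J :: nat and H :: "nat \<Rightarrow> real"
  assumes "c \<in> {1..y}" "c' \<in> {1..y}"
    and H: "\<And>q. q > 0 \<Longrightarrow> 0 \<le> H q \<and> H q \<le> T" "\<And>q q'. 0 < q \<Longrightarrow> q \<le> q' \<Longrightarrow> H q' \<le> H q"
  shows "\<bar>(\<Sum>q | q \<in> {1..y * J} \<and> [q = c] (mod y). H q) -
    (\<Sum>q | q \<in> {1..y * J} \<and> [q = c'] (mod y). H q)\<bar> \<le> T"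
proof -
  have progressions: "(\<Sum>q | q \<in> {1..y * J} \<and> [q = d] (mod y). H q) = (\<Sum>j<J. H (d + y * j))"
    if "d \<in> {1..y}" for d
    using that by (intro sum_residue_class) auto
  have "\<bar>(\<Sum>j<J. H (c + y * j)) - (\<Sum>j<J. H (c' + y * j))\<bar> \<le> T"
  proof (cases "c \<le> c'")
    case True
    then show ?thesis
      using arith_progressions_interlace[of c c' y H T J, OF _ True _ H] assms(1,2) by simp
  next
    case False
    then have "c' \<le> c" by simp
    then show ?thesis
      using arith_progressions_interlace[of c' c y H T J, OF _ \<open>c' \<le> c\<close> _ H] assms(1,2) by simp
  qed
  then show ?thesis using assms(1,2) by (simp only: progressions)
qed

lemma linear_dvd_iff_cong:
  fixes s y n :: nat
  assumes "coprime s y" "y > 0"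
  obtains c where "c \<in> {1..y}" "\<And>q. y dvd q * s + n \<longleftrightarrow> [q = c] (mod y)"
proof -
  obtain i where "[s * i = 1] (mod y)" using cong_solve_coprime_nat[OF assms(1)] by auto
  then have i: "[(y - 1) * n * (s * i) = (y - 1) * n * 1] (mod y)" by (intro cong_mult) auto
  define c where "c = (if (y - 1) * n * i mod y = 0 then y else (y - 1) * n * i mod y)"
  have c: "c \<in> {1..y}" "[c = (y - 1) * n * i] (mod y)"
    using assms(2) by (auto simp: c_def Cong.cong_def less_imp_le)
  have "[c * s + n = (y - 1) * n * i * s + n] (mod y)"
    using c(2) by (intro cong_add cong_mult) auto
  also have "(y - 1) * n * i * s + n = (y - 1) * n * (s * i) + n" by simp
  also have "[\<dots> = (y - 1) * n * 1 + n] (mod y)" using i by (intro cong_add) auto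
  also have "(y - 1) * n * 1 + n = y * n" using assms(2) by (cases y) auto
  also have "[y * n = 0] (mod y)" by (simp add: Cong.cong_def)
  finally have root: "[c * s + n = 0] (mod y)" .
  have "y dvd q * s + n \<longleftrightarrow> [q = c] (mod y)" for q
  proof -
    have "y dvd q * s + n \<longleftrightarrow> [q * s + n = c * s + n] (mod y)"
      using root by (metis cong_0_iff cong_sym cong_trans)
    also have "\<dots> \<longleftrightarrow> [q = c] (mod y)"
      using assms(1) by (simp add: cong_add_rcancel_nat cong_mult_rcancel_nat)
    finally show ?thesis .
  qed
  then show ?thesis using c(1) that by blast
qed

lemma sieved_multiples_eq:
  fixes e n s y q :: nat
  assumes "e > 0" "y > 0"
  shows "y dvd e * x * s + e * n \<and> e dvd (e * x * s + e * n) div y \<longleftrightarrow> y dvd x * s + n"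
proof -
  have eq: "e * x * s + e * n = e * (x * s + n)" by (simp add: algebra_simps)
  have "y dvd k \<and> e dvd k div y \<longleftrightarrow> e * y dvd k" for k
    using assms(2) by (metis dvd_div_iff_mult dvd_mult_right not_gr_zero)
  then show ?thesis unfolding eq using assms(1) by simp
qed

definition denom_weight :: "(real \<Rightarrow> real) \<Rightarrow> nat \<Rightarrow> nat \<Rightarrow> nat \<Rightarrow> real" where
  "denom_weight g N y s = (\<Sum>q\<in>tail_denoms N y s. g (real N / real (q * y)))"

definition sieved_weight :: "(real \<Rightarrow> real) \<Rightarrow> nat \<Rightarrow> nat \<Rightarrow> nat \<Rightarrow> nat \<Rightarrow> real" where
  "sieved_weight g N y s e =
    (\<Sum>q | q \<in> {q \<in> {1..y * N}. y dvd q * s + N} \<and> e dvd q \<and> e dvd (q * s + N) div y. g (real N / real (q * y)))"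

context quality_weight
begin

lemma weight_denom_eq_0:
  assumes "N \<le> 2 * (q * y)"
  shows "g (real N / real (q * y)) = 0"
proof -
  have "real N \<le> 2 * real (q * y)" using assms by (metis of_nat_le_iff of_nat_mult of_nat_numeral)
  then have "real N / real (q * y) \<le> 2" by (cases "q * y = 0") (auto simp: divide_le_eq simp del: of_nat_mult)
  then show ?thesis by (rule weight_vanish)
qed

lemma weight_denom_antimono:
  assumes "0 < q" "q \<le> q'" "y > 0"
  shows "g (real N / real (q' * y)) \<le> g (real N / real (q * y))"
  using assms by (intro weight_mono divide_left_mono) auto

lemma denom_weight_eq_sieve:
  assumes N: "N > 0" and y: "y > 0"
  shows "denom_weight g N y s = (\<Sum>X\<in>Pow (prime_factors N). (-1) ^ card X * sieved_weight g N y s (\<Prod>X))"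
proof -
  let ?A = "{q \<in> {1..y * N}. y dvd q * s + N}"
  have gcd_dvd: "gcd q ((q * s + N) div y) dvd N" if "q \<in> ?A" for q
  proof -
    have "(q * s + N) div y * y = q * s + N" using that by simp
    then have "gcd q ((q * s + N) div y) dvd q * s + N" by (metis dvd_mult2 gcd_dvd2)
    then show ?thesis by (metis dvd_add_right_iff dvd_mult2 gcd_dvd1)
  qed
  have "denom_weight g N y s =
      (\<Sum>q | q \<in> ?A \<and> coprime q ((q * s + N) div y). g (real N / real (q * y)))"
    unfolding denom_weight_def
  proof (rule sum.mono_neutral_left)
    show "tail_denoms N y s \<subseteq> {q. q \<in> ?A \<and> coprime q ((q * s + N) div y)}"
    proof
      fix q assume q: "q \<in> tail_denoms N y s"
      have "q * 1 \<le> q * y" "1 * N \<le> y * N" using y by (intro mult_le_mono; simp)+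
      moreover have "2 * (q * y) < N" using q by (simp add: tail_denoms_def)
      ultimately have "q \<le> y * N" by linarith
      then show "q \<in> {q. q \<in> ?A \<and> coprime q ((q * s + N) div y)}" using q by (auto simp: tail_denoms_def)
    qed
    show "\<forall>q\<in>{q. q \<in> ?A \<and> coprime q ((q * s + N) div y)} - tail_denoms N y s. g (real N / real (q * y)) = 0"
      by (intro ballI weight_denom_eq_0) (auto simp: tail_denoms_def)
  qed simp
  also have "\<dots> = (\<Sum>X\<in>Pow (prime_factors N). (-1) ^ card X * sieved_weight g N y s (\<Prod>X))"
    unfolding sieved_weight_def by (rule sum_coprime_sieve[OF _ N gcd_dvd]) simp_all
  finally show ?thesis .
qed

lemma sieved_weight_eq_sum_multiples:
  assumes "e > 0" "N = e * n" "y > 0"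
  shows "sieved_weight g N y s e =
    (\<Sum>x | x \<in> {1..y * N} \<and> y dvd x * s + n. g (real N / real (e * x * y)))"
proof -
  define I where "I = {q. q \<in> {q \<in> {1..y * N}. y dvd q * s + N} \<and> e dvd q \<and> e dvd (q * s + N) div y}"
  define K where "K = {x. x \<in> {1..y * N} \<and> y dvd x * s + n}"
  have multiple: "e * x \<in> I \<longleftrightarrow> e * x \<in> {1..y * N} \<and> y dvd x * s + n" for x
    using sieved_multiples_eq[OF assms(1,3), of x s n] by (auto simp: I_def assms(2))
  have "(\<Sum>q\<in>I. g (real N / real (q * y))) = (\<Sum>q\<in>(\<lambda>x. e * x) ` K. g (real N / real (q * y)))"
  proof (rule sum.mono_neutral_left)
    show "I \<subseteq> (\<lambda>x. e * x) ` K"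
    proof
      fix q assume q: "q \<in> I"
      then obtain x where x: "q = e * x" by (auto simp: I_def elim: dvdE)
      have "1 \<le> e * x" "e * x \<le> y * N" "y dvd x * s + n" using q multiple[of x] by (simp_all add: x)
      moreover have "x \<le> e * x" using assms(1) by simp
      ultimately have "x \<le> y * N" "x \<noteq> 0" "y dvd x * s + n" by (linarith, auto)
      then have "x \<in> K" by (simp add: K_def)
      then show "q \<in> (\<lambda>x. e * x) ` K" using x by blast
    qed
    show "\<forall>q\<in>(\<lambda>x. e * x) ` K - I. g (real N / real (q * y)) = 0"
    proof (intro ballI weight_denom_eq_0)
      fix q assume "q \<in> (\<lambda>x. e * x) ` K - I"
      then obtain x where x: "q = e * x" "x \<in> K" "e * x \<notin> I" by auto
      then have "\<not> e * x \<le> y * N" using multiple[of x] assms(1) by (auto simp: K_def)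
      then have "y * N < q" using x(1) by simp
      moreover have "1 * N \<le> y * N" "q * 1 \<le> q * y" using assms(3) by (intro mult_le_mono; simp)+
      ultimately show "N \<le> 2 * (q * y)" by linarith
    qed
  qed (simp add: K_def)
  also have "\<dots> = (\<Sum>x\<in>K. g (real N / real (e * x * y)))"
    using assms(1) by (subst sum.reindex) (auto simp: inj_on_def)
  finally show ?thesis by (simp add: sieved_weight_def I_def K_def)
qed

end

locale bounded_quality_weight = quality_weight +
  fixes T :: real
  assumes weight_le: "g z \<le> T"
begin

lemma sieved_weight_diff_le:
  assumes e: "e > 0" "e dvd N" and y: "y > 0" and s: "coprime s y" "coprime s' y"
  shows "\<bar>sieved_weight g N y s e - sieved_weight g N y s' e\<bar> \<le> T"
proof -
  obtain n where n: "N = e * n" using e(2) by auto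
  obtain c where c: "c \<in> {1..y}" "\<And>q. y dvd q * s + n \<longleftrightarrow> [q = c] (mod y)"
    using linear_dvd_iff_cong[OF s(1) y] by metis
  obtain c' where c': "c' \<in> {1..y}" "\<And>q. y dvd q * s' + n \<longleftrightarrow> [q = c'] (mod y)"
    using linear_dvd_iff_cong[OF s(2) y] by metis
  show ?thesis
    unfolding sieved_weight_eq_sum_multiples[OF e(1) n y] c(2) c'(2)
  proof (rule sum_residue_classes_diff_le[OF c(1) c'(1)])
    fix q q' :: nat assume "0 < q" "q \<le> q'"
    then show "g (real N / real (e * q' * y)) \<le> g (real N / real (e * q * y))"
      using e(1) y by (intro weight_denom_antimono) auto
  qed (simp add: weight_nonneg weight_le)
qed

lemma denom_weight_diff_le:
  assumes N: "N > 0" and y: "y > 0" and s: "coprime s y" "coprime s' y"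
  shows "\<bar>denom_weight g N y s - denom_weight g N y s'\<bar> \<le> real (divisor_count N) * T"
proof -
  let ?d = "\<lambda>X. sieved_weight g N y s (\<Prod>X) - sieved_weight g N y s' (\<Prod>X)"
  have "\<bar>denom_weight g N y s - denom_weight g N y s'\<bar> =
      \<bar>\<Sum>X\<in>Pow (prime_factors N). (-1) ^ card X * ?d X\<bar>"
    by (simp add: denom_weight_eq_sieve[OF N y] sum_subtractf right_diff_distrib)
  also have "\<dots> \<le> (\<Sum>X\<in>Pow (prime_factors N). \<bar>(-1) ^ card X * ?d X\<bar>)" by (rule sum_abs)
  also have "\<dots> \<le> (\<Sum>X\<in>Pow (prime_factors N). T)"
  proof (intro sum_mono)
    fix X assume "X \<in> Pow (prime_factors N)"
    then have X: "finite X" "\<And>p. p \<in> X \<Longrightarrow> prime p" "\<And>p. p \<in> X \<Longrightarrow> p dvd N"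
      using finite_subset by auto
    have "\<Prod>X dvd N" using X by (simp add: prod_primes_dvd_iff)
    moreover have "\<Prod>X > 0" using X(2) by (auto intro!: prod_pos simp: prime_gt_0_nat)
    ultimately have "\<bar>?d X\<bar> \<le> T" using y s by (intro sieved_weight_diff_le)
    then show "\<bar>(-1) ^ card X * ?d X\<bar> \<le> T" by (simp add: abs_mult)
  qed
  also have "\<dots> = real (2 ^ card (prime_factors N)) * T" by (simp add: card_Pow)
  also have "\<dots> \<le> real (divisor_count N) * T"
    using two_pow_card_prime_factors_le[OF N] order_trans[OF weight_nonneg weight_le]
    by (intro mult_right_mono) (simp_all only: of_nat_le_iff)
  finally show ?thesis .
qed

end

definition cross_sum :: "(real \<Rightarrow> real) \<Rightarrow> nat \<Rightarrow> nat \<Rightarrow> real" where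
  "cross_sum g N y = (\<Sum>(a, v)\<in>res_pairs N y. g (quality (int N) (int a) v) *
     conv_sum g (int y) (lattice_res (int N) (int a) (complement (int N) (int a) v)))"

lemma cross_sum_eq_sum_totatives:
  assumes "N > 0" "y > 0"
  shows "cross_sum g N y = (\<Sum>s\<in>totatives y. conv_sum g (int y) (int s) * denom_weight g N y s)"
proof -
  define F where "F = (\<lambda>(s, q). g (real N / real (q * y)) * conv_sum g (int y) (int s))"
  have "cross_sum g N y = (\<Sum>x\<in>res_pairs N y. F (tail_params N x))"
    unfolding cross_sum_def
  proof (intro sum.cong refl)
    fix x assume x_in: "x \<in> res_pairs N y"
    obtain a v where x: "x = (a, v)" by (cases x)
    have v: "v \<in> conv_vecs (int N) (int a)" "lattice_res (int N) (int a) v = int y"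
      using x_in by (auto simp: x res_pairs_def)
    then have "quality (int N) (int a) v = real N / real (nat (fst v) * y)"
      using conv_vecsD(1)[OF v(1)] by (simp add: quality_def)
    moreover have "lattice_res (int N) (int a) (complement (int N) (int a) v) > 0"
      using res_pairsD(2)[OF x_in[unfolded x] assms(2)] by simp
    ultimately show "(case x of (a, v) \<Rightarrow> g (quality (int N) (int a) v) *
        conv_sum g (int y) (lattice_res (int N) (int a) (complement (int N) (int a) v))) = F (tail_params N x)"
      by (simp add: x F_def tail_params_def)
  qed
  also have "\<dots> = (\<Sum>z\<in>Sigma (totatives y) (tail_denoms N y). F z)"
    by (rule sum.reindex_bij_betw[OF bij_betw_tail_params[OF assms]])
  also have "\<dots> = (\<Sum>s\<in>totatives y. \<Sum>q\<in>tail_denoms N y s. F (s, q))"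
    using finite_tail_denoms[OF assms(2)] by (subst sum.Sigma) auto
  finally show ?thesis by (simp add: F_def denom_weight_def sum_distrib_left mult.commute)
qed

lemma bij_betw_diff_totatives:
  assumes "y > 1"
  shows "bij_betw (\<lambda>s. y - s) (totatives y) (totatives y)"
  using diff_in_totatives[OF _ assms] totatives_le
  by (intro bij_betw_byWitness[where f' = "\<lambda>s. y - s"]) auto

lemma conv_sum_diff_nat: "s \<le> y \<Longrightarrow> conv_sum g (int y) (int (y - s)) = - conv_sum g (int y) (int s)"
  by (simp add: of_nat_diff conv_sum_diff)

lemma cross_sum_antisymmetric:
  assumes "N > 0" "y > 1"
  shows "2 * cross_sum g N y =
    (\<Sum>s\<in>totatives y. conv_sum g (int y) (int s) * (denom_weight g N y s - denom_weight g N y (y - s)))"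
proof -
  have "cross_sum g N y = (\<Sum>s\<in>totatives y. conv_sum g (int y) (int (y - s)) * denom_weight g N y (y - s))"
    unfolding cross_sum_eq_sum_totatives[OF assms(1) order.strict_trans[OF zero_less_one assms(2)]]
    by (rule sum.reindex_bij_betw[OF bij_betw_diff_totatives[OF assms(2)], symmetric])
  also have "\<dots> = (\<Sum>s\<in>totatives y. - (conv_sum g (int y) (int s) * denom_weight g N y (y - s)))"
    by (intro sum.cong refl) (simp only: conv_sum_diff_nat totatives_le mult_minus_left)
  finally show ?thesis
    using cross_sum_eq_sum_totatives[of N y g] assms by (simp add: right_diff_distrib sum_subtractf sum_negf)
qed

context bounded_quality_weight
begin

lemma abs_cross_sum_le_sum_conv_sum:
  assumes "N > 0" "y > 0"
  shows "\<bar>cross_sum g N y\<bar> \<le> real (divisor_count N) * T * (\<Sum>s\<in>totatives y. \<bar>conv_sum g (int y) (int s)\<bar>)"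
proof (cases "y = 1")
  case True
  then show ?thesis by (simp add: cross_sum_def conv_sum_def conv_vecs_empty)
next
  case False
  then have y: "y > 1" using assms(2) by simp
  have "2 * \<bar>cross_sum g N y\<bar> \<le> (\<Sum>s\<in>totatives y.
      \<bar>conv_sum g (int y) (int s) * (denom_weight g N y s - denom_weight g N y (y - s))\<bar>)"
    using cross_sum_antisymmetric[OF assms(1) y, of g] sum_abs
    by (metis abs_mult abs_numeral)
  also have "\<dots> \<le> (\<Sum>s\<in>totatives y. \<bar>conv_sum g (int y) (int s)\<bar> * (real (divisor_count N) * T))"
  proof (intro sum_mono)
    fix s assume s: "s \<in> totatives y"
    then have "coprime s y" "coprime (y - s) y" using diff_in_totatives[OF s y] by (simp_all add: in_totatives_iff)
    then have "\<bar>denom_weight g N y s - denom_weight g N y (y - s)\<bar> \<le> real (divisor_count N) * T"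
      using assms by (intro denom_weight_diff_le)
    then show "\<bar>conv_sum g (int y) (int s) * (denom_weight g N y s - denom_weight g N y (y - s))\<bar> \<le>
        \<bar>conv_sum g (int y) (int s)\<bar> * (real (divisor_count N) * T)"
      unfolding abs_mult by (intro mult_left_mono) auto
  qed
  also have "\<dots> = real (divisor_count N) * T * (\<Sum>s\<in>totatives y. \<bar>conv_sum g (int y) (int s)\<bar>)"
    by (simp add: sum_distrib_left mult.commute)
  finally show ?thesis by linarith
qed

lemma abs_conv_sum_le: "\<bar>conv_sum g N a\<bar> \<le> T * real (card (conv_vecs N a))"
proof -
  have "\<bar>conv_sum g N a\<bar> \<le> (\<Sum>v\<in>conv_vecs N a. \<bar>signed_term g N a v\<bar>)"
    unfolding conv_sum_def by (rule sum_abs)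
  also have "\<dots> \<le> (\<Sum>v\<in>conv_vecs N a. T)"
    using abs_signed_term_le[OF weight_nonneg] weight_le by (intro sum_mono) (rule order_trans)
  finally show ?thesis by (simp add: mult.commute)
qed

end

section \<open>Moments\<close>

lemma quality_ge_imp_fst_le:
  assumes "(a, v) \<in> res_pairs N y" "y > 0" "i > 0" "real i \<le> quality (int N) (int a) v"
  shows "fst v \<le> int (N div (i * y))"
proof -
  have v: "v \<in> conv_vecs (int N) (int a)" "lattice_res (int N) (int a) v = int y"
    using assms(1) by (auto simp: res_pairs_def)
  define q where "q = nat (fst v)"
  have q: "fst v = int q" "q > 0" using conv_vecsD(1)[OF v(1)] by (auto simp: q_def)
  have "real i * real (q * y) \<le> real N"
    using assms(4) q assms(2) by (simp add: quality_def v(2) le_divide_eq)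
  then have "real (q * (i * y)) \<le> real N" by (simp add: mult_ac)
  then have "q * (i * y) \<le> N" by (simp only: of_nat_le_iff)
  then show ?thesis using assms(2,3) by (simp add: q less_eq_div_iff_mult_less_eq)
qed

lemma card_res_pairs_le_card_mult_cong_pairs:
  assumes "N > 0"
  shows "card {(a, v) \<in> res_pairs N y. fst v \<le> int n} \<le> card (mult_cong_pairs N y n)"
proof (rule card_inj_on_le[where f = "\<lambda>(a, v). (a, nat (fst v))"])
  have D: "a \<in> totatives N" "fst v = int (nat (fst v))" "nat (fst v) \<ge> 1" "lattice_res (int N) (int a) v = int y"
    if "(a, v) \<in> res_pairs N y" for a v
    using that conv_vecsD(1)[of v "int N" "int a"] by (auto simp: res_pairs_def)
  show "inj_on (\<lambda>(a, v). (a, nat (fst v))) {(a, v) \<in> res_pairs N y. fst v \<le> int n}"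
  proof (rule inj_onI)
    fix x x' assume x_in: "x \<in> {(a, v) \<in> res_pairs N y. fst v \<le> int n}" "x' \<in> {(a, v) \<in> res_pairs N y. fst v \<le> int n}"
      and eq: "(case x of (a, v) \<Rightarrow> (a, nat (fst v))) = (case x' of (a, v) \<Rightarrow> (a, nat (fst v)))"
    obtain a v a' v' where x: "x = (a, v)" "x' = (a', v')" by (cases x, cases x')
    have "a' = a" "nat (fst v') = nat (fst v)" using eq by (simp_all add: x)
    then have "fst v = fst v'" "lattice_res (int N) (int a) v = lattice_res (int N) (int a) v'"
      using D(2,4)[of a v] D(2,4)[of a' v'] x_in by (simp_all add: x)
    then have "v = v'" using assms by (intro lattice_res_inject) auto
    then show "x = x'" using \<open>a' = a\<close> by (simp add: x)
  qed
  show "(\<lambda>(a, v). (a, nat (fst v))) ` {(a, v) \<in> res_pairs N y. fst v \<le> int n} \<subseteq> mult_cong_pairs N y n"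
  proof (rule image_subsetI)
    fix x assume x_in: "x \<in> {(a, v) \<in> res_pairs N y. fst v \<le> int n}"
    obtain a v where x: "x = (a, v)" by (cases x)
    define q where "q = nat (fst v)"
    have q: "fst v = int q" "q \<ge> 1" "q \<le> n" using D(2,3)[of a v] x_in by (auto simp: x q_def)
    have "int (a * q) - int y = int N * snd v"
      using D(4)[of a v] x_in by (simp add: x q lattice_res_def algebra_simps)
    then have "[int (a * q) = int y] (mod int N)" by (simp only: cong_iff_dvd_diff) simp
    then have "[a * q = y] (mod N)" by (simp only: cong_int_iff)
    then show "(case x of (a, v) \<Rightarrow> (a, nat (fst v))) \<in> mult_cong_pairs N y n"
      using D(1)[of a v] q x_in by (simp add: x mult_cong_pairs_def)
  qed
qed simp

lemma card_res_pairs_quality_ge_le: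
  assumes "N > 0" "y > 0" "i > 0"
  shows "real (card {(a, v) \<in> res_pairs N y. real i \<le> quality (int N) (int a) v}) \<le>
    real (totient N) / (real i * real y) + real (gcd y N) * real (divisor_count N)"
proof -
  have "card {(a, v) \<in> res_pairs N y. real i \<le> quality (int N) (int a) v} \<le>
      card {(a, v) \<in> res_pairs N y. fst v \<le> int (N div (i * y))}"
    using quality_ge_imp_fst_le[OF _ assms(2,3)] by (intro card_mono) (auto intro: finite_subset[OF _ finite_res_pairs])
  also have "\<dots> \<le> card (mult_cong_pairs N y (N div (i * y)))"
    by (rule card_res_pairs_le_card_mult_cong_pairs[OF assms(1)])
  also have "real \<dots> \<le> real (totient N) * real (N div (i * y)) / real N + real (gcd y N) * real (divisor_count N)"
    by (rule card_mult_cong_pairs_le_totient[OF assms(1)])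
  also have "real (totient N) * real (N div (i * y)) / real N \<le> real (totient N) * (real N / real (i * y)) / real N"
    by (intro divide_right_mono mult_left_mono real_div_bounds) auto
  also have "\<dots> = real (totient N) / (real i * real y)" using assms(1) by simp
  finally show ?thesis by simp
qed

lemma sum_quality_res_pairs_le:
  fixes h :: "real \<Rightarrow> real" and w :: "nat \<Rightarrow> real"
  assumes "N > 0" "y > 0" "\<And>i. w i \<ge> 0" "\<And>z. h z \<le> (\<Sum>i=1..T. w i * of_bool (real i \<le> z))"
  shows "(\<Sum>(a, v)\<in>res_pairs N y. h (quality (int N) (int a) v)) \<le>
    (\<Sum>i=1..T. w i * (real (totient N) / (real i * real y) + real (gcd y N) * real (divisor_count N)))"
proof -
  let ?z = "\<lambda>(a, v). quality (int N) (int a) v"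
  have "(\<Sum>(a, v)\<in>res_pairs N y. h (quality (int N) (int a) v)) \<le>
      (\<Sum>x\<in>res_pairs N y. \<Sum>i=1..T. w i * of_bool (real i \<le> ?z x))"
    using assms(4) by (intro sum_mono) auto
  also have "\<dots> = (\<Sum>i=1..T. w i * (\<Sum>x\<in>res_pairs N y. of_bool (real i \<le> ?z x)))"
    by (subst sum.swap) (simp only: sum_distrib_left)
  also have "\<dots> = (\<Sum>i=1..T. w i * real (card {(a, v) \<in> res_pairs N y. real i \<le> quality (int N) (int a) v}))"
  proof -
    have "(\<Sum>x\<in>res_pairs N y. of_bool (real i \<le> ?z x)) =
        real (card {(a, v) \<in> res_pairs N y. real i \<le> quality (int N) (int a) v})" for i
    proof -
      have "(\<Sum>x\<in>res_pairs N y. of_bool (real i \<le> ?z x)) = real (card (res_pairs N y \<inter> {x. real i \<le> ?z x}))"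
        by (simp add: sum_of_bool_eq)
      also have "res_pairs N y \<inter> {x. real i \<le> ?z x} = {(a, v) \<in> res_pairs N y. real i \<le> quality (int N) (int a) v}"
        by auto
      finally show ?thesis .
    qed
    then show ?thesis by simp
  qed
  also have "\<dots> \<le> (\<Sum>i=1..T. w i * (real (totient N) / (real i * real y) + real (gcd y N) * real (divisor_count N)))"
    using assms(1-3) by (intro sum_mono mult_left_mono card_res_pairs_quality_ge_le) auto
  finally show ?thesis .
qed

lemma quality_reflect:
  assumes "a \<in> totatives N"
  shows "quality (int N) (int (N - a)) (shear_vec (- 1) 1 v) = quality (int N) (int a) v"
  using quality_shear_vec[of "- 1" "int N" "int a" 1 v] totatives_le[OF assms] by (simp add: of_nat_diff)

lemma first_moment_le:
  fixes h :: "real \<Rightarrow> real" and w :: "nat \<Rightarrow> real"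
  assumes N: "N > 0" and Y: "Y \<subseteq> {1..n}"
    and w: "\<And>i. w i \<ge> 0" and h: "\<And>z. h z \<le> (\<Sum>i=1..T. w i * of_bool (real i \<le> z))"
  shows "(\<Sum>a\<in>totatives N. \<Sum>v\<in>res_vecs N Y a. h (quality (int N) (int a) v)) \<le>
    2 * (real (totient N) * (\<Sum>y\<in>Y. 1 / real y) * (\<Sum>i=1..T. w i / real i)
      + real n * (real (divisor_count N))\<^sup>2 * (\<Sum>i=1..T. w i))"
proof -
  have Y': "finite Y" "0 \<notin> Y" using Y finite_subset by auto
  have "(\<Sum>a\<in>totatives N. \<Sum>v\<in>res_vecs N Y a. h (quality (int N) (int a) v)) =
      2 * (\<Sum>y\<in>Y. \<Sum>(a, v)\<in>res_pairs N y. h (quality (int N) (int a) v))"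
    using Y' by (intro sum_res_vecs) (simp_all add: quality_reflect)
  also have "\<dots> \<le> 2 * (\<Sum>y\<in>Y. \<Sum>i=1..T. w i * (real (totient N) / (real i * real y) + real (gcd y N) * real (divisor_count N)))"
    using Y by (intro mult_left_mono sum_mono sum_quality_res_pairs_le[OF N _ w h]) auto
  also have "(\<Sum>y\<in>Y. \<Sum>i=1..T. w i * (real (totient N) / (real i * real y) + real (gcd y N) * real (divisor_count N))) =
      (\<Sum>y\<in>Y. \<Sum>i=1..T. real (totient N) * ((1 / real y) * (w i / real i)) + real (divisor_count N) * (real (gcd y N) * w i))"
    by (intro sum.cong refl) (simp add: algebra_simps)
  also have "\<dots> = real (totient N) * ((\<Sum>y\<in>Y. 1 / real y) * (\<Sum>i=1..T. w i / real i)) +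
      real (divisor_count N) * (real (\<Sum>y\<in>Y. gcd y N) * (\<Sum>i=1..T. w i))"
    by (simp only: sum.distrib sum_distrib_left[symmetric] sum_product of_nat_sum)
  also have "\<dots> \<le> real (totient N) * ((\<Sum>y\<in>Y. 1 / real y) * (\<Sum>i=1..T. w i / real i)) +
      real (divisor_count N) * (real (n * divisor_count N) * (\<Sum>i=1..T. w i))"
  proof -
    have "(\<Sum>y\<in>Y. gcd y N) \<le> (\<Sum>y=1..n. gcd y N)" using Y by (intro sum_mono2) auto
    also have "\<dots> \<le> n * divisor_count N" by (rule sum_gcd_le[OF N])
    finally show ?thesis
      using w by (intro add_left_mono mult_left_mono mult_right_mono sum_nonneg) (auto simp only: of_nat_le_iff of_nat_0_le_iff)
  qed
  finally show ?thesis by (simp add: power2_eq_square mult_ac)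
qed

lemma sum_inverse_interval_le:
  assumes "m \<ge> 1" "m \<le> n"
  shows "(\<Sum>y\<in>{m<..n}. 1 / real y) \<le> ln (real n / real m)"
proof -
  have "harm n - ln (real n) \<le> harm m - ln (real m)"
    using decseqD[OF decseq_harm_diff_ln, of "m - 1" "n - 1"] assms by simp
  moreover have "harm n = harm m + (\<Sum>y\<in>{m<..n}. 1 / real y)"
  proof -
    have split: "{1..n} = {1..m} \<union> {m<..n}" using assms by auto
    show ?thesis unfolding harm_def split by (subst sum.union_disjoint) (auto simp: inverse_eq_divide)
  qed
  ultimately show ?thesis using assms by (simp add: ln_div)
qed

lemma sum_inverse_le:
  assumes "n \<ge> 1"
  shows "(\<Sum>y=1..n. 1 / real y) \<le> 1 + ln (real n)"
proof -
  have "{1..n} = insert 1 {1<..n}" using assms by auto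
  then show ?thesis using sum_inverse_interval_le[of 1 n] assms by simp
qed

lemma card_res_pairs_le:
  assumes "N > 0" "y > 0"
  shows "card (res_pairs N y) \<le> N div (2 * y)"
proof -
  have "fst v \<le> int (N div (2 * y))" if "(a, v) \<in> res_pairs N y" for a v
  proof -
    have "2 * (fst v * int y) < int N" "fst v \<ge> 1"
      using that conv_vecsD(1,4)[of v "int N" "int a"] by (auto simp: res_pairs_def)
    then have "2 * (nat (fst v) * y) < N" by (simp flip: of_nat_less_iff[where ?'a = int])
    then have "nat (fst v) \<le> N div (2 * y)" using assms(2) by (simp add: less_eq_div_iff_mult_less_eq mult_ac)
    then show ?thesis by linarith
  qed
  then have "card (res_pairs N y) = card {(a, v) \<in> res_pairs N y. fst v \<le> int (N div (2 * y))}"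
    by (intro arg_cong[where f = card]) auto
  also have "\<dots> \<le> card (mult_cong_pairs N y (N div (2 * y)))"
    by (rule card_res_pairs_le_card_mult_cong_pairs[OF assms(1)])
  also have "\<dots> \<le> N div (2 * y)" by (rule card_mult_cong_pairs_le[OF assms(1)])
  finally show ?thesis .
qed

lemma sum_card_conv_vecs_le:
  assumes "N > 0"
  shows "(\<Sum>a\<in>totatives N. real (card (conv_vecs (int N) (int a)))) \<le> real N * (1 + ln (real N))"
proof -
  have "conv_vecs (int N) (int a) = res_vecs N {1..N} a" for a
    using conv_vecsD(3,6)[of _ "int N" "int a"] by (fastforce simp: res_vecs_def)
  then have "(\<Sum>a\<in>totatives N. real (card (conv_vecs (int N) (int a)))) =
      (\<Sum>a\<in>totatives N. \<Sum>v\<in>res_vecs N {1..N} a. 1)" by simp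
  also have "\<dots> = 2 * (\<Sum>y=1..N. real (card (res_pairs N y)))"
    by (subst sum_res_vecs) (simp_all add: case_prod_beta)
  also have "\<dots> \<le> 2 * (\<Sum>y=1..N. real N / real (2 * y))"
  proof (intro mult_left_mono sum_mono)
    fix y assume "y \<in> {1..N}"
    then have "card (res_pairs N y) \<le> N div (2 * y)" using assms by (intro card_res_pairs_le) auto
    then have "real (card (res_pairs N y)) \<le> real (N div (2 * y))" by (simp only: of_nat_le_iff)
    also have "\<dots> \<le> real N / real (2 * y)" by (rule real_div_bounds)
    finally show "real (card (res_pairs N y)) \<le> real N / real (2 * y)" .
  qed simp
  also have "\<dots> = real N * (\<Sum>y=1..N. 1 / real y)" by (simp add: sum_distrib_left)
  also have "\<dots> \<le> real N * (1 + ln (real N))"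
    using assms by (intro mult_left_mono sum_inverse_le) auto
  finally show ?thesis .
qed

lemma (in bounded_quality_weight) abs_cross_sum_le:
  assumes "N > 0" "y > 0"
  shows "\<bar>cross_sum g N y\<bar> \<le> real (divisor_count N) * T\<^sup>2 * real y * (1 + ln (real y))"
proof -
  have T: "T \<ge> 0" using weight_nonneg weight_le by (rule order_trans)
  have "(\<Sum>s\<in>totatives y. \<bar>conv_sum g (int y) (int s)\<bar>) \<le> (\<Sum>s\<in>totatives y. T * real (card (conv_vecs (int y) (int s))))"
    by (intro sum_mono abs_conv_sum_le)
  also have "\<dots> \<le> T * (real y * (1 + ln (real y)))"
    unfolding sum_distrib_left[symmetric] by (intro mult_left_mono sum_card_conv_vecs_le assms T)
  finally have "real (divisor_count N) * T * (\<Sum>s\<in>totatives y. \<bar>conv_sum g (int y) (int s)\<bar>) \<le>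
      real (divisor_count N) * T * (T * (real y * (1 + ln (real y))))"
    using T by (intro mult_left_mono) auto
  with abs_cross_sum_le_sum_conv_sum[OF assms] show ?thesis by (simp add: power2_eq_square mult_ac)
qed

subsection \<open>The second moment of the late vectors\<close>

lemma square_sum_ordered:
  fixes x :: "'a \<Rightarrow> 'b :: comm_ring_1" and k :: "'a \<Rightarrow> 'c :: linorder"
  assumes "finite A" "inj_on k A"
  shows "(\<Sum>v\<in>A. x v)\<^sup>2 = (\<Sum>v\<in>A. (x v)\<^sup>2) + 2 * (\<Sum>v\<in>A. x v * (\<Sum>u | u \<in> A \<and> k u > k v. x u))"
proof -
  have split: "(\<Sum>u\<in>A. x u) = x v + (\<Sum>u | u \<in> A \<and> k u > k v. x u) + (\<Sum>u | u \<in> A \<and> k u < k v. x u)"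
    if v: "v \<in> A" for v
  proof -
    have "k u < k v \<or> k u > k v" if "u \<in> A" "u \<noteq> v" for u
      using that v assms(2) by (metis inj_onD neq_iff)
    then have "A = {v} \<union> {u \<in> A. k u > k v} \<union> {u \<in> A. k u < k v}" using v by blast
    then have "(\<Sum>u\<in>A. x u) = (\<Sum>u\<in>{v} \<union> {u \<in> A. k u > k v} \<union> {u \<in> A. k u < k v}. x u)"
      by (rule sum.cong) simp
    also have "\<dots> = (\<Sum>u\<in>{v} \<union> {u \<in> A. k u > k v}. x u) + (\<Sum>u | u \<in> A \<and> k u < k v. x u)"
      using assms(1) by (intro sum.union_disjoint) auto
    also have "(\<Sum>u\<in>{v} \<union> {u \<in> A. k u > k v}. x u) = x v + (\<Sum>u | u \<in> A \<and> k u > k v. x u)"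
      using assms(1) by (subst sum.union_disjoint) auto
    finally show ?thesis .
  qed
  have swap: "(\<Sum>v\<in>A. x v * (\<Sum>u | u \<in> A \<and> k u < k v. x u)) = (\<Sum>v\<in>A. x v * (\<Sum>u | u \<in> A \<and> k u > k v. x u))"
    unfolding sum_distrib_left
    by (subst sum.swap_restrict[OF assms(1,1)]) (simp add: mult.commute)
  have "(\<Sum>v\<in>A. x v)\<^sup>2 = (\<Sum>v\<in>A. x v * (\<Sum>u\<in>A. x u))" by (simp add: power2_eq_square sum_distrib_right)
  also have "\<dots> = (\<Sum>v\<in>A. (x v)\<^sup>2 + x v * (\<Sum>u | u \<in> A \<and> k u > k v. x u) + x v * (\<Sum>u | u \<in> A \<and> k u < k v. x u))"
    by (rule sum.cong[OF refl]) (subst split, auto simp: power2_eq_square distrib_left)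
  also have "\<dots> = (\<Sum>v\<in>A. (x v)\<^sup>2) + 2 * (\<Sum>v\<in>A. x v * (\<Sum>u | u \<in> A \<and> k u > k v. x u))"
    unfolding sum.distrib swap by simp
  finally show ?thesis .
qed

lemma later_in_res_vecs:
  assumes "v \<in> res_vecs N {1..R} a" "u \<in> conv_vecs (int N) (int a)" "fst u > fst v"
  shows "u \<in> res_vecs N {1..R} a"
  using assms conv_vecs_res_decreasing[OF _ assms(2,3)] conv_vecsD(3)[OF assms(2)]
  by (auto simp: res_vecs_def)

lemma sum_late_squared:
  "(\<Sum>v\<in>res_vecs N {1..R} a. signed_term g (int N) (int a) v)\<^sup>2 =
    (\<Sum>v\<in>res_vecs N {1..R} a. (g (quality (int N) (int a) v))\<^sup>2) +
    2 * (\<Sum>v\<in>res_vecs N {1..R} a. signed_term g (int N) (int a) v * tail_sum g (int N) (int a) v)"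
proof -
  let ?L = "res_vecs N {1..R} a"
  have "inj_on fst ?L"
    by (rule inj_on_subset[OF inj_on_fst_conv_vecs]) (auto simp: res_vecs_def)
  moreover have "{u. u \<in> ?L \<and> fst u > fst v} = {u. u \<in> conv_vecs (int N) (int a) \<and> fst u > fst v}"
    if "v \<in> ?L" for v
    using later_in_res_vecs[OF that] by (auto simp: res_vecs_def)
  moreover have "(signed_term g (int N) (int a) v)\<^sup>2 = (g (quality (int N) (int a) v))\<^sup>2" if "v \<in> ?L" for v
    using that by (intro signed_term_squared) (simp add: res_vecs_def)
  ultimately show ?thesis
    using square_sum_ordered[of ?L fst "signed_term g (int N) (int a)"] by (simp add: tail_sum_def)
qed

lemma tail_sum_reflect:
  assumes "a \<in> totatives N"
  shows "tail_sum g (int N) (int (N - a)) (shear_vec (- 1) 1 v) = - tail_sum g (int N) (int a) v"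
  using tail_sum_shear[of "- 1" g "int N" "int a" 1 v] totatives_le[OF assms] by (simp add: of_nat_diff)

lemma signed_term_reflect:
  assumes "a \<in> totatives N"
  shows "signed_term g (int N) (int (N - a)) (shear_vec (- 1) 1 v) = - signed_term g (int N) (int a) v"
  using signed_term_shear_vec[of "- 1" g "int N" "int a" 1 v] totatives_le[OF assms] by (simp add: of_nat_diff)

context quality_weight
begin

lemma abs_sum_tail_sum_minus_cross_sum_le:
  assumes "y > 0"
  shows "\<bar>(\<Sum>(a, v)\<in>res_pairs N y. signed_term g (int N) (int a) v * tail_sum g (int N) (int a) v) - cross_sum g N y\<bar>
    \<le> 4 * (\<Sum>(a, v)\<in>res_pairs N y. g (quality (int N) (int a) v))"
proof -
  have approx: "\<bar>signed_term g (int N) (int a) v * tail_sum g (int N) (int a) v - g (quality (int N) (int a) v) *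
      conv_sum g (int y) (lattice_res (int N) (int a) (complement (int N) (int a) v))\<bar>
      \<le> 4 * g (quality (int N) (int a) v)" if av: "(a, v) \<in> res_pairs N y" for a v
  proof -
    have v: "v \<in> conv_vecs (int N) (int a)" "lattice_res (int N) (int a) v = int y"
      using av by (auto simp: res_pairs_def)
    have "conv_basis (int N) (int a) v (complement (int N) (int a) v)"
      using v assms res_pairsD(1)[OF av assms] by unfold_locales simp_all
    from tail_sum_approx[OF this] have "\<bar>tail_sum g (int N) (int a) v -
        conv_sum g (int y) (lattice_res (int N) (int a) (complement (int N) (int a) v))\<bar> \<le> 4" by (simp add: v(2))
    moreover have "signed_term g (int N) (int a) v = g (quality (int N) (int a) v)"
      using assms by (simp add: signed_term_def v(2))
    ultimately show ?thesis
      using weight_nonneg[of "quality (int N) (int a) v"]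
      by (simp add: abs_mult mult_left_mono mult.commute[of 4] flip: right_diff_distrib)
  qed
  show ?thesis
    unfolding cross_sum_def sum_subtractf[symmetric] sum_distrib_left
    by (rule order_trans[OF sum_abs]) (auto intro!: sum_mono approx)
qed

lemma late_second_moment_le_moments:
  "(\<Sum>a\<in>totatives N. (\<Sum>v\<in>res_vecs N {1..R} a. signed_term g (int N) (int a) v)\<^sup>2) \<le>
    (\<Sum>a\<in>totatives N. \<Sum>v\<in>res_vecs N {1..R} a. (g (quality (int N) (int a) v))\<^sup>2)
    + 8 * (\<Sum>a\<in>totatives N. \<Sum>v\<in>res_vecs N {1..R} a. g (quality (int N) (int a) v))
    + 4 * (\<Sum>y=1..R. \<bar>cross_sum g N y\<bar>)"
proof -
  let ?cross = "\<lambda>y. \<Sum>(a, v)\<in>res_pairs N y. signed_term g (int N) (int a) v * tail_sum g (int N) (int a) v"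
  let ?first = "\<lambda>y. \<Sum>(a, v)\<in>res_pairs N y. g (quality (int N) (int a) v)"
  have "(\<Sum>a\<in>totatives N. \<Sum>v\<in>res_vecs N {1..R} a. signed_term g (int N) (int a) v * tail_sum g (int N) (int a) v) =
      2 * (\<Sum>y=1..R. ?cross y)"
    by (rule sum_res_vecs[where F = "\<lambda>a v. signed_term g (int N) (int a) v * tail_sum g (int N) (int a) v"])
      (simp_all add: signed_term_reflect tail_sum_reflect)
  then have "(\<Sum>a\<in>totatives N. (\<Sum>v\<in>res_vecs N {1..R} a. signed_term g (int N) (int a) v)\<^sup>2) =
      (\<Sum>a\<in>totatives N. \<Sum>v\<in>res_vecs N {1..R} a. (g (quality (int N) (int a) v))\<^sup>2) + 4 * (\<Sum>y=1..R. ?cross y)"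
    unfolding sum_late_squared sum.distrib sum_distrib_left[symmetric] by simp
  moreover have "(\<Sum>y=1..R. ?cross y) \<le> (\<Sum>y=1..R. \<bar>cross_sum g N y\<bar> + 4 * ?first y)"
  proof (intro sum_mono)
    fix y assume "y \<in> {1..R}"
    then show "?cross y \<le> \<bar>cross_sum g N y\<bar> + 4 * ?first y"
      using abs_sum_tail_sum_minus_cross_sum_le[of y N] by (simp add: abs_le_iff) linarith
  qed
  moreover have "(\<Sum>a\<in>totatives N. \<Sum>v\<in>res_vecs N {1..R} a. g (quality (int N) (int a) v)) = 2 * (\<Sum>y=1..R. ?first y)"
    by (intro sum_res_vecs) (simp_all add: quality_reflect)
  ultimately show ?thesis by (simp add: sum.distrib flip: sum_distrib_left)
qed

end

subsection \<open>Capped weights\<close>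

definition capped :: "nat \<Rightarrow> real \<Rightarrow> real" where
  "capped T z = excess (min z (real T))"

interpretation capped: bounded_quality_weight "capped T" "real T" for T
  by unfold_locales (auto simp: capped_def excess_def)

lemma sum_layers_ge:
  fixes w :: "nat \<Rightarrow> real"
  assumes "\<And>i. w i \<ge> 0"
  shows "(\<Sum>i=1..min T (nat \<lfloor>z\<rfloor>). w i) \<le> (\<Sum>i=1..T. w i * of_bool (real i \<le> z))"
proof -
  have "real i \<le> z" if "i \<in> {1..min T (nat \<lfloor>z\<rfloor>)}" for i
  proof -
    have "int i \<le> \<lfloor>z\<rfloor>" using that by (simp add: le_nat_iff) linarith
    then show ?thesis by (simp add: le_floor_iff)
  qed
  then have "(\<Sum>i=1..min T (nat \<lfloor>z\<rfloor>). w i) = (\<Sum>i=1..min T (nat \<lfloor>z\<rfloor>). w i * of_bool (real i \<le> z))"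
    by (intro sum.cong) auto
  also have "\<dots> \<le> (\<Sum>i=1..T. w i * of_bool (real i \<le> z))"
    using assms by (intro sum_mono2) auto
  finally show ?thesis .
qed

lemma capped_le_floor: "capped T z \<le> real (min T (nat \<lfloor>z\<rfloor>))"
proof (cases "z \<le> 2")
  case True
  then show ?thesis by (simp add: capped.weight_vanish)
next
  case False
  then have "z < real (nat \<lfloor>z\<rfloor>) + 1" by linarith
  then show ?thesis by (auto simp: capped_def excess_def min_def)
qed

lemma capped_le_layers: "capped T z \<le> (\<Sum>i=1..T. 1 * of_bool (real i \<le> z))"
  using sum_layers_ge[of "\<lambda>_. 1" T z] capped_le_floor[of T z] by simp

lemma capped_squared_le_layers: "(capped T z)\<^sup>2 \<le> (\<Sum>i=1..T. 2 * real i * of_bool (real i \<le> z))"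
proof -
  let ?k = "min T (nat \<lfloor>z\<rfloor>)"
  have "(capped T z)\<^sup>2 \<le> (real ?k)\<^sup>2" by (intro power_mono capped_le_floor capped.weight_nonneg)
  also have "\<dots> \<le> real ?k * (real ?k + 1)" unfolding power2_eq_square by (intro mult_left_mono) auto
  also have "\<dots> = (\<Sum>i=1..?k. 2 * real i)" by (rule double_sum_real[symmetric])
  also have "\<dots> \<le> (\<Sum>i=1..T. 2 * real i * of_bool (real i \<le> z))" by (rule sum_layers_ge) simp
  finally show ?thesis .
qed

lemma sum_abs_cross_sum_le:
  assumes "N > 0"
  shows "(\<Sum>y=1..R. \<bar>cross_sum (capped T) N y\<bar>) \<le>
    real (divisor_count N) * (real T)\<^sup>2 * (real R)\<^sup>2 * (1 + ln (real R))"
proof -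
  have "(\<Sum>y=1..R. \<bar>cross_sum (capped T) N y\<bar>) \<le>
      (\<Sum>y=1..R. real (divisor_count N) * (real T)\<^sup>2 * real R * (1 + ln (real R)))"
  proof (intro sum_mono)
    fix y assume y: "y \<in> {1..R}"
    have "\<bar>cross_sum (capped T) N y\<bar> \<le> real (divisor_count N) * (real T)\<^sup>2 * real y * (1 + ln (real y))"
      using assms y by (intro capped.abs_cross_sum_le) auto
    also have "\<dots> \<le> real (divisor_count N) * (real T)\<^sup>2 * real R * (1 + ln (real R))"
      using y by (intro mult_mono mult_left_mono add_mono) auto
    finally show "\<bar>cross_sum (capped T) N y\<bar> \<le>
        real (divisor_count N) * (real T)\<^sup>2 * real R * (1 + ln (real R))" .
  qed
  then show ?thesis by (simp add: power2_eq_square mult_ac)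
qed

lemma late_second_moment_le:
  assumes N: "N > 0" and R: "R \<ge> 1"
  shows "(\<Sum>a\<in>totatives N. (\<Sum>v\<in>res_vecs N {1..R} a. signed_term (capped T) (int N) (int a) v)\<^sup>2) \<le>
    20 * (real T * real (totient N) * (1 + ln (real R)))
    + 20 * (real R * (real (divisor_count N))\<^sup>2 * (real T)\<^sup>2)
    + 4 * (real (divisor_count N) * (real T)\<^sup>2 * (real R)\<^sup>2 * (1 + ln (real R)))"
proof -
  define \<phi> B H where "\<phi> = real (totient N)" and "B = real (divisor_count N)" and "H = 1 + ln (real R)"
  have R_sub: "{1..R} \<subseteq> {1..R}" by simp
  have harmonic: "(\<Sum>y=1..R. 1 / real y) \<le> H" unfolding H_def using R by (rule sum_inverse_le)
  have "(\<Sum>a\<in>totatives N. \<Sum>v\<in>res_vecs N {1..R} a. (capped T (quality (int N) (int a) v))\<^sup>2) \<le>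
      2 * (\<phi> * (\<Sum>y=1..R. 1 / real y) * (\<Sum>i=1..T. 2 * real i / real i) + real R * B\<^sup>2 * (\<Sum>i=1..T. 2 * real i))"
    unfolding \<phi>_def B_def by (rule first_moment_le[OF N R_sub _ capped_squared_le_layers]) simp
  also have "(\<Sum>i=1..T. 2 * real i / real i) = 2 * real T" by simp
  also have "\<phi> * (\<Sum>y=1..R. 1 / real y) * (2 * real T) \<le> \<phi> * H * (2 * real T)"
    using harmonic by (intro mult_right_mono mult_left_mono) (auto simp: \<phi>_def)
  finally have square: "(\<Sum>a\<in>totatives N. \<Sum>v\<in>res_vecs N {1..R} a. (capped T (quality (int N) (int a) v))\<^sup>2) \<le>
      2 * (\<phi> * H * (2 * real T) + real R * B\<^sup>2 * (real T * (real T + 1)))"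
    unfolding double_sum_real by simp
  have "(\<Sum>a\<in>totatives N. \<Sum>v\<in>res_vecs N {1..R} a. capped T (quality (int N) (int a) v)) \<le>
      2 * (\<phi> * (\<Sum>y=1..R. 1 / real y) * (\<Sum>i=1..T. 1 / real i) + real R * B\<^sup>2 * (\<Sum>i=1..T. 1))"
    unfolding \<phi>_def B_def by (rule first_moment_le[OF N R_sub _ capped_le_layers]) simp
  also have "\<phi> * (\<Sum>y=1..R. 1 / real y) * (\<Sum>i=1..T. 1 / real i) \<le> \<phi> * H * (\<Sum>i=1..T. 1)"
    using harmonic R by (intro mult_mono sum_mono sum_nonneg mult_nonneg_nonneg) (auto simp: \<phi>_def H_def)
  finally have first: "(\<Sum>a\<in>totatives N. \<Sum>v\<in>res_vecs N {1..R} a. capped T (quality (int N) (int a) v)) \<le>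
      2 * (\<phi> * H * real T + real R * B\<^sup>2 * real T)" by simp
  have cross: "(\<Sum>y=1..R. \<bar>cross_sum (capped T) N y\<bar>) \<le> B * (real T)\<^sup>2 * (real R)\<^sup>2 * H"
    unfolding B_def H_def by (rule sum_abs_cross_sum_le[OF N])
  have "real R * B\<^sup>2 * real T \<le> real R * B\<^sup>2 * (real T)\<^sup>2"
    unfolding power2_eq_square by (intro mult_left_mono) (auto simp: B_def simp flip: of_nat_mult)
  then show ?thesis
    using capped.late_second_moment_le_moments[where N = N and R = R and T = T] square first cross
    unfolding \<phi>_def[symmetric] B_def[symmetric] H_def[symmetric]
    by (simp add: power2_eq_square algebra_simps)
qed

lemma middle_first_moment_le:
  assumes "N > 0" "T \<ge> 1" "R \<ge> 1" "R \<le> n"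
  shows "(\<Sum>a\<in>totatives N. \<Sum>v\<in>res_vecs N {R<..n} a. capped T (quality (int N) (int a) v)) \<le>
    2 * (real (totient N) * (ln (real n / real R) * (1 + ln (real T)))
      + real n * (real (divisor_count N))\<^sup>2 * real T)"
proof -
  have "(\<Sum>a\<in>totatives N. \<Sum>v\<in>res_vecs N {R<..n} a. capped T (quality (int N) (int a) v)) \<le>
      2 * (real (totient N) * (\<Sum>y\<in>{R<..n}. 1 / real y) * (\<Sum>i=1..T. 1 / real i)
        + real n * (real (divisor_count N))\<^sup>2 * (\<Sum>i=1..T. 1))"
    by (rule first_moment_le[OF assms(1) _ _ capped_le_layers]) auto
  also have "real (totient N) * (\<Sum>y\<in>{R<..n}. 1 / real y) * (\<Sum>i=1..T. 1 / real i) \<le>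
      real (totient N) * (ln (real n / real R) * (1 + ln (real T)))"
    unfolding mult.assoc using assms
    by (intro mult_left_mono mult_mono sum_inverse_interval_le sum_inverse_le sum_nonneg) auto
  finally show ?thesis by simp
qed

lemma markov_count:
  fixes f :: "'a \<Rightarrow> real"
  assumes "finite A" "X > 0" "\<And>a. a \<in> A \<Longrightarrow> f a \<ge> 0"
  shows "real (card {a \<in> A. f a \<ge> X}) \<le> (\<Sum>a\<in>A. f a) / X"
proof -
  have "real (card {a \<in> A. f a \<ge> X}) * X = (\<Sum>a | a \<in> A \<and> f a \<ge> X. X)" by simp
  also have "\<dots> \<le> (\<Sum>a | a \<in> A \<and> f a \<ge> X. f a)" by (intro sum_mono) auto
  also have "\<dots> \<le> (\<Sum>a\<in>A. f a)" using assms(1,3) by (intro sum_mono2) auto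
  finally show ?thesis using assms(2) by (simp add: le_divide_eq)
qed

lemma chebyshev_count:
  fixes f :: "'a \<Rightarrow> real"
  assumes "finite A" "X > 0"
  shows "real (card {a \<in> A. \<bar>f a\<bar> \<ge> X}) \<le> (\<Sum>a\<in>A. (f a)\<^sup>2) / X\<^sup>2"
proof -
  have "X \<le> \<bar>f a\<bar> \<longleftrightarrow> X\<^sup>2 \<le> (f a)\<^sup>2" for a
    using assms(2) abs_le_square_iff[of X "f a"] by simp
  then show ?thesis using markov_count[of A "X\<^sup>2" "\<lambda>a. (f a)\<^sup>2"] assms by simp
qed

lemma card_large_quality_le:
  assumes N: "N > 0" and T: "T \<ge> 1" and S: "S \<ge> 1"
  shows "real (card {a \<in> totatives N. \<exists>v\<in>res_vecs N {1..S} a. quality (int N) (int a) v \<ge> real T}) \<le>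
    2 * (real (totient N) * (1 + ln (real S)) / real T + real S * (real (divisor_count N))\<^sup>2)"
proof -
  define h w where "h z = (of_bool (real T \<le> z) :: real)" and "w i = (of_bool (i = T) :: real)" for z and i :: nat
  have single_layer: "(\<Sum>i=1..T. w i * f i) = f T" for f :: "nat \<Rightarrow> real"
    using T sum.delta[of "{1..T}" T f] by (simp add: w_def of_bool_def if_distrib[of "\<lambda>c. c * _"] cong: if_cong)
  have "{a \<in> totatives N. \<exists>v\<in>res_vecs N {1..S} a. quality (int N) (int a) v \<ge> real T} \<subseteq>
      {a \<in> totatives N. (\<Sum>v\<in>res_vecs N {1..S} a. h (quality (int N) (int a) v)) \<ge> 1}"
  proof (intro subsetI CollectI conjI)
    fix a assume "a \<in> {a \<in> totatives N. \<exists>v\<in>res_vecs N {1..S} a. quality (int N) (int a) v \<ge> real T}"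
    then obtain v where v: "v \<in> res_vecs N {1..S} a" "quality (int N) (int a) v \<ge> real T" by auto
    have "h (quality (int N) (int a) v) \<le> (\<Sum>v\<in>res_vecs N {1..S} a. h (quality (int N) (int a) v))"
      using v(1) by (intro member_le_sum) (auto simp: h_def)
    then show "(\<Sum>v\<in>res_vecs N {1..S} a. h (quality (int N) (int a) v)) \<ge> 1" using v(2) by (simp add: h_def)
  qed auto
  then have "real (card {a \<in> totatives N. \<exists>v\<in>res_vecs N {1..S} a. quality (int N) (int a) v \<ge> real T}) \<le>
      real (card {a \<in> totatives N. (\<Sum>v\<in>res_vecs N {1..S} a. h (quality (int N) (int a) v)) \<ge> 1})"
    by (intro of_nat_mono card_mono) auto
  also have "\<dots> \<le> (\<Sum>a\<in>totatives N. \<Sum>v\<in>res_vecs N {1..S} a. h (quality (int N) (int a) v)) / 1"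
    by (intro markov_count sum_nonneg) (auto simp: h_def)
  also have "\<dots> \<le> 2 * (real (totient N) * (\<Sum>y=1..S. 1 / real y) * (\<Sum>i=1..T. w i / real i)
      + real S * (real (divisor_count N))\<^sup>2 * (\<Sum>i=1..T. w i))"
    unfolding div_by_1
    by (rule first_moment_le[OF N order_refl]) (simp_all only: single_layer, simp_all add: h_def w_def)
  also have "(\<Sum>i=1..T. w i / real i) = 1 / real T" using single_layer[of "\<lambda>i. 1 / real i"] by simp
  also have "(\<Sum>i=1..T. w i) = 1" using single_layer[of "\<lambda>_. 1"] by simp
  also have "real (totient N) * (\<Sum>y=1..S. 1 / real y) * (1 / real T) \<le>
      real (totient N) * (1 + ln (real S)) * (1 / real T)"
    using S by (intro mult_right_mono mult_left_mono sum_inverse_le) auto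
  finally show ?thesis by simp
qed

section \<open>The tail estimate\<close>

subsection \<open>Reduction to late and middle vectors\<close>

definition late_sum :: "nat \<Rightarrow> nat \<Rightarrow> nat \<Rightarrow> nat \<Rightarrow> real" where
  "late_sum N T R a = (\<Sum>v\<in>res_vecs N {1..R} a. signed_term (capped T) (int N) (int a) v)"

definition early_sum :: "nat \<Rightarrow> nat \<Rightarrow> nat \<Rightarrow> nat \<Rightarrow> real" where
  "early_sum N T R a = (\<Sum>v\<in>denom_vecs N {1..R} a. signed_term (capped T) (int N) (int a) v)"

definition middle_sum :: "nat \<Rightarrow> nat \<Rightarrow> nat \<Rightarrow> nat \<Rightarrow> real" where
  "middle_sum N T R a = (\<Sum>v\<in>res_vecs N {R<..N div (2 * R)} a. capped T (quality (int N) (int a) v))"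

lemma middle_in_res_vecs:
  assumes "R \<ge> 1" "v \<in> conv_vecs (int N) (int a)" "v \<notin> denom_vecs N {1..R} a" "v \<notin> res_vecs N {1..R} a"
  shows "v \<in> res_vecs N {R<..N div (2 * R)} a"
proof -
  note D = conv_vecsD[OF assms(2)]
  define y where "y = nat \<bar>lattice_res (int N) (int a) v\<bar>"
  have y: "int y = \<bar>lattice_res (int N) (int a) v\<bar>" "y > R" and q: "fst v > int R"
    using assms(2-4) D(1,3) by (auto simp: denom_vecs_def res_vecs_def y_def)
  have "int R * int y \<le> fst v * int y" using q by (intro mult_right_mono) auto
  then have "int (2 * (R * y)) < int N" using D(4) y(1) by simp
  then have "y * (2 * R) \<le> N" by (simp only: of_nat_less_iff) (simp add: mult_ac)
  then have "y \<le> N div (2 * R)" using assms(1) by (simp add: less_eq_div_iff_mult_less_eq)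
  then show ?thesis using assms(2) y(2) by (simp add: res_vecs_def y_def)
qed

lemma abs_conv_sum_capped_le:
  assumes "R \<ge> 1" and disjoint: "denom_vecs N {1..R} a \<inter> res_vecs N {1..R} a = {}"
  shows "\<bar>conv_sum (capped T) (int N) (int a)\<bar> \<le> \<bar>early_sum N T R a\<bar> + \<bar>late_sum N T R a\<bar> + middle_sum N T R a"
proof -
  let ?st = "signed_term (capped T) (int N) (int a)"
  define E L where "E = denom_vecs N {1..R} a" and "L = res_vecs N {1..R} a"
  define M where "M = conv_vecs (int N) (int a) - (E \<union> L)"
  have split: "conv_vecs (int N) (int a) = E \<union> L \<union> M"
    by (auto simp: M_def E_def L_def denom_vecs_def res_vecs_def)
  have fin: "finite E" "finite L" "finite M" by (simp_all add: E_def L_def M_def)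
  have "conv_sum (capped T) (int N) (int a) = (\<Sum>v\<in>E \<union> L. ?st v) + (\<Sum>v\<in>M. ?st v)"
    unfolding conv_sum_def split using fin by (intro sum.union_disjoint) (auto simp: M_def)
  also have "(\<Sum>v\<in>E \<union> L. ?st v) = early_sum N T R a + late_sum N T R a"
    unfolding early_sum_def late_sum_def E_def[symmetric] L_def[symmetric]
    using fin disjoint by (intro sum.union_disjoint) (simp_all add: E_def L_def)
  finally have "conv_sum (capped T) (int N) (int a) = early_sum N T R a + late_sum N T R a + (\<Sum>v\<in>M. ?st v)" .
  moreover have "\<bar>\<Sum>v\<in>M. ?st v\<bar> \<le> (\<Sum>v\<in>M. capped T (quality (int N) (int a) v))"
    by (rule order_trans[OF sum_abs]) (intro sum_mono abs_signed_term_le capped.weight_nonneg)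
  moreover have "(\<Sum>v\<in>M. capped T (quality (int N) (int a) v)) \<le> middle_sum N T R a"
    unfolding middle_sum_def using middle_in_res_vecs[OF assms(1), of _ N a]
    by (intro sum_mono2 capped.weight_nonneg) (auto simp: M_def E_def L_def)
  ultimately show ?thesis by linarith
qed

lemma conv_vecs_eq_denom_Un_res:
  assumes "N < (S + 1) * (S + 1)"
  shows "conv_vecs (int N) (int a) = denom_vecs N {1..S} a \<union> res_vecs N {1..S} a"
proof -
  have "v \<in> denom_vecs N {1..S} a \<union> res_vecs N {1..S} a" if v: "v \<in> conv_vecs (int N) (int a)" for v
  proof (rule ccontr)
    note D = conv_vecsD[OF v]
    assume "v \<notin> denom_vecs N {1..S} a \<union> res_vecs N {1..S} a"
    then have "fst v \<ge> int S + 1" "\<bar>lattice_res (int N) (int a) v\<bar> \<ge> int S + 1"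
      using v D(1,3) by (auto simp: denom_vecs_def res_vecs_def)
    then have "(int S + 1) * (int S + 1) \<le> fst v * \<bar>lattice_res (int N) (int a) v\<bar>" by (intro mult_mono) auto
    moreover have "0 \<le> (int S + 1) * (int S + 1)" by simp
    ultimately have "int ((S + 1) * (S + 1)) < int N" using D(4) by (simp add: algebra_simps)
    then show False using assms by linarith
  qed
  then show ?thesis by (auto simp: denom_vecs_def res_vecs_def)
qed

lemma denom_vecs_res_vecs_disjoint:
  assumes "R * R * T \<le> N" and small: "\<And>v. v \<in> conv_vecs (int N) (int a) \<Longrightarrow> quality (int N) (int a) v < real T"
  shows "denom_vecs N {1..R} a \<inter> res_vecs N {1..R} a = {}"
proof (rule ccontr)
  assume "denom_vecs N {1..R} a \<inter> res_vecs N {1..R} a \<noteq> {}"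
  then obtain v where "v \<in> denom_vecs N {1..R} a" "v \<in> res_vecs N {1..R} a" by blast
  then have v: "v \<in> conv_vecs (int N) (int a)" "fst v \<le> int R"
      "\<bar>lattice_res (int N) (int a) v\<bar> \<le> int R"
    by (simp_all add: denom_vecs_def res_vecs_def nat_le_iff)
  note D = conv_vecsD[OF v(1)]
  define m where "m = fst v * \<bar>lattice_res (int N) (int a) v\<bar>"
  have "m > 0" unfolding m_def using D(1,3) by (intro mult_pos_pos) auto
  have "m \<le> int R * int R" unfolding m_def using v D by (intro mult_mono) auto
  then have "int T * m \<le> int T * (int R * int R)" by (intro mult_left_mono) auto
  also have "\<dots> = int (R * R * T)" by simp
  also have "\<dots> \<le> int N" using assms(1) by (simp only: of_nat_le_iff)
  finally have "real_of_int (int T * m) \<le> real_of_int (int N)" by (simp only: of_int_le_iff)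
  then have "real T \<le> quality (int N) (int a) v"
    using \<open>m > 0\<close> unfolding quality_def m_def[symmetric] by (simp add: le_divide_eq)
  then show False using small[OF v(1)] by simp
qed

lemma large_dedekind_sum_cases:
  assumes N: "N > 0" and a: "coprime a N" and R: "R \<ge> 1" "R * R * T \<le> N" and S: "N < (S + 1) * (S + 1)"
    and X: "6 * log 2 (real N) + 3 * X \<le> 12 * Y" and large: "\<bar>dedekind_sum a N\<bar> \<ge> Y"
  shows "(\<exists>v\<in>denom_vecs N {1..S} a. quality (int N) (int a) v \<ge> real T) \<or>
    (\<exists>v\<in>res_vecs N {1..S} a. quality (int N) (int a) v \<ge> real T) \<or>
    \<bar>early_sum N T R a\<bar> \<ge> X \<or> \<bar>late_sum N T R a\<bar> \<ge> X \<or> middle_sum N T R a \<ge> X"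
proof (cases "\<exists>v\<in>conv_vecs (int N) (int a). quality (int N) (int a) v \<ge> real T")
  case True
  then show ?thesis unfolding conv_vecs_eq_denom_Un_res[OF S] by blast
next
  case False
  then have small: "quality (int N) (int a) v < real T" if "v \<in> conv_vecs (int N) (int a)" for v
    using that by force
  then have "conv_sum excess (int N) (int a) = conv_sum (capped T) (int N) (int a)"
    unfolding conv_sum_def signed_term_def capped_def by (intro sum.cong refl) (simp add: min_absorb1 less_imp_le)
  then have "\<bar>12 * dedekind_sum a N - conv_sum (capped T) (int N) (int a)\<bar> \<le> 6 * log 2 (real N)"
    using abs_dedekind_error_le[OF N a] by (simp add: dedekind_error_def)
  then have "3 * X \<le> \<bar>conv_sum (capped T) (int N) (int a)\<bar>" using X large by linarith
  also have "\<dots> \<le> \<bar>early_sum N T R a\<bar> + \<bar>late_sum N T R a\<bar> + middle_sum N T R a"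
    by (intro abs_conv_sum_capped_le denom_vecs_res_vecs_disjoint[OF R(2) small] R(1))
  finally show ?thesis by linarith
qed

lemma card_large_dedekind_sum_le:
  assumes N: "N > 1" and R: "R \<ge> 1" "R * R * T \<le> N" and S: "N < (S + 1) * (S + 1)"
    and X: "6 * log 2 (real N) + 3 * X \<le> 12 * Y"
  shows "card {a \<in> totatives N. \<bar>dedekind_sum a N\<bar> \<ge> Y} \<le>
    2 * card {a \<in> totatives N. \<exists>v\<in>res_vecs N {1..S} a. quality (int N) (int a) v \<ge> real T}
    + 2 * card {a \<in> totatives N. \<bar>late_sum N T R a\<bar> \<ge> X} + card {a \<in> totatives N. middle_sum N T R a \<ge> X}"
proof -
  let ?D = "{a \<in> totatives N. \<exists>v\<in>denom_vecs N {1..S} a. quality (int N) (int a) v \<ge> real T}"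
  let ?Q = "{a \<in> totatives N. \<exists>v\<in>res_vecs N {1..S} a. quality (int N) (int a) v \<ge> real T}"
  let ?E = "{a \<in> totatives N. \<bar>early_sum N T R a\<bar> \<ge> X}"
  let ?L = "{a \<in> totatives N. \<bar>late_sum N T R a\<bar> \<ge> X}"
  let ?M = "{a \<in> totatives N. middle_sum N T R a \<ge> X}"
  have "{a \<in> totatives N. \<bar>dedekind_sum a N\<bar> \<ge> Y} \<subseteq> ?D \<union> ?Q \<union> ?E \<union> ?L \<union> ?M"
  proof
    fix a assume "a \<in> {a \<in> totatives N. \<bar>dedekind_sum a N\<bar> \<ge> Y}"
    then have "a \<in> totatives N" "coprime a N" "\<bar>dedekind_sum a N\<bar> \<ge> Y" by (auto simp: in_totatives_iff)
    then show "a \<in> ?D \<union> ?Q \<union> ?E \<union> ?L \<union> ?M"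
      using large_dedekind_sum_cases[OF _ _ R S X, of a] N by auto
  qed
  then have "card {a \<in> totatives N. \<bar>dedekind_sum a N\<bar> \<ge> Y} \<le> card (?D \<union> ?Q \<union> ?E \<union> ?L \<union> ?M)"
    by (intro card_mono) auto
  also have "\<dots> \<le> card ?D + card ?Q + card ?E + card ?L + card ?M"
    by (intro order_trans[OF card_Un_le] add_mono order_refl)
  also have "card ?D \<le> card ?Q"
    by (rule card_totatives_le_by_inverse[OF N ex_quality_res_vecs])
  also have "card ?E \<le> card ?L"
    by (rule card_totatives_le_by_inverse[OF N])
      (simp add: early_sum_def late_sum_def sum_signed_term_denom_vecs)
  finally show ?thesis by simp
qed

subsection \<open>Choice of parameters\<close>

lemma ln_ge_1: "N \<ge> 3 \<Longrightarrow> ln (real N) \<ge> 1"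
  using exp_le by (subst ln_ge_iff) auto

lemma log2_le_2_ln:
  assumes "x \<ge> 1"
  shows "log 2 x \<le> 2 * ln x"
proof -
  have "ln x / ln 2 \<le> ln x / (1 / 2)"
    using ln2_ge_two_thirds assms by (intro divide_left_mono) auto
  then show ?thesis by (simp add: log_def)
qed

locale tail_parameters =
  fixes N T :: nat
  assumes N_ge: "N \<ge> 3" and T_ge: "T \<ge> 1"
    and T_le: "(real T)\<^sup>2 * real (divisor_count N) ^ 4 \<le> sqrt (real N)"
begin

abbreviation \<phi> :: real where "\<phi> \<equiv> real (totient N)"
abbreviation B :: real where "B \<equiv> real (divisor_count N)"
abbreviation T\<^sub>r :: real where "T\<^sub>r \<equiv> real T"

definition R :: nat where "R = nat \<lfloor>sqrt (real N) / (B * T\<^sub>r)\<rfloor>"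
definition S :: nat where "S = nat \<lfloor>sqrt (real N)\<rfloor>"
definition n :: nat where "n = N div (2 * R)"

lemma B_ge: "B \<ge> 2"
  using divisor_count_ge_2[of N] N_ge by simp

lemma BT_ge: "B * T\<^sub>r \<ge> 2"
  using mult_mono[of 2 B 1 T\<^sub>r] B_ge T_ge by simp

lemma N_le_B_totient: "real N \<le> B * \<phi>"
  using le_divisor_count_mult_totient[of N] N_ge by (simp flip: of_nat_mult)

lemma ln_N_ge: "ln (real N) \<ge> 1"
  by (rule ln_ge_1[OF N_ge])

lemma power_B_power_T_le_sqrt:
  assumes "i \<le> 4" "j \<le> 2"
  shows "B ^ i * T\<^sub>r ^ j \<le> sqrt (real N)"
proof -
  have "B ^ i * T\<^sub>r ^ j \<le> B ^ 4 * T\<^sub>r ^ 2"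
    using assms B_ge T_ge by (intro mult_mono power_increasing) auto
  then show ?thesis using T_le by (simp add: mult.commute)
qed

lemma sqrt_mult_powers_le_totient:
  assumes "i \<le> 3" "j \<le> 2"
  shows "B ^ i * T\<^sub>r ^ j * sqrt (real N) \<le> \<phi>"
proof -
  have "B * (B ^ i * T\<^sub>r ^ j * sqrt (real N)) = B ^ Suc i * T\<^sub>r ^ j * sqrt (real N)" by simp
  also have "\<dots> \<le> sqrt (real N) * sqrt (real N)"
    using assms by (intro mult_right_mono power_B_power_T_le_sqrt) auto
  also have "\<dots> \<le> B * \<phi>" using N_le_B_totient by simp
  finally show ?thesis using B_ge by simp
qed

lemma R_bounds: "R \<ge> 1" "real R * (B * T\<^sub>r) \<le> sqrt (real N)" "sqrt (real N) \<le> 2 * (real R * (B * T\<^sub>r))"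
proof -
  let ?\<rho> = "sqrt (real N) / (B * T\<^sub>r)"
  have pos: "B * T\<^sub>r > 0" using BT_ge by linarith
  have "1 * (B * T\<^sub>r) \<le> sqrt (real N)" using power_B_power_T_le_sqrt[of 1 1] by simp
  then have "1 \<le> ?\<rho>" using pos by (simp only: le_divide_eq) simp
  then have "1 \<le> \<lfloor>?\<rho>\<rfloor>" by simp
  then have R: "R \<ge> 1" "real R \<le> ?\<rho>" "?\<rho> \<le> 2 * real R" unfolding R_def by linarith+
  show "R \<ge> 1" by (rule R(1))
  show "real R * (B * T\<^sub>r) \<le> sqrt (real N)" using R(2) pos by (simp only: pos_le_divide_eq)
  show "sqrt (real N) \<le> 2 * (real R * (B * T\<^sub>r))" using R(3) pos by (simp only: pos_divide_le_eq mult.assoc)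
qed

lemma R_BT_squared_le: "(real R * (B * T\<^sub>r))\<^sup>2 \<le> real N"
  using power_mono[OF R_bounds(2), of 2] by simp

lemma R_squared_mult_le: "(real R)\<^sup>2 * x \<le> real N" if "x \<le> (B * T\<^sub>r)\<^sup>2"
  using R_BT_squared_le mult_left_mono[OF that, of "(real R)\<^sup>2"] by (simp add: power_mult_distrib)

lemma R_R_T_le: "R * R * T \<le> N"
proof -
  have "T\<^sub>r * 1 \<le> (B * T\<^sub>r) * (B * T\<^sub>r)" using B_ge BT_ge T_ge by (intro mult_mono) auto
  then have "real (R * R * T) \<le> real N"
    using R_squared_mult_le[of T\<^sub>r] by (simp add: power2_eq_square)
  then show ?thesis by (simp only: of_nat_le_iff)
qed

lemma R_le_n: "R \<le> n"
proof -
  have "2\<^sup>2 \<le> (B * T\<^sub>r)\<^sup>2" using BT_ge by (intro power_mono) auto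
  then have "real (R * (2 * R)) \<le> real N"
    using R_squared_mult_le[of 2] by (simp add: power2_eq_square)
  then have "R * (2 * R) \<le> N" by (simp only: of_nat_le_iff)
  then show ?thesis unfolding n_def using R_bounds(1) by (simp add: less_eq_div_iff_mult_less_eq)
qed

lemma n_le: "real n \<le> sqrt (real N) * (B * T\<^sub>r)"
proof -
  have "real N \<le> sqrt (real N) * (2 * (real R * (B * T\<^sub>r)))"
    using mult_left_mono[OF R_bounds(3), of "sqrt (real N)"] by simp
  then have "real N / real (2 * R) \<le> sqrt (real N) * (B * T\<^sub>r)"
    using R_bounds(1) by (simp add: divide_le_eq mult_ac)
  then show ?thesis unfolding n_def using real_div_bounds(1)[of N "2 * R"] by linarith
qed

lemma ln_n_div_R_le: "ln (real n / real R) \<le> 1 + 2 * ln B + 2 * ln T\<^sub>r"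
proof -
  have "sqrt (real N) * (B * T\<^sub>r) \<le> 2 * (real R * (B * T\<^sub>r)) * (B * T\<^sub>r)"
    using R_bounds(3) by (intro mult_right_mono) auto
  then have "real n \<le> 2 * (B * T\<^sub>r)\<^sup>2 * real R" using n_le by (simp add: power2_eq_square mult_ac)
  then have "real n / real R \<le> 2 * (B * T\<^sub>r)\<^sup>2" using R_bounds(1) by (simp add: divide_le_eq)
  then have "ln (real n / real R) \<le> ln (2 * (B * T\<^sub>r)\<^sup>2)" using R_le_n R_bounds(1) by (intro ln_mono) auto
  also have "\<dots> = ln 2 + 2 * (ln B + ln T\<^sub>r)" using B_ge T_ge by (simp add: ln_mult ln_realpow)
  also have "\<dots> \<le> 1 + 2 * ln B + 2 * ln T\<^sub>r" using ln_2_less_1 by simp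
  finally show ?thesis .
qed

lemma one_plus_ln_le: "1 \<le> x \<Longrightarrow> x \<le> sqrt (real N) \<Longrightarrow> 1 + ln x \<le> 2 * ln (real N)"
proof -
  assume x: "1 \<le> x" "x \<le> sqrt (real N)"
  have "sqrt (real N) * 1 \<le> sqrt (real N) * sqrt (real N)" using N_ge by (intro mult_left_mono) auto
  then have "ln x \<le> ln (real N)" using x by (intro ln_mono) auto
  then show ?thesis using ln_N_ge by simp
qed

lemma one_plus_ln_R_le: "1 + ln (real R) \<le> 2 * ln (real N)"
proof (rule one_plus_ln_le)
  have "real R * 1 \<le> real R * (B * T\<^sub>r)" using BT_ge by (intro mult_left_mono) auto
  then show "real R \<le> sqrt (real N)" using R_bounds(2) by simp
qed (use R_bounds(1) in simp)

lemma S_bounds: "S \<ge> 1" "real S \<le> sqrt (real N)" "N < (S + 1) * (S + 1)"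
proof -
  have "sqrt (real N) \<ge> 1" using N_ge by simp
  then show "S \<ge> 1" "real S \<le> sqrt (real N)" unfolding S_def by linarith+
  have "sqrt (real N) < real S + 1" unfolding S_def by linarith
  then have "sqrt (real N) * sqrt (real N) < (real S + 1) * (real S + 1)" by (intro mult_strict_mono) auto
  then have "real N < real ((S + 1) * (S + 1))" by (simp add: algebra_simps)
  then show "N < (S + 1) * (S + 1)" by (simp only: of_nat_less_iff)
qed

lemma late_second_moment_bound: "(\<Sum>a\<in>totatives N. (late_sum N T R a)\<^sup>2) \<le> 68 * (T\<^sub>r * \<phi> * ln (real N))"
proof -
  define u H where "u = ln (real N)" and "H = 1 + ln (real R)"
  have u: "u \<ge> 1" "H \<le> 2 * u" using ln_N_ge one_plus_ln_R_le by (simp_all add: u_def H_def)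
  have "1 * (\<phi> * u) \<le> T\<^sub>r * (\<phi> * u)" "\<phi> * 1 \<le> \<phi> * u"
    using T_ge u by (intro mult_right_mono mult_left_mono; simp)+
  moreover have "T\<^sub>r * \<phi> * H \<le> T\<^sub>r * \<phi> * (2 * u)" using u by (intro mult_left_mono) auto
  moreover have "real R * B\<^sup>2 * T\<^sub>r\<^sup>2 \<le> \<phi>"
  proof -
    have "real R * B\<^sup>2 * T\<^sub>r\<^sup>2 = B * T\<^sub>r * (real R * (B * T\<^sub>r))" by (simp add: power2_eq_square mult_ac)
    also have "\<dots> \<le> B * T\<^sub>r * sqrt (real N)" using R_bounds(2) by (intro mult_left_mono) auto
    also have "\<dots> \<le> \<phi>" using sqrt_mult_powers_le_totient[of 1 1] by simp
    finally show ?thesis .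
  qed
  moreover have "B * T\<^sub>r\<^sup>2 * (real R)\<^sup>2 * H \<le> \<phi> * (2 * u)"
  proof (rule mult_mono)
    have "B * (B * T\<^sub>r\<^sup>2 * (real R)\<^sup>2) = (real R * (B * T\<^sub>r))\<^sup>2" by (simp add: power2_eq_square mult_ac)
    also have "\<dots> \<le> B * \<phi>" using R_BT_squared_le N_le_B_totient by linarith
    finally show "B * T\<^sub>r\<^sup>2 * (real R)\<^sup>2 \<le> \<phi>" using B_ge by simp
  qed (use u R_bounds(1) in \<open>auto simp: H_def\<close>)
  ultimately have "20 * (T\<^sub>r * \<phi> * H) + 20 * (real R * B\<^sup>2 * T\<^sub>r\<^sup>2)
      + 4 * (B * T\<^sub>r\<^sup>2 * (real R)\<^sup>2 * H) \<le> 68 * (T\<^sub>r * \<phi> * u)"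
    by (simp add: mult_ac)
  moreover have "(\<Sum>a\<in>totatives N. (late_sum N T R a)\<^sup>2) \<le>
      20 * (T\<^sub>r * \<phi> * H) + 20 * (real R * B\<^sup>2 * T\<^sub>r\<^sup>2) + 4 * (B * T\<^sub>r\<^sup>2 * (real R)\<^sup>2 * H)"
    unfolding late_sum_def H_def using N_ge R_bounds(1) by (intro late_second_moment_le) auto
  ultimately show ?thesis by (simp add: u_def)
qed

lemma middle_first_moment_bound:
  "(\<Sum>a\<in>totatives N. middle_sum N T R a) \<le> 2 * \<phi> * ((1 + ln T\<^sub>r) * (1 + 2 * ln B + 2 * ln T\<^sub>r) + 1)"
proof -
  have "(\<Sum>a\<in>totatives N. middle_sum N T R a) \<le>
      2 * (\<phi> * (ln (real n / real R) * (1 + ln T\<^sub>r)) + real n * B\<^sup>2 * T\<^sub>r)"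
    unfolding middle_sum_def n_def[symmetric] using N_ge T_ge R_bounds(1) R_le_n
    by (intro middle_first_moment_le) auto
  also have "real n * B\<^sup>2 * T\<^sub>r \<le> sqrt (real N) * (B * T\<^sub>r) * B\<^sup>2 * T\<^sub>r"
    by (intro mult_right_mono n_le) auto
  also have "\<dots> = B ^ 3 * T\<^sub>r ^ 2 * sqrt (real N)" by (simp add: power2_eq_square power3_eq_cube mult_ac)
  also have "\<dots> \<le> \<phi>" by (rule sqrt_mult_powers_le_totient) auto
  also have "\<phi> * (ln (real n / real R) * (1 + ln T\<^sub>r)) \<le> \<phi> * ((1 + 2 * ln B + 2 * ln T\<^sub>r) * (1 + ln T\<^sub>r))"
    using T_ge by (intro mult_left_mono mult_right_mono ln_n_div_R_le) auto
  finally show ?thesis by (simp add: algebra_simps)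
qed

lemma card_large_quality_bound:
  "real (card {a \<in> totatives N. \<exists>v\<in>res_vecs N {1..S} a. quality (int N) (int a) v \<ge> T\<^sub>r}) \<le>
    6 * (\<phi> * ln (real N) / T\<^sub>r)"
proof -
  have "real (card {a \<in> totatives N. \<exists>v\<in>res_vecs N {1..S} a. quality (int N) (int a) v \<ge> T\<^sub>r}) \<le>
      2 * (\<phi> * (1 + ln (real S)) / T\<^sub>r + real S * B\<^sup>2)"
    using N_ge T_ge S_bounds(1) by (intro card_large_quality_le) auto
  also have "\<phi> * (1 + ln (real S)) / T\<^sub>r \<le> \<phi> * (2 * ln (real N)) / T\<^sub>r"
    using S_bounds by (intro divide_right_mono mult_left_mono one_plus_ln_le) auto
  also have "real S * B\<^sup>2 \<le> \<phi> * ln (real N) / T\<^sub>r"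
  proof -
    have "T\<^sub>r * (real S * B\<^sup>2) \<le> T\<^sub>r * (sqrt (real N) * B\<^sup>2)"
      using S_bounds(2) by (intro mult_left_mono mult_right_mono) auto
    also have "\<dots> \<le> \<phi> * 1" using sqrt_mult_powers_le_totient[of 2 1] by (simp add: mult_ac)
    also have "\<dots> \<le> \<phi> * ln (real N)" using ln_N_ge by (intro mult_left_mono) auto
    finally show ?thesis using T_ge by (simp add: le_divide_eq mult.commute)
  qed
  finally show ?thesis by simp
qed

lemma card_late_sum_ge_bound:
  assumes "t > 0" "T\<^sub>r \<le> 2 * (t * ln (real N))"
  shows "real (card {a \<in> totatives N. \<bar>late_sum N T R a\<bar> \<ge> t * ln (real N)}) \<le> 136 * (\<phi> / t)"
proof -
  define u where "u = ln (real N)"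
  have u: "u \<ge> 1" and tu: "t * u > 0" using ln_N_ge assms(1) by (simp_all add: u_def)
  have "real (card {a \<in> totatives N. \<bar>late_sum N T R a\<bar> \<ge> t * u}) \<le>
      (\<Sum>a\<in>totatives N. (late_sum N T R a)\<^sup>2) / (t * u)\<^sup>2"
    using tu by (intro chebyshev_count) auto
  also have "\<dots> \<le> 68 * (T\<^sub>r * \<phi> * u) / (t * u)\<^sup>2"
    unfolding u_def by (intro divide_right_mono late_second_moment_bound) simp
  also have "\<dots> \<le> 68 * (2 * (t * u) * \<phi> * u) / (t * u)\<^sup>2"
    using assms(2) u by (intro divide_right_mono mult_left_mono mult_right_mono) (auto simp: u_def)
  also have "\<dots> = 136 * (\<phi> / t)" using assms(1) u by (simp add: power2_eq_square)
  finally show ?thesis by (simp add: u_def)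
qed

lemma card_middle_sum_ge_bound:
  assumes "t > 0" "(1 + ln T\<^sub>r) * (1 + 2 * ln B + 2 * ln T\<^sub>r) \<le> K * ln (real N)"
  shows "real (card {a \<in> totatives N. middle_sum N T R a \<ge> t * ln (real N)}) \<le> (2 * K + 2) * (\<phi> / t)"
proof -
  define u where "u = ln (real N)"
  have u: "u \<ge> 1" and tu: "t * u > 0" using ln_N_ge assms(1) by (simp_all add: u_def)
  have "real (card {a \<in> totatives N. middle_sum N T R a \<ge> t * u}) \<le>
      (\<Sum>a\<in>totatives N. middle_sum N T R a) / (t * u)"
    using tu by (intro markov_count) (auto simp: middle_sum_def intro: sum_nonneg capped.weight_nonneg)
  also have "\<dots> \<le> 2 * \<phi> * ((1 + ln T\<^sub>r) * (1 + 2 * ln B + 2 * ln T\<^sub>r) + 1) / (t * u)"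
    using tu by (intro divide_right_mono middle_first_moment_bound) auto
  also have "\<dots> \<le> 2 * \<phi> * ((K + 1) * u) / (t * u)"
    using assms(2) u tu by (intro divide_right_mono mult_left_mono) (auto simp: u_def distrib_right)
  also have "\<dots> = (2 * K + 2) * (\<phi> / t)" using assms(1) u by (simp add: field_simps)
  finally show ?thesis by (simp add: u_def)
qed

lemma card_dedekind_sum_bound:
  assumes t: "t \<ge> 2" "t * ln (real N) \<le> T\<^sub>r" "T\<^sub>r \<le> 2 * (t * ln (real N))"
    and K: "(1 + ln T\<^sub>r) * (1 + 2 * ln B + 2 * ln T\<^sub>r) \<le> K * ln (real N)"
  shows "real (card {a \<in> totatives N. \<bar>dedekind_sum a N\<bar> \<ge> t * ln (real N)}) \<le> (286 + 2 * K) * (\<phi> / t)"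
proof -
  define u where "u = ln (real N)"
  have u: "u \<ge> 1" and tu: "t * u > 0" using ln_N_ge t(1) by (simp_all add: u_def)
  have "log 2 (real N) \<le> 2 * u" unfolding u_def using N_ge by (intro log2_le_2_ln) simp
  moreover have "2 * u \<le> t * u" using t(1) u by (intro mult_right_mono) auto
  ultimately have "6 * log 2 (real N) + 3 * (t * u) \<le> 12 * (t * u)" using u by linarith
  then have "real (card {a \<in> totatives N. \<bar>dedekind_sum a N\<bar> \<ge> t * u}) \<le>
      real (2 * card {a \<in> totatives N. \<exists>v\<in>res_vecs N {1..S} a. quality (int N) (int a) v \<ge> T\<^sub>r}
      + 2 * card {a \<in> totatives N. \<bar>late_sum N T R a\<bar> \<ge> t * u}
      + card {a \<in> totatives N. middle_sum N T R a \<ge> t * u})"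
    using N_ge R_bounds(1) R_R_T_le S_bounds(3) by (intro of_nat_mono card_large_dedekind_sum_le) auto
  moreover have "\<phi> * u / T\<^sub>r \<le> \<phi> * u / (t * u)"
    using t(2) tu u by (intro divide_left_mono) (auto simp: u_def)
  then have "real (card {a \<in> totatives N. \<exists>v\<in>res_vecs N {1..S} a. quality (int N) (int a) v \<ge> T\<^sub>r}) \<le> 6 * (\<phi> / t)"
    using card_large_quality_bound u by (simp add: u_def)
  moreover have "real (card {a \<in> totatives N. \<bar>late_sum N T R a\<bar> \<ge> t * u}) \<le> 136 * (\<phi> / t)"
    unfolding u_def using t by (intro card_late_sum_ge_bound) auto
  moreover have "real (card {a \<in> totatives N. middle_sum N T R a \<ge> t * u}) \<le> (2 * K + 2) * (\<phi> / t)"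
    unfolding u_def using t(1) K by (intro card_middle_sum_ge_bound) auto
  ultimately show ?thesis unfolding u_def[symmetric] by (simp add: algebra_simps)
qed

end

subsection \<open>Asymptotics\<close>

lemma ln_divisor_count_le:
  assumes "ln (real N) > 1"
  shows "ln (real (divisor_count N)) \<le>
    sqrt (ln (real N)) * ln (1 + 2 * ln (real N)) + 2 * ln (real N) / ln (ln (real N))"
proof -
  define u x where "u = ln (real N)" and "x = sqrt (ln (real N))"
  have u: "u > 1" "x > 1" using assms by (simp_all add: u_def x_def)
  have N: "N > 0" using assms by (intro Nat.gr0I) auto
  have log2: "0 \<le> log 2 (real N)" "log 2 (real N) \<le> 2 * u"
    using N log2_le_2_ln[of "real N"] by (simp_all add: u_def)
  have "ln (real (divisor_count N)) \<le> ln ((1 + log 2 (real N)) powr x * 2 powr (log x (real N)))"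
    using divisor_count_le_powr[OF N u(2)] divisor_count_pos[OF N] by (intro ln_mono) auto
  also have "\<dots> = x * ln (1 + log 2 (real N)) + log x (real N) * ln 2"
    using log2 by (simp add: ln_mult ln_powr)
  also have "x * ln (1 + log 2 (real N)) \<le> x * ln (1 + 2 * u)"
    using log2 u by (intro mult_left_mono ln_mono) auto
  also have "log x (real N) * ln 2 = (2 * u / ln u) * ln 2"
    using u by (simp add: log_def u_def x_def ln_sqrt)
  also have "\<dots> \<le> (2 * u / ln u) * 1" using u ln_2_less_1 by (intro mult_left_mono) auto
  finally show ?thesis by (simp add: u_def x_def)
qed

lemma eventually_cap_conditions:
  fixes C :: real
  assumes "C > 0"
  defines "\<beta> \<equiv> \<lambda>u. sqrt u * ln (1 + 2 * u) + 2 * u / ln u"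
    and "\<tau> \<equiv> \<lambda>u. 1 + (C + 1) * ln u"
  shows "eventually (\<lambda>u. 2 * \<tau> u + 4 * \<beta> u \<le> u / 2) at_top"
    "eventually (\<lambda>u. (1 + \<tau> u) * (1 + 2 * \<beta> u + 2 * \<tau> u) \<le> 8 * (C + 1) * u) at_top"
proof -
  have "((\<lambda>u. (2 * \<tau> u + 4 * \<beta> u) / u) \<longlongrightarrow> 0) at_top"
    unfolding \<beta>_def \<tau>_def by real_asymp
  then have "eventually (\<lambda>u. (2 * \<tau> u + 4 * \<beta> u) / u < 1 / 2) at_top"
    by (rule order_tendstoD) simp
  then show "eventually (\<lambda>u. 2 * \<tau> u + 4 * \<beta> u \<le> u / 2) at_top"
    using eventually_gt_at_top[of 0] by eventually_elim (simp add: field_simps)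
  have "((\<lambda>u. ((1 + \<tau> u) * (1 + 2 * \<beta> u + 2 * \<tau> u)) / u) \<longlongrightarrow> 4 * (C + 1)) at_top"
    unfolding \<beta>_def \<tau>_def using assms(1) by real_asymp
  then have "eventually (\<lambda>u. ((1 + \<tau> u) * (1 + 2 * \<beta> u + 2 * \<tau> u)) / u < 8 * (C + 1)) at_top"
    by (rule order_tendstoD) (use assms(1) in simp)
  then show "eventually (\<lambda>u. (1 + \<tau> u) * (1 + 2 * \<beta> u + 2 * \<tau> u) \<le> 8 * (C + 1) * u) at_top"
    using eventually_gt_at_top[of 0] by eventually_elim (simp add: field_simps)
qed

lemma tail_parametersI:
  assumes "N \<ge> 3" "T \<ge> 1" "2 * ln (real T) + 4 * ln (real (divisor_count N)) \<le> ln (real N) / 2"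
  shows "tail_parameters N T"
proof
  have B: "real (divisor_count N) > 0" using divisor_count_pos[of N] assms(1) by simp
  have "ln ((real T)\<^sup>2 * real (divisor_count N) ^ 4) = 2 * ln (real T) + 4 * ln (real (divisor_count N))"
    using assms(2) B by (simp add: ln_mult ln_realpow)
  also have "\<dots> \<le> ln (sqrt (real N))" using assms(1,3) by (simp add: ln_sqrt)
  finally show "(real T)\<^sup>2 * real (divisor_count N) ^ 4 \<le> sqrt (real N)"
    using assms(1,2) B by (subst (asm) ln_le_cancel_iff) auto
qed (use assms in auto)

lemma ln_le_if_le_powr:
  assumes "u > 1" "x \<ge> 1" "x \<le> 2 * u powr p"
  shows "ln x \<le> 1 + p * ln (u :: real)"
proof -
  have "ln x \<le> ln (2 * u powr p)" using assms by (intro ln_mono) auto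
  also have "\<dots> = ln 2 + p * ln u" using assms(1) by (simp add: ln_mult ln_powr)
  finally show ?thesis using ln_2_less_1 by linarith
qed

lemma eventually_tail_parameters:
  fixes C :: real
  assumes C: "C > 0"
  shows "\<forall>\<^sub>F N in at_top. \<forall>T\<ge>1. real T \<le> 2 * ln (real N) powr (C + 1) \<longrightarrow> tail_parameters N T \<and>
    (1 + ln (real T)) * (1 + 2 * ln (real (divisor_count N)) + 2 * ln (real T)) \<le> 8 * (C + 1) * ln (real N)"
proof -
  define \<beta> \<tau> where "\<beta> u = sqrt u * ln (1 + 2 * u) + 2 * u / ln u" and "\<tau> u = 1 + (C + 1) * ln u" for u :: real
  have "\<forall>\<^sub>F u in at_top. 2 * \<tau> u + 4 * \<beta> u \<le> u / 2 \<and>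
      (1 + \<tau> u) * (1 + 2 * \<beta> u + 2 * \<tau> u) \<le> 8 * (C + 1) * u \<and> u > 1"
    unfolding \<beta>_def \<tau>_def
    by (intro eventually_conj eventually_cap_conditions[OF C] eventually_gt_at_top)
  moreover have "filterlim (\<lambda>N. ln (real N)) at_top at_top" by real_asymp
  ultimately have "\<forall>\<^sub>F N in at_top. 2 * \<tau> (ln (real N)) + 4 * \<beta> (ln (real N)) \<le> ln (real N) / 2 \<and>
      (1 + \<tau> (ln (real N))) * (1 + 2 * \<beta> (ln (real N)) + 2 * \<tau> (ln (real N))) \<le> 8 * (C + 1) * ln (real N) \<and>
      ln (real N) > 1"
    by (rule eventually_compose_filterlim)
  with eventually_ge_at_top[of 3] show ?thesis
  proof eventually_elim
    case (elim N)
    define u B where "u = ln (real N)" and "B = real (divisor_count N)"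
    note u = elim(2)[folded u_def]
    have B: "B \<ge> 1" "ln B \<le> \<beta> u"
      using divisor_count_pos[of N] ln_divisor_count_le[of N] elim(1) u
      by (auto simp: B_def \<beta>_def u_def Suc_le_eq)
    show ?case
    proof (intro allI impI)
      fix T :: nat assume T_bounds: "T \<ge> 1" "real T \<le> 2 * ln (real N) powr (C + 1)"
      have T: "ln (real T) \<le> \<tau> u"
        unfolding \<tau>_def using u T_bounds by (intro ln_le_if_le_powr) (simp_all add: u_def)
      have "tail_parameters N T"
        using elim(1) T_bounds(1) B(2) T u by (intro tail_parametersI) (simp_all add: B_def u_def)
      moreover have "0 \<le> ln (real T)" "0 \<le> ln B" using T_bounds(1) B(1) by simp_all
      then have "(1 + ln (real T)) * (1 + 2 * ln B + 2 * ln (real T)) \<le> (1 + \<tau> u) * (1 + 2 * \<beta> u + 2 * \<tau> u)"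
        using B(2) T by (intro mult_mono) auto
      ultimately show "tail_parameters N T \<and> (1 + ln (real T)) *
          (1 + 2 * ln (real (divisor_count N)) + 2 * ln (real T)) \<le> 8 * (C + 1) * ln (real N)"
        using u by (simp add: B_def u_def)
    qed
  qed
qed

lemma eventually_dedekind_sum_tail:
  fixes C :: real
  assumes "C > 0"
  shows "\<forall>\<^sub>F N in at_top. \<forall>t\<ge>2. t \<le> ln (real N) powr C \<longrightarrow>
    real (card {a \<in> totatives N. \<bar>dedekind_sum a N\<bar> \<ge> t * ln (real N)}) \<le>
      (286 + 16 * (C + 1)) * (real (totient N) / t)"
  using eventually_tail_parameters[OF assms] eventually_ge_at_top[of 3]
proof eventually_elim
  case (elim N)
  define u where "u = ln (real N)"
  have u: "u \<ge> 1" unfolding u_def using elim(2) by (rule ln_ge_1)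
  show ?case
  proof (intro allI impI)
    fix t :: real assume t: "t \<ge> 2" "t \<le> ln (real N) powr C"
    define T where "T = nat \<lceil>t * u\<rceil>"
    have "2 * 1 \<le> t * u" using t(1) u by (intro mult_mono) auto
    then have T: "T \<ge> 1" "t * u \<le> real T" "real T \<le> 2 * (t * u)" unfolding T_def by linarith+
    have "t * u \<le> u powr C * u" using t(2) u by (intro mult_right_mono) (auto simp: u_def)
    also have "\<dots> = u powr (C + 1)" using u by (simp add: powr_add)
    finally have "real T \<le> 2 * u powr (C + 1)" using T(3) by linarith
    then have parameters: "tail_parameters N T"
      "(1 + ln (real T)) * (1 + 2 * ln (real (divisor_count N)) + 2 * ln (real T)) \<le> 8 * (C + 1) * ln (real N)"
      using elim(1) T(1) by (simp_all add: u_def)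
    then show "real (card {a \<in> totatives N. \<bar>dedekind_sum a N\<bar> \<ge> t * ln (real N)}) \<le>
        (286 + 16 * (C + 1)) * (real (totient N) / t)"
      using tail_parameters.card_dedekind_sum_bound[OF parameters(1) t(1) _ _ parameters(2)] T by (simp add: u_def)
  qed
qed

lemma card_dedekind_sum_le_of_le:
  fixes t K :: real
  assumes "0 < t" "t \<le> K"
  shows "real (card {a \<in> totatives N. \<bar>dedekind_sum a N\<bar> \<ge> t * ln (real N)}) \<le> K * (real (totient N) / t)"
proof -
  have "real (card {a \<in> totatives N. \<bar>dedekind_sum a N\<bar> \<ge> t * ln (real N)}) \<le> 1 * real (totient N)"
    unfolding totient_def mult_1 by (intro of_nat_mono card_mono) auto
  also have "\<dots> \<le> (K / t) * real (totient N)"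
    using assms by (intro mult_right_mono) auto
  finally show ?thesis by simp
qed

theorem theorem4:
  fixes C :: real
  assumes "C > 0"
  shows "\<exists>K > 0. \<forall>N::nat. \<forall>t::real. N \<ge> 3 \<longrightarrow> 0 < t \<longrightarrow> t \<le> ln (real N) powr C \<longrightarrow>
           1 / real (totient N) *
             real (card {a \<in> totatives N. \<bar>dedekind_sum a N\<bar> \<ge> t * ln (real N)}) \<le> K * (1 / t)"
proof -
  define c where "c N t = real (card {a \<in> totatives N. \<bar>dedekind_sum a N\<bar> \<ge> t * ln (real N)})" for N t
  define K\<^sub>0 where "K\<^sub>0 = 286 + 16 * (C + 1)"
  obtain N\<^sub>0 where large: "c N t \<le> K\<^sub>0 * (real (totient N) / t)"
    if "N \<ge> N\<^sub>0" "t \<ge> 2" "t \<le> ln (real N) powr C" for N t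
    using eventually_dedekind_sum_tail[OF assms] unfolding eventually_at_top_linorder c_def K\<^sub>0_def by blast
  define K where "K = K\<^sub>0 + ln (real N\<^sub>0 + 3) powr C"
  have K: "K\<^sub>0 \<ge> 2" "K\<^sub>0 \<le> K" "ln (real N\<^sub>0 + 3) powr C \<le> K" using assms by (simp_all add: K\<^sub>0_def K_def)
  have "c N t \<le> K * (real (totient N) / t)" if "N \<ge> 3" "0 < t" "t \<le> ln (real N) powr C" for N t
  proof (cases "N \<ge> N\<^sub>0 \<and> t \<ge> 2")
    case True
    then show ?thesis using large[of N t] that mult_right_mono[OF K(2), of "real (totient N) / t"] by simp
  next
    case False
    have "ln (real N) powr C \<le> ln (real N\<^sub>0 + 3) powr C" if "N < N\<^sub>0"
      using assms \<open>N \<ge> 3\<close> that by (intro powr_mono2 ln_mono) auto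
    then have "t \<le> K" using False K that by force
    then show ?thesis unfolding c_def using that by (intro card_dedekind_sum_le_of_le)
  qed
  then have "1 / real (totient N) * c N t \<le> K * (1 / t)" if "N \<ge> 3" "0 < t" "t \<le> ln (real N) powr C" for N t
    using that by (fastforce simp: field_simps)
  then show ?thesis using K unfolding c_def by (intro exI[of _ K]) auto
qed

end
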